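(* For the Besov spaces $B^\sigma_{2,\infty}$ defined on the Sierpinski sickle $K$ (with its normalized $\alpha$-Hausdorff measure $\mu$, $\alpha=\log17/\log7$), the critical exponents are $$\sigma^*=\frac12\Big(1+\frac{\log17}{\log7}\Big),\qquad\sigma^\#=\frac12\Big(\frac{2\log17-\log2}{\log7}\Big).$$ Moreover, (i) $B^{\sigma^*}_{2,\infty}$ is dense in $C(K)$; (ii) for $\sigma^*<\sigma\le\sigma^\#$, $B^\sigma_{2,\infty}$ is dense in $L^2(K,\mu)$.
   Context: **Sierpinski sickle.** Let $p_1=(0,0)$, $p_2=(1,0)$, $p_3=(\frac12,\frac{\sqrt3}2)$, $V_0=\{p_1,p_2,p_3\}$. For integers $i,j\ge0$ put $q(i,j)=\frac17(i\,p_2+j\,p_3)$; for $i+j\le 6$ the "cell $(i,j)$" is the image of the triangle with vertices $V_0$ under $x\mapsto\frac17x+q(i,j)$, so the images of $p_1,p_2,p_3$ are $q(i,j),q(i+1,j),q(i,j+1)$. The IFS $\{F_i\}_{i=1}^{17}$ consists of the $17$ maps $F_i(x)=\frac17x+a_i$ for the following cells: the five left cells $(0,0),\dots,(0,4)$; the three top cells $(0,5),(1,5),(0,6)$; and nine right cells forming a simple chain from $z_0=q(2,5)$ to $z_9=q(7,0)=p_2$: there are points $z_0,\dots,z_9$ such that $z_{k-1}\neq z_k$ are vertices of the $k$-th right cell, consecutive right cells meet only at $z_k$, non-consecutive right cells are disjoint, the chain meets the left and top cells only in $z_0$, and the pair $\{z_{k-1},z_k\}$ is the image of $\{p_1,p_2\}$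 for exactly four, of $\{p_2,p_3\}$ for exactly three, and of $\{p_3,p_1\}$ for exactly two of the nine right cells. (For example the right cells $(2,4),(3,3),(3,2),(2,2),(2,1),(3,0),(4,0),(5,0),(6,0)$; one such chain is fixed, and the assertions do not depend on which.) $K$ is the nonempty compact set with $K=\bigcup_{i=1}^{17}F_i(K)$. **Besov spaces.** For $\sigma>0$, $[u]^2_{B^\sigma_{2,\infty}}=\sup_{0<r<1}r^{-\alpha-2\sigma}\int_K\int_{B(x,r)}|u(x)-u(y)|^2d\mu(y)d\mu(x)$ and $B^\sigma_{2,\infty}=\{u\in L^2(K,\mu):\|u\|_2+[u]_{B^\sigma_{2,\infty}}<\infty\}$. When $2\sigma>\alpha$, elements of $B^\sigma_{2,\infty}$ have continuous representatives and $B^\sigma_{2,\infty}$ is regarded as a subset of $C(K)$. The critical exponents are $\sigma^*=\sup\{\sigma: B^\sigma_{2,\infty}\cap C(K)\text{ is dense in }C(K)\}$ (sup norm) and $\sigma^\#=\sup\{\sigma: B^\sigma_{2,\infty}\text{ contains non-constant functions}\}$. *)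

theory Defs
  imports "HOL-Analysis.Analysis"
begin

section \<open>Hausdorff measure\<close>

text \<open>
  The value of \<open>diameter\<close> is only meaningful on bounded sets, hence the boundedness
  condition on the covering sets.  As \<open>0 powr s = 0\<close>, empty covering sets contribute nothing,
  so countable covers include the finite ones.  The exponent is meant to satisfy \<open>s > 0\<close>.
\<close>

definition hausdorff_content :: "real \<Rightarrow> real \<Rightarrow> 'a::metric_space set \<Rightarrow> ennreal" where
  "hausdorff_content s \<delta> A =
     (INF U \<in> {U :: nat \<Rightarrow> 'a set. A \<subseteq> (\<Union>n. U n) \<and> (\<forall>n. bounded (U n) \<and> diameter (U n) \<le> \<delta>)}.
        \<Sum>n. ennreal (diameter (U n) powr s))"

definition hausdorff_outer :: "real \<Rightarrow> 'a::metric_space set \<Rightarrow> ennreal" where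
  "hausdorff_outer s A = (SUP \<delta> \<in> {0<..}. hausdorff_content s \<delta> A)"

definition hausdorff_measure :: "real \<Rightarrow> 'a::metric_space measure" where
  "hausdorff_measure s = measure_of UNIV (sets borel) (hausdorff_outer s)"

text \<open>The Hausdorff measure restricted to the subspace \<open>K\<close> and scaled to total mass one.\<close>

definition normalized_hausdorff :: "real \<Rightarrow> 'a::metric_space set \<Rightarrow> 'a measure" where
  "normalized_hausdorff s K =
     scale_measure (inverse (emeasure (hausdorff_measure s) K)) (restrict_space (hausdorff_measure s) K)"


section \<open>The Sierpinski sickle\<close>

text \<open>The plane is \<open>real \<times> real\<close>, whose norm and metric are the Euclidean ones.\<close>

type_synonym plane = "real \<times> real"

definition p1 :: plane where "p1 = (0, 0)"
definition p2 :: plane where "p2 = (1, 0)"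
definition p3 :: plane where "p3 = (1/2, sqrt 3 / 2)"

definition grid_pt :: "nat \<times> nat \<Rightarrow> plane" where
  "grid_pt ij = (1/7) *\<^sub>R (real (fst ij) *\<^sub>R p2 + real (snd ij) *\<^sub>R p3)"

definition cell_map :: "nat \<times> nat \<Rightarrow> plane \<Rightarrow> plane" where
  "cell_map ij x = (1/7) *\<^sub>R x + grid_pt ij"

definition cell :: "nat \<times> nat \<Rightarrow> plane set" where
  "cell ij = cell_map ij ` (convex hull {p1, p2, p3})"

definition left_cells :: "(nat \<times> nat) set" where
  "left_cells = {(0,0), (0,1), (0,2), (0,3), (0,4)}"

definition top_cells :: "(nat \<times> nat) set" where
  "top_cells = {(0,5), (1,5), (0,6)}"

text \<open>
  The \<open>k\<close>-th right cell is \<open>c k\<close> for \<open>k = 1, \<dots>, 9\<close>, and \<open>z 0, \<dots>, z 9\<close> are the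
  connecting points; other values of \<open>c\<close> and \<open>z\<close> play no role.
\<close>

definition right_chain :: "(nat \<Rightarrow> nat \<times> nat) \<Rightarrow> (nat \<Rightarrow> plane) \<Rightarrow> bool" where
  "right_chain c z \<longleftrightarrow>
     (\<forall>k\<in>{1..9}. fst (c k) + snd (c k) \<le> 6) \<and>
     z 0 = grid_pt (2, 5) \<and> z 9 = grid_pt (7, 0) \<and>
     (\<forall>k\<in>{1..9}. z (k - 1) \<noteq> z k \<and> {z (k - 1), z k} \<subseteq> cell_map (c k) ` {p1, p2, p3}) \<and>
     (\<forall>k\<in>{1..8}. cell (c k) \<inter> cell (c (k + 1)) = {z k}) \<and>
     (\<forall>k\<in>{1..9}. \<forall>l\<in>{1..9}. k + 1 < l \<longrightarrow> cell (c k) \<inter> cell (c l) = {}) \<and>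
     (\<Union>k\<in>{1..9}. cell (c k)) \<inter> (\<Union>ij\<in>left_cells \<union> top_cells. cell ij) = {z 0} \<and>
     card {k\<in>{1..9}. {z (k - 1), z k} = cell_map (c k) ` {p1, p2}} = 4 \<and>
     card {k\<in>{1..9}. {z (k - 1), z k} = cell_map (c k) ` {p2, p3}} = 3 \<and>
     card {k\<in>{1..9}. {z (k - 1), z k} = cell_map (c k) ` {p3, p1}} = 2"

definition sickle_cells :: "(nat \<Rightarrow> nat \<times> nat) \<Rightarrow> (nat \<times> nat) set" where
  "sickle_cells c = left_cells \<union> top_cells \<union> c ` {1..9}"

definition is_sickle :: "(nat \<Rightarrow> nat \<times> nat) \<Rightarrow> plane set \<Rightarrow> bool" where
  "is_sickle c K \<longleftrightarrow> compact K \<and> K \<noteq> {} \<and> K = (\<Union>ij\<in>sickle_cells c. cell_map ij ` K)"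


section \<open>Besov spaces and critical exponents\<close>

text \<open>
  Elements of \<open>L\<^sup>2\<close> are represented by functions, not by classes modulo null sets.  All notions
  below apart from continuity are invariant under changes on null sets.
\<close>

definition L2_space :: "'a measure \<Rightarrow> ('a \<Rightarrow> real) set" where
  "L2_space \<mu> = {u \<in> borel_measurable \<mu>. integrable \<mu> (\<lambda>x. (u x)\<^sup>2)}"

definition L2_norm :: "'a measure \<Rightarrow> ('a \<Rightarrow> real) \<Rightarrow> real" where
  "L2_norm \<mu> u = sqrt (\<integral>x. (u x)\<^sup>2 \<partial>\<mu>)"

text \<open>The square of the seminorm, for a measure \<open>\<mu>\<close> living on \<open>K\<close>.\<close>

definition besov_seminorm_sq ::
    "real \<Rightarrow> 'a::metric_space measure \<Rightarrow> real \<Rightarrow> ('a \<Rightarrow> real) \<Rightarrow> ennreal" where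
  "besov_seminorm_sq \<alpha> \<mu> \<sigma> u =
     (SUP r \<in> {0<..<1}. ennreal (r powr (- \<alpha> - 2 * \<sigma>)) *
        (\<integral>\<^sup>+x. (\<integral>\<^sup>+y\<in>ball x r. ennreal (\<bar>u x - u y\<bar>\<^sup>2) \<partial>\<mu>) \<partial>\<mu>))"

definition besov_space :: "real \<Rightarrow> 'a::metric_space set \<Rightarrow> real \<Rightarrow> ('a \<Rightarrow> real) set" where
  "besov_space \<alpha> K \<sigma> =
     {u \<in> L2_space (normalized_hausdorff \<alpha> K).
        besov_seminorm_sq \<alpha> (normalized_hausdorff \<alpha> K) \<sigma> u < \<infinity>}"

text \<open>
  \<open>B \<inter> C(K)\<close> is dense in \<open>C(K)\<close> for the sup norm.  Values outside \<open>K\<close> are irrelevant.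
  Where \<open>B\<close> is regarded as a subset of \<open>C(K)\<close> through continuous representatives, that subset is
  precisely \<open>B \<inter> C(K)\<close>.
\<close>

definition dense_in_C :: "'a::metric_space set \<Rightarrow> ('a \<Rightarrow> real) set \<Rightarrow> bool" where
  "dense_in_C K B \<longleftrightarrow>
     (\<forall>f. continuous_on K f \<longrightarrow>
        (\<forall>\<epsilon>>0. \<exists>u\<in>B. continuous_on K u \<and> (\<forall>x\<in>K. \<bar>f x - u x\<bar> < \<epsilon>)))"

definition dense_in_L2 :: "'a measure \<Rightarrow> ('a \<Rightarrow> real) set \<Rightarrow> bool" where
  "dense_in_L2 \<mu> B \<longleftrightarrow>
     B \<subseteq> L2_space \<mu> \<and>
     (\<forall>f\<in>L2_space \<mu>. \<forall>\<epsilon>>0. \<exists>u\<in>B. L2_norm \<mu> (\<lambda>x. f x - u x) < \<epsilon>)"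

text \<open>
  The suprema are taken in the extended reals, so that equality with a real number entails that
  the set is nonempty and bounded.  Non-constant means not almost everywhere constant.
\<close>

definition sigma_star :: "real \<Rightarrow> 'a::metric_space set \<Rightarrow> ereal" where
  "sigma_star \<alpha> K = (SUP \<sigma> \<in> {\<sigma>. 0 < \<sigma> \<and> dense_in_C K (besov_space \<alpha> K \<sigma>)}. ereal \<sigma>)"

definition sigma_sharp :: "real \<Rightarrow> 'a::metric_space set \<Rightarrow> ereal" where
  "sigma_sharp \<alpha> K =
     (SUP \<sigma> \<in> {\<sigma>. 0 < \<sigma> \<and> (\<exists>u\<in>besov_space \<alpha> K \<sigma>.
        \<not> (\<exists>b. AE x in normalized_hausdorff \<alpha> K. u x = b))}. ereal \<sigma>)"

end

theory Submission
  imports Defs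
begin

text \<open>The Besov seminorm of exponent \<open>\<sigma>\<close> measures a function by the sums over the cells of level \<open>n\<close> of
  squared differences, which have to be of order \<open>7 powr (- n * (2 * \<sigma> - \<alpha>))\<close>. Regard every cell as three
  resistors between its vertices. The critical exponents are then given by the growth of resistance
  between corners of the big triangle under refinement.

  From \<open>p1\<close> to \<open>p3\<close> the sickle contains the whole segment, which consists of seven similar segments, so
  the resistance grows by the factor 7. If \<open>7 powr (2 * \<sigma> - \<alpha>) > 7\<close>, every function in the Besov space
  takes equal values at \<open>p1\<close> and \<open>p3\<close> (\<open>segment_constant\<close>), and the space cannot be dense in \<open>C(K)\<close>. For
  equality, constants and two self-similar functions (\<open>f_exists\<close>, \<open>g_exists\<close>) realize arbitrary values at
  the three corners, and copies of their combinations can be glued along the vertices of any level, which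
  gives density in \<open>C(K)\<close> (\<open>uniform_approximation\<close>).

  Beyond this exponent all copies of the segment are short circuits. A current from \<open>p1\<close> to \<open>p2\<close> still
  meets resistance in the top triangle, where two parallel cells are followed by a third one, and in the
  seven cells of the right arc that are not traversed along a copy of the segment. The total is
  \<open>1/2 + 1 + 7 = 17/2\<close>. If \<open>7 powr (2 * \<sigma> - \<alpha>) > 17/2\<close>, all differences of vertex values vanish and only
  constants remain (\<open>besov_constant\<close>). For equality there is the harmonic function \<open>g\<close> of this circuit,
  whose restriction to each cell is an affine function of \<open>g\<close> itself. Only the small cells along the
  segment from \<open>p1\<close> to \<open>p3\<close> and the one at \<open>p2\<close> are needed to lower the constant 1 to the value 0 at all
  three corners (\<open>plateau_exists\<close>). These plateau functions replace the constants in approximations by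
  step functions and give density in \<open>L\<^sup>2\<close> (\<open>plateau_dense\<close>), although all functions involved are equal at
  \<open>p1\<close> and \<open>p3\<close>.

  The analysis behind this has two parts. A continuous function whose squared oscillations on the cells of
  level \<open>n\<close> sum to \<open>O(\<rho> ^ n)\<close> lies in the Besov space if \<open>7 powr (\<alpha> + 2 * \<sigma>) * \<rho> \<le> 289\<close>
  (\<open>osc_class_besov\<close>). Conversely, averages of a Besov function over shrinking cells converge to vertex
  values that obey the corresponding decay (\<open>vertex_value_decay\<close>). Both rest on the facts that the
  Hausdorff outer measure is a measure on the Borel sets (\<open>measure_space_hausdorff\<close>), and that it is
  positive and finite on \<open>K\<close> (\<open>content_K_ge\<close>, \<open>outer_K_le\<close>), so that by self-similarity a cell of level
  \<open>n\<close> has normalized measure \<open>17 ^ (- n)\<close>.\<close>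

section \<open>Hausdorff measure\<close>

abbreviation hausdorff_covers :: "real \<Rightarrow> 'a::metric_space set \<Rightarrow> (nat \<Rightarrow> 'a set) set" where
  "hausdorff_covers \<delta> A \<equiv> {U. A \<subseteq> (\<Union>n. U n) \<and> (\<forall>n. bounded (U n) \<and> diameter (U n) \<le> \<delta>)}"

lemma content_le:
  assumes "U \<in> hausdorff_covers \<delta> A"
  shows "hausdorff_content s \<delta> A \<le> (\<Sum>n. ennreal (diameter (U n) powr s))"
  unfolding hausdorff_content_def by (rule INF_lower[OF assms])

lemma content_mono: "A \<subseteq> B \<Longrightarrow> hausdorff_content s \<delta> A \<le> hausdorff_content s \<delta> B"
  unfolding hausdorff_content_def by (rule INF_superset_mono) auto

lemma content_antimono: "\<delta> \<le> \<delta>' \<Longrightarrow> hausdorff_content s \<delta>' A \<le> hausdorff_content s \<delta> A"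
  unfolding hausdorff_content_def by (rule INF_superset_mono) (auto intro: order_trans)

lemma content_empty: "\<delta> > 0 \<Longrightarrow> hausdorff_content s \<delta> {} = 0"
  using content_le[where U="\<lambda>_. {}" and A="{}" and \<delta>=\<delta> and s=s] by simp

lemma content_cover:
  assumes "hausdorff_content s \<delta> A < c"
  obtains U where "U \<in> hausdorff_covers \<delta> A" "(\<Sum>n. ennreal (diameter (U n) powr s)) < c"
  using assms unfolding hausdorff_content_def by (auto simp: INF_less_iff)

lemma content_subadditive:
  "hausdorff_content s \<delta> (\<Union>i. A i) \<le> (\<Sum>i. hausdorff_content s \<delta> (A i))"
proof (cases "\<exists>i. hausdorff_content s \<delta> (A i) = \<infinity>")
  case True
  then obtain i where "hausdorff_content s \<delta> (A i) = \<infinity>" by blast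
  moreover have "hausdorff_content s \<delta> (A i) \<le> (\<Sum>i. hausdorff_content s \<delta> (A i))"
    using sum_le_suminf[of "\<lambda>i. hausdorff_content s \<delta> (A i)" "{i}"] by simp
  ultimately show ?thesis by (metis infinity_ennreal_def neq_top_trans top_greatest)
next
  case False
  show ?thesis
  proof (rule ennreal_le_epsilon)
    fix e :: real assume "0 < e"
    have "\<forall>i. \<exists>U. U \<in> hausdorff_covers \<delta> (A i) \<and>
        (\<Sum>n. ennreal (diameter (U n) powr s)) \<le> hausdorff_content s \<delta> (A i) + ennreal (e * (1/2)^Suc i)"
    proof
      fix i
      have "hausdorff_content s \<delta> (A i) < hausdorff_content s \<delta> (A i) + ennreal (e * (1/2)^Suc i)"
        using False \<open>0 < e\<close>
          ennreal_add_left_cancel_less[of "hausdorff_content s \<delta> (A i)" 0 "ennreal (e * (1/2)^Suc i)"]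
        by simp
      then show "\<exists>U. U \<in> hausdorff_covers \<delta> (A i) \<and>
        (\<Sum>n. ennreal (diameter (U n) powr s)) \<le> hausdorff_content s \<delta> (A i) + ennreal (e * (1/2)^Suc i)"
        by (elim content_cover) (auto intro: less_imp_le)
    qed
    from choice[OF this] obtain U where U: "\<And>i. U i \<in> hausdorff_covers \<delta> (A i)"
      "\<And>i. (\<Sum>n. ennreal (diameter (U i n) powr s)) \<le> hausdorff_content s \<delta> (A i) + ennreal (e * (1/2)^Suc i)"
      by blast
    define V where "V k = (case prod_decode k of (i, n) \<Rightarrow> U i n)" for k
    have "V \<in> hausdorff_covers \<delta> (\<Union>i. A i)"
    proof -
      have "x \<in> (\<Union>k. V k)" if x: "x \<in> A i" for x i
      proof -
        obtain n where "x \<in> U i n" using U(1)[of i] x by blast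
        then have "x \<in> V (prod_encode (i, n))" by (simp add: V_def)
        then show ?thesis by blast
      qed
      moreover have "bounded (V k) \<and> diameter (V k) \<le> \<delta>" for k
        using U(1) by (auto simp: V_def split: prod.split)
      ultimately show ?thesis by (intro CollectI conjI subsetI allI) auto
    qed
    then have "hausdorff_content s \<delta> (\<Union>i. A i) \<le> (\<Sum>k. ennreal (diameter (V k) powr s))"
      by (rule content_le)
    also have "\<dots> = (\<Sum>k. case prod_decode k of (i, n) \<Rightarrow> ennreal (diameter (U i n) powr s))"
      by (intro suminf_cong) (simp add: V_def split: prod.split)
    also have "\<dots> = (\<Sum>i. \<Sum>n. ennreal (diameter (U i n) powr s))"
      by (rule suminf_ennreal_2dimen[where f = "\<lambda>(i, n). ennreal (diameter (U i n) powr s)",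
            unfolded comp_def]) simp
    also have "\<dots> \<le> (\<Sum>i. hausdorff_content s \<delta> (A i) + ennreal (e * (1/2)^Suc i))"
      by (intro suminf_le U) auto
    also have "\<dots> = (\<Sum>i. hausdorff_content s \<delta> (A i)) + (\<Sum>i. ennreal (e * (1/2)^Suc i))"
      by (intro suminf_add[symmetric]) auto
    also have "(\<Sum>i. ennreal (e * (1/2)^Suc i)) = ennreal e"
    proof (rule suminf_ennreal_eq)
      show "(\<lambda>i. e * (1/2)^Suc i) sums e"
        using sums_mult[OF power_half_series, of e] by simp
    qed (use \<open>0 < e\<close> in auto)
    finally show "hausdorff_content s \<delta> (\<Union>i. A i) \<le> (\<Sum>i. hausdorff_content s \<delta> (A i)) + ennreal e" .
  qed
qed

lemma outer_empty: "hausdorff_outer s {} = 0"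
  unfolding hausdorff_outer_def by (simp add: content_empty)

lemma outer_mono: "A \<subseteq> B \<Longrightarrow> hausdorff_outer s A \<le> hausdorff_outer s B"
  unfolding hausdorff_outer_def by (intro SUP_mono) (auto intro: content_mono)

lemma content_le_outer: "\<delta> > 0 \<Longrightarrow> hausdorff_content s \<delta> A \<le> hausdorff_outer s A"
  unfolding hausdorff_outer_def by (rule SUP_upper) auto

lemma outer_subadditive: "hausdorff_outer s (\<Union>i. A i) \<le> (\<Sum>i. hausdorff_outer s (A i))"
  unfolding hausdorff_outer_def[of s "\<Union>i. A i"]
proof (rule SUP_least)
  fix \<delta> :: real assume "\<delta> \<in> {0<..}"
  then show "hausdorff_content s \<delta> (\<Union>i. A i) \<le> (\<Sum>i. hausdorff_outer s (A i))"
    by (intro order_trans[OF content_subadditive] suminf_le content_le_outer) auto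
qed

lemma outer_measure_space_hausdorff: "outer_measure_space UNIV (hausdorff_outer s)"
  unfolding outer_measure_space_def positive_def increasing_def countably_subadditive_def
  by (auto simp: outer_empty intro: outer_mono outer_subadditive)

lemma outer_subadditive_Un: "hausdorff_outer s (A \<union> B) \<le> hausdorff_outer s A + hausdorff_outer s B"
proof -
  have "A \<union> B = (\<Union>i. binaryset A B i)" by (simp add: UN_binaryset_eq)
  also have "hausdorff_outer s \<dots> \<le> (\<Sum>i. hausdorff_outer s (binaryset A B i))"
    by (rule outer_subadditive)
  also have "\<dots> = hausdorff_outer s A + hausdorff_outer s B"
    by (rule suminf_binaryset_eq) (simp add: outer_empty)
  finally show ?thesis .
qed

text \<open>A covering set of diameter less than the distance of two sets meets at most one of them, so a fine cover
  of the union splits into covers of the two sets.\<close>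

lemma outer_separated:
  assumes e: "e > 0" and sep: "\<And>x y. x \<in> A \<Longrightarrow> y \<in> B \<Longrightarrow> e \<le> dist x y"
  shows "hausdorff_outer s A + hausdorff_outer s B \<le> hausdorff_outer s (A \<union> B)"
proof -
  have split: "hausdorff_content s \<delta> A + hausdorff_content s \<delta> B \<le> hausdorff_outer s (A \<union> B)"
    if d: "0 < \<delta>" "\<delta> < e" for \<delta>
  proof -
    have "hausdorff_content s \<delta> A + hausdorff_content s \<delta> B \<le> hausdorff_content s \<delta> (A \<union> B)"
      unfolding hausdorff_content_def[of s \<delta> "A \<union> B"]
    proof (rule INF_greatest)
      fix U assume U: "U \<in> hausdorff_covers \<delta> (A \<union> B)"
      define V where "V n = (if U n \<inter> A \<noteq> {} then U n else {})" for n
      define W where "W n = (if U n \<inter> B \<noteq> {} then U n else {})" for n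
      have "V \<in> hausdorff_covers \<delta> A" "W \<in> hausdorff_covers \<delta> B"
        using U d by (auto simp: V_def W_def; fastforce)+
      then have "hausdorff_content s \<delta> A + hausdorff_content s \<delta> B
          \<le> (\<Sum>n. ennreal (diameter (V n) powr s)) + (\<Sum>n. ennreal (diameter (W n) powr s))"
        by (intro add_mono content_le)
      also have "\<dots> = (\<Sum>n. ennreal (diameter (V n) powr s) + ennreal (diameter (W n) powr s))"
        by (intro suminf_add) auto
      also have "\<dots> \<le> (\<Sum>n. ennreal (diameter (U n) powr s))"
      proof (intro suminf_le)
        fix n
        have "U n \<inter> A = {} \<or> U n \<inter> B = {}"
        proof (rule ccontr)
          assume "\<not> ?thesis"
          then obtain x y where xy: "x \<in> U n" "x \<in> A" "y \<in> U n" "y \<in> B" by blast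
          have "dist x y \<le> diameter (U n)" using U xy diameter_bounded_bound by blast
          moreover have "diameter (U n) \<le> \<delta>" using U by blast
          ultimately show False using sep[OF xy(2,4)] d by linarith
        qed
        then show "ennreal (diameter (V n) powr s) + ennreal (diameter (W n) powr s)
            \<le> ennreal (diameter (U n) powr s)"
          by (auto simp: V_def W_def)
      qed auto
      finally show "hausdorff_content s \<delta> A + hausdorff_content s \<delta> B
          \<le> (\<Sum>n. ennreal (diameter (U n) powr s))" .
    qed
    also have "\<dots> \<le> hausdorff_outer s (A \<union> B)" using d by (intro content_le_outer)
    finally show ?thesis .
  qed
  have "hausdorff_outer s A + hausdorff_outer s B =
      (SUP \<delta>\<in>{0<..}. hausdorff_content s \<delta> A + hausdorff_content s \<delta> B)"
    unfolding hausdorff_outer_def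
  proof (rule SUP_add_directed_ennreal[symmetric])
    fix i j :: real assume "i \<in> {0<..}" "j \<in> {0<..}"
    then show "\<exists>k\<in>{0<..}. hausdorff_content s i A + hausdorff_content s j B
        \<le> hausdorff_content s k A + hausdorff_content s k B"
      by (intro bexI[of _ "min i j"] add_mono content_antimono) auto
  qed
  also have "\<dots> \<le> hausdorff_outer s (A \<union> B)"
  proof (rule SUP_least)
    fix \<delta> :: real assume "\<delta> \<in> {0<..}"
    then have "hausdorff_content s \<delta> A + hausdorff_content s \<delta> B
        \<le> hausdorff_content s (min \<delta> (e/2)) A + hausdorff_content s (min \<delta> (e/2)) B"
      by (intro add_mono content_antimono) auto
    also have "\<dots> \<le> hausdorff_outer s (A \<union> B)"
      using \<open>\<delta> \<in> {0<..}\<close> e by (intro split) auto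
    finally show "hausdorff_content s \<delta> A + hausdorff_content s \<delta> B \<le> hausdorff_outer s (A \<union> B)" .
  qed
  finally show ?thesis .
qed

text \<open>The points of \<open>A\<close> outside the closed set \<open>C\<close> are exhausted by the sets \<open>D n\<close> of points at distance at
  least \<open>1/(n+1)\<close> from \<open>C\<close>, and \<open>A \<inter> C\<close> is separated from each of them. What is lost between \<open>D n\<close> and
  \<open>A - C\<close> is a union of shells \<open>D (k+1) - D k\<close>. Shells with \<open>k\<close> of the same parity are separated from each
  other, so the outer measures of all shells have a finite sum and the tails tend to zero. By
  Caratheodory's criterion this makes all Borel sets measurable.\<close>

lemma outer_closed_split:
  fixes C :: "'a::metric_space set"
  assumes C: "closed C"
  shows "hausdorff_outer s (A \<inter> C) + hausdorff_outer s (A - C) \<le> hausdorff_outer s A"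
proof (cases "C = {} \<or> hausdorff_outer s A = \<infinity>")
  case True
  then show ?thesis by (auto simp: outer_empty)
next
  case False
  let ?H = "hausdorff_outer s :: 'a set \<Rightarrow> ennreal"
  define D where "D n = {x \<in> A. infdist x C \<ge> 1 / real (n + 1)}" for n
  define R where "R n = D (Suc n) - D n" for n
  have "C \<noteq> {}" and fin: "?H A < \<infinity>" using False by (auto simp: less_top)
  have D_mono: "D m \<subseteq> D n" if "m \<le> n" for m n
  proof -
    have "1 / real (n + 1) \<le> 1 / real (m + 1)" using that by (intro divide_left_mono) auto
    then show ?thesis by (auto simp: D_def)
  qed
  have D_A: "D n \<subseteq> A" for n by (auto simp: D_def)
  have split: "?H (A \<inter> C) + ?H (D n) \<le> ?H A" for n
  proof -
    have "?H (A \<inter> C) + ?H (D n) \<le> ?H (A \<inter> C \<union> D n)"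
    proof (rule outer_separated)
      show "0 < 1 / real (n + 1)" by simp
      fix x y assume "x \<in> A \<inter> C" "y \<in> D n"
      then have "1 / real (n + 1) \<le> infdist y C" "infdist y C \<le> dist y x"
        by (auto simp: D_def intro: infdist_le)
      then show "1 / real (n + 1) \<le> dist x y" by (simp add: dist_commute)
    qed
    also have "\<dots> \<le> ?H A" by (intro outer_mono) (auto simp: D_def)
    finally show ?thesis .
  qed
  have R_sep: "?H X + ?H (R n) \<le> ?H (X \<union> R n)" if X: "X \<subseteq> D m" "m < n" for X m n
  proof (rule outer_separated)
    show "0 < 1 / real (m + 1) - 1 / real (n + 1)" using X by (simp add: frac_less2)
    fix x y assume xy: "x \<in> X" "y \<in> R n"
    have "infdist x C \<ge> 1 / real (m + 1)" using xy X by (auto simp: D_def)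
    moreover have "infdist y C < 1 / real (n + 1)" using xy D_A by (auto simp: R_def D_def)
    moreover have "infdist x C \<le> infdist y C + dist x y" by (rule infdist_triangle)
    ultimately show "1 / real (m + 1) - 1 / real (n + 1) \<le> dist x y" by linarith
  qed
  have R_D: "R n \<subseteq> D (Suc n)" for n by (auto simp: R_def)
  have par: "(\<Sum>k<n. ?H (R (2 * k + i))) \<le> ?H (\<Union>k<n. R (2 * k + i))" for n i
  proof (induction n)
    case (Suc n)
    let ?W = "\<Union>k<n. R (2 * k + i)"
    have "(\<Sum>k<Suc n. ?H (R (2 * k + i))) \<le> ?H ?W + ?H (R (2 * n + i))"
      using Suc by (simp add: add_right_mono)
    also have "\<dots> \<le> ?H (?W \<union> R (2 * n + i))"
    proof (cases n)
      case 0
      then show ?thesis by (simp add: outer_empty)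
    next
      case (Suc n')
      have "R (2 * k + i) \<subseteq> D (2 * n + i - 1)" if "k < n" for k
      proof -
        have "Suc (2 * k + i) \<le> 2 * n + i - 1" using that by linarith
        then show ?thesis using order_trans[OF R_D D_mono] by blast
      qed
      then have "?W \<subseteq> D (2 * n + i - 1)" by blast
      then show ?thesis using Suc by (intro R_sep) auto
    qed
    also have "?W \<union> R (2 * n + i) = (\<Union>k<Suc n. R (2 * k + i))"
      by (auto simp: lessThan_Suc)
    finally show ?case .
  qed (simp add: outer_empty)
  have par_A: "(\<Sum>k<n. ?H (R (2 * k + i))) \<le> ?H A" for n i
    using par[where n=n and i=i] by (rule order_trans) (intro outer_mono, auto simp: R_def D_def)
  have R_sum: "(\<Sum>k<n. ?H (R k)) \<le> 2 * ?H A" for n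
  proof -
    have "(\<Sum>k<n. ?H (R k)) \<le> (\<Sum>k<2 * n. ?H (R k))"
      by (intro sum_mono2) auto
    also have "\<dots> = (\<Sum>k<n. ?H (R (2 * k + 0))) + (\<Sum>k<n. ?H (R (2 * k + 1)))"
      by (induction n) (simp_all add: ac_simps)
    also have "\<dots> \<le> ?H A + ?H A" by (intro add_mono par_A)
    finally show ?thesis by (simp add: mult_2)
  qed
  have R_fin: "?H (R k) < \<infinity>" for k
    using outer_mono[of "R k" A s] fin by (auto simp: R_def D_def intro: le_less_trans)
  define b where "b k = enn2real (?H (R k))" for k
  have b: "ennreal (b k) = ?H (R k)" "0 \<le> b k" for k
    using R_fin[of k] by (auto simp: b_def ennreal_enn2real_if)
  have "summable b"
  proof (rule summableI_nonneg_bounded[of _ "enn2real (2 * ?H A)"])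
    fix n
    have "ennreal (\<Sum>k<n. b k) = (\<Sum>k<n. ?H (R k))"
      using b by (simp flip: sum_ennreal)
    also have "\<dots> \<le> ennreal (enn2real (2 * ?H A))"
      using R_sum[of n] fin by (simp add: ennreal_enn2real_if ennreal_mult_less_top less_top[symmetric] ennreal_mult_eq_top_iff)
    finally show "(\<Sum>k<n. b k) \<le> enn2real (2 * ?H A)" by (simp add: ennreal_le_iff)
  qed (rule b)
  have cover: "A - C \<subseteq> D n \<union> (\<Union>k. R (k + n))" for n
  proof
    fix x assume x: "x \<in> A - C"
    then have "infdist x C > 0"
      using C \<open>C \<noteq> {}\<close> by (metis DiffD2 in_closed_iff_infdist_zero infdist_nonneg less_eq_real_def)
    then obtain m where "1 / real (Suc m) < infdist x C" using nat_approx_posE by blast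
    then have m: "x \<in> D m" using x by (auto simp: D_def)
    show "x \<in> D n \<union> (\<Union>k. R (k + n))"
    proof (rule ccontr)
      assume neg: "\<not> ?thesis"
      have "x \<notin> D (k + n)" for k
        by (induction k) (use neg in \<open>auto simp: R_def\<close>)
      then show False using D_mono[of m "m + n"] m by auto
    qed
  qed
  show ?thesis
  proof (rule ennreal_le_epsilon)
    fix e :: real assume "0 < e"
    then obtain n where n: "norm (\<Sum>i. b (i + n)) < e"
      using suminf_exist_split[OF _ \<open>summable b\<close>] by blast
    have "?H (A - C) \<le> ?H (D n) + ?H (\<Union>k. R (k + n))"
      using outer_mono[OF cover] outer_subadditive_Un by (rule order_trans)
    also have "?H (\<Union>k. R (k + n)) \<le> (\<Sum>k. ?H (R (k + n)))" by (rule outer_subadditive)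
    also have "(\<Sum>k. ?H (R (k + n))) = ennreal (\<Sum>k. b (k + n))"
      unfolding b(1)[symmetric] using \<open>summable b\<close> b(2)
      by (intro suminf_ennreal2) (auto intro: summable_ignore_initial_segment)
    also have "\<dots> \<le> ennreal e" using n by (intro ennreal_leI) auto
    finally have "?H (A - C) \<le> ?H (D n) + ennreal e" by (simp add: add_left_mono)
    then have "?H (A \<inter> C) + ?H (A - C) \<le> ?H (A \<inter> C) + ?H (D n) + ennreal e"
      by (simp add: add.assoc add_left_mono)
    also have "\<dots> \<le> ?H A + ennreal e" using split[of n] by (rule add_right_mono)
    finally show "?H (A \<inter> C) + ?H (A - C) \<le> ?H A + ennreal e" .
  qed
qed

lemma measure_space_hausdorff: "measure_space UNIV (sets borel) (hausdorff_outer s)"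
proof -
  interpret sigma_algebra UNIV "Pow UNIV :: 'a set set" by (rule sigma_algebra_Pow)
  let ?L = "lambda_system UNIV (Pow UNIV) (hausdorff_outer s :: 'a set \<Rightarrow> ennreal)"
  have L: "measure_space UNIV ?L (hausdorff_outer s)"
    using caratheodory_lemma outer_measure_space_hausdorff by auto
  then interpret L: sigma_algebra UNIV ?L by (simp add: measure_space_def)
  have "C \<in> ?L" if "closed C" for C
  proof -
    have "hausdorff_outer s (A \<inter> C) + hausdorff_outer s (A - C) = hausdorff_outer s A" for A
    proof (rule antisym[OF outer_closed_split[OF that]])
      have "A = (A \<inter> C) \<union> (A - C)" by blast
      then show "hausdorff_outer s A \<le> hausdorff_outer s (A \<inter> C) + hausdorff_outer s (A - C)"
        by (metis outer_subadditive_Un)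
    qed
    then show ?thesis by (simp add: lambda_system_def Int_commute Diff_eq)
  qed
  then have "sigma_sets UNIV (Collect closed) \<subseteq> ?L" by (intro L.sigma_sets_subset) auto
  moreover have "sets borel = sigma_sets UNIV (Collect closed :: 'a set set)"
    by (simp add: borel_eq_closed)
  ultimately show ?thesis
    using measure_down[OF L] sets.sigma_algebra_axioms[of "borel :: 'a measure"] by simp
qed

lemma sets_hausdorff [simp, measurable_cong]: "sets (hausdorff_measure s) = sets borel"
  unfolding hausdorff_measure_def
  by (metis sets.sigma_sets_eq sets_measure_of space_borel subset_UNIV Pow_UNIV)

lemma space_hausdorff [simp]: "space (hausdorff_measure s) = UNIV"
  using sets_eq_imp_space_eq[OF sets_hausdorff] by simp

lemma emeasure_hausdorff:
  assumes "A \<in> sets borel"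
  shows "emeasure (hausdorff_measure s) A = hausdorff_outer s A"
  unfolding hausdorff_measure_def
  using measure_space_hausdorff[of s] assms
  by (intro emeasure_measure_of_sigma) (auto simp: measure_space_def)

text \<open>The images of a cover form a cover with all diameters multiplied by \<open>c\<close>. The opposite inequality comes
  from the inverse map, which is a similarity with ratio \<open>1 / c\<close>.\<close>

lemma outer_similarity_le:
  fixes F :: "'a::metric_space \<Rightarrow> 'a"
  assumes c: "c > 0" and F: "\<And>x y. dist (F x) (F y) = c * dist x y"
    and s: "s > 0"
  shows "hausdorff_outer s (F ` A) \<le> ennreal (c powr s) * hausdorff_outer s A"
  unfolding hausdorff_outer_def[of s "F ` A"]
proof (rule SUP_least)
  fix \<delta> :: real assume \<delta>: "\<delta> \<in> {0<..}"
  have *: "hausdorff_content s \<delta> (F ` A) \<le> ennreal (c powr s) * (\<Sum>n. ennreal (diameter (U n) powr s))"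
    if U: "U \<in> hausdorff_covers (\<delta> / c) A" for U
  proof -
    have bd: "bounded (F ` U n) \<and> diameter (F ` U n) \<le> c * diameter (U n)" for n
    proof (cases "U n = {}")
      case False
      have *: "dist x y \<le> c * diameter (U n)" if "x \<in> F ` U n" "y \<in> F ` U n" for x y
        using that U c by (auto simp: F intro!: mult_left_mono diameter_bounded_bound)
      obtain x where "x \<in> U n" using False by blast
      with * have "bounded (F ` U n)" unfolding bounded_def by blast
      then show ?thesis using * False by (auto simp: diameter_def intro!: cSUP_least)
    qed simp
    have "(\<lambda>n. F ` U n) \<in> hausdorff_covers \<delta> (F ` A)"
    proof -
      have "diameter (F ` U n) \<le> \<delta>" for n
      proof -
        have "diameter (U n) \<le> \<delta> / c" using U by blast
        then have "c * diameter (U n) \<le> \<delta>" using c by (simp add: field_simps)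
        then show ?thesis using bd[of n] by linarith
      qed
      then show ?thesis using U bd by (simp add: image_UN[symmetric] image_mono)
    qed
    then have "hausdorff_content s \<delta> (F ` A) \<le> (\<Sum>n. ennreal (diameter (F ` U n) powr s))"
      by (rule content_le)
    also have "\<dots> \<le> (\<Sum>n. ennreal (c powr s) * ennreal (diameter (U n) powr s))"
    proof (intro suminf_le)
      fix n
      have "diameter (F ` U n) powr s \<le> (c * diameter (U n)) powr s"
        using bd[of n] s by (intro powr_mono2) (auto intro: diameter_ge_0)
      then show "ennreal (diameter (F ` U n) powr s) \<le> ennreal (c powr s) * ennreal (diameter (U n) powr s)"
        using c U diameter_ge_0[of "U n"] by (simp add: powr_mult ennreal_mult[symmetric] ennreal_leI)
    qed auto
    finally show ?thesis by simp
  qed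
  have "hausdorff_content s \<delta> (F ` A) \<le> ennreal (c powr s) * hausdorff_content s (\<delta> / c) A"
  proof -
    let ?c = "ennreal (c powr s)" and ?c' = "ennreal (inverse (c powr s))"
    have c': "?c' * ?c = 1" using c by (simp add: ennreal_mult[symmetric])
    have "?c' * hausdorff_content s \<delta> (F ` A) \<le> hausdorff_content s (\<delta> / c) A"
      unfolding hausdorff_content_def[of s "\<delta> / c" A]
    proof (rule INF_greatest)
      fix U assume "U \<in> hausdorff_covers (\<delta> / c) A"
      from mult_left_mono[OF *[OF this] zero_le, of ?c']
      show "?c' * hausdorff_content s \<delta> (F ` A) \<le> (\<Sum>n. ennreal (diameter (U n) powr s))"
        by (simp only: mult.assoc[symmetric] c' mult_1 zero_le)
    qed
    from mult_left_mono[OF this zero_le, of ?c] show ?thesis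
      by (simp only: mult.assoc[symmetric] mult.commute[of ?c ?c'] c' mult_1 zero_le)
  qed
  also have "\<dots> \<le> ennreal (c powr s) * hausdorff_outer s A"
    using \<delta> c by (intro mult_left_mono content_le_outer) auto
  finally show "hausdorff_content s \<delta> (F ` A) \<le> ennreal (c powr s) * hausdorff_outer s A" .
qed

lemma outer_similarity:
  fixes F :: "'a::metric_space \<Rightarrow> 'a"
  assumes c: "c > 0" and F: "\<And>x y. dist (F x) (F y) = c * dist x y" and G: "\<And>x. F (G x) = x"
    and s: "s > 0"
  shows "hausdorff_outer s (F ` A) = ennreal (c powr s) * hausdorff_outer s A"
proof (rule antisym[OF outer_similarity_le[OF c F s]])
  have inj: "x = y" if "F x = F y" for x y
    using F[of x y] c that by simp
  have "G (F x) = x" for x using G[of "F x"] by (rule inj)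
  then have GF: "G ` F ` A = A" by (simp add: image_image)
  have dG: "dist (G x) (G y) = (1 / c) * dist x y" for x y
    using F[of "G x" "G y"] c by (simp add: G)
  let ?c = "ennreal (c powr s)" and ?c' = "ennreal ((1 / c) powr s)"
  have c': "?c * ?c' = 1" using c by (simp add: ennreal_mult[symmetric] powr_mult[symmetric])
  have "?c * hausdorff_outer s A = ?c * hausdorff_outer s (G ` F ` A)" by (simp add: GF)
  also have "\<dots> \<le> ?c * (?c' * hausdorff_outer s (F ` A))"
    using c by (intro mult_left_mono outer_similarity_le[OF _ dG s]) auto
  also have "\<dots> = hausdorff_outer s (F ` A)" by (simp add: mult.assoc[symmetric] c')
  finally show "?c * hausdorff_outer s A \<le> hausdorff_outer s (F ` A)" .
qed

section \<open>Triangular lattice coordinates\<close>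

text \<open>The second and the third barycentric coordinate with respect to \<open>p1\<close>, \<open>p2\<close>, \<open>p3\<close>. In these coordinates
  the vertices of the cells become integer points, and membership in a triangle becomes a set of linear
  inequalities.\<close>

definition coordX :: "plane \<Rightarrow> real" where "coordX x = fst x - snd x / sqrt 3"
definition coordY :: "plane \<Rightarrow> real" where "coordY x = 2 * snd x / sqrt 3"

definition lattice_pt :: "nat \<times> nat \<Rightarrow> plane" where
  "lattice_pt e = real (fst e) *\<^sub>R p2 + real (snd e) *\<^sub>R p3"

text \<open>The lattice coordinates of \<open>p1\<close>, \<open>p2\<close>, \<open>p3\<close>. The vertices of the cell \<open>i\<close> are \<open>grid_pt (a + i)\<close> with
  \<open>a \<in> corners\<close>, so that a coincidence of vertices is an equation between pairs of natural numbers.\<close>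

definition corners :: "(nat \<times> nat) set" where "corners = {(0,0), (1,0), (0,1)}"

lemma coord_linear [simp]:
  "coordX (x + y) = coordX x + coordX y" "coordX (c *\<^sub>R x) = c * coordX x"
  "coordY (x + y) = coordY x + coordY y" "coordY (c *\<^sub>R x) = c * coordY x"
  by (simp_all add: coordX_def coordY_def algebra_simps add_divide_distrib)

lemma coord_lattice [simp]:
  "coordX (lattice_pt e) = real (fst e)" "coordY (lattice_pt e) = real (snd e)"
  by (simp_all add: coordX_def coordY_def lattice_pt_def p2_def p3_def)

lemma grid_pt_lattice: "grid_pt e = (1/7) *\<^sub>R lattice_pt e"
  by (simp add: grid_pt_def lattice_pt_def)

lemma coord_cell_map [simp]:
  "coordX (cell_map i x) = (coordX x + real (fst i)) / 7"
  "coordY (cell_map i x) = (coordY x + real (snd i)) / 7"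
  by (simp_all add: cell_map_def grid_pt_lattice)

lemma coord_eqI: "coordX x = coordX y \<Longrightarrow> coordY x = coordY y \<Longrightarrow> x = y"
  by (simp add: coordX_def coordY_def prod_eq_iff)

lemma coord_lipschitz: "\<bar>coordX x - coordX y\<bar> \<le> 2 * dist x y" "\<bar>coordY x - coordY y\<bar> \<le> 2 * dist x y"
    "\<bar>(coordX x + coordY x) - (coordX y + coordY y)\<bar> \<le> 2 * dist x y"
proof -
  have f: "\<bar>fst x - fst y\<bar> \<le> dist x y" and s: "\<bar>snd x - snd y\<bar> \<le> dist x y"
    using dist_fst_le[of x y] dist_snd_le[of x y] by (simp_all add: dist_real_def)
  have "1 \<le> sqrt 3" by simp
  then have s3: "\<bar>t / sqrt 3\<bar> \<le> \<bar>t\<bar>" for t :: real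
    using mult_left_mono[OF \<open>1 \<le> sqrt 3\<close>, of "\<bar>t\<bar>"] by (simp add: divide_le_eq)
  have eq: "coordX x - coordX y = (fst x - fst y) - (snd x - snd y) / sqrt 3"
    "coordY x - coordY y = 2 * ((snd x - snd y) / sqrt 3)"
    by (simp_all add: coordX_def coordY_def diff_divide_distrib)
  have d: "\<bar>(snd x - snd y) / sqrt 3\<bar> \<le> dist x y" using s3[of "snd x - snd y"] s by linarith
  show "\<bar>coordX x - coordX y\<bar> \<le> 2 * dist x y" "\<bar>coordY x - coordY y\<bar> \<le> 2 * dist x y"
    "\<bar>(coordX x + coordY x) - (coordX y + coordY y)\<bar> \<le> 2 * dist x y"
    using f d eq by linarith+
qed

lemma coord_triangle_dist:
  assumes "0 \<le> coordX x" "0 \<le> coordY x" "coordX x + coordY x \<le> 1"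
    and "0 \<le> coordX y" "0 \<le> coordY y" "coordX y + coordY y \<le> 1"
  shows "dist x y \<le> 1"
proof -
  let ?a = "coordX x - coordX y" and ?b = "coordY x - coordY y"
  have y: "snd x - snd y = sqrt 3 / 2 * ?b"
    by (simp add: coordY_def field_simps)
  have x: "fst x - fst y = ?a + ?b / 2"
    by (simp add: coordX_def coordY_def field_simps)
  have "(fst x - fst y)\<^sup>2 + (snd x - snd y)\<^sup>2 = ?a\<^sup>2 + ?a * ?b + ?b\<^sup>2"
  proof -
    have "(a + b / 2)\<^sup>2 + 3 / 4 * b\<^sup>2 = a\<^sup>2 + a * b + b\<^sup>2" for a b :: real
      by (simp add: power2_eq_square field_simps)
    moreover have "(sqrt 3 / 2 * b)\<^sup>2 = 3 / 4 * b\<^sup>2" for b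
      by (simp add: power_mult_distrib power_divide)
    ultimately show ?thesis unfolding x y by metis
  qed
  also have "\<dots> \<le> 1"
  proof -
    have *: "\<bar>?a\<bar> \<le> 1" "\<bar>?b\<bar> \<le> 1" "\<bar>?a + ?b\<bar> \<le> 1" using assms by linarith+
    show ?thesis
    proof (cases "?a * ?b \<le> 0")
      case True
      consider "\<bar>?a\<bar> \<le> \<bar>?b\<bar>" | "\<bar>?b\<bar> \<le> \<bar>?a\<bar>" by linarith
      then show ?thesis
      proof cases
        case 1
        then have "\<bar>?a\<bar> * \<bar>?a\<bar> \<le> \<bar>?a\<bar> * \<bar>?b\<bar>" by (intro mult_left_mono) auto
        then have "?a * ?a \<le> \<bar>?a * ?b\<bar>" by (simp only: abs_mult abs_mult_self_eq)
        then have "?a * ?a \<le> - (?a * ?b)" using True by linarith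
        moreover have "?b\<^sup>2 \<le> 1" using *(2) by (simp add: abs_square_le_1)
        ultimately show ?thesis by (simp add: power2_eq_square)
      next
        case 2
        then have "\<bar>?b\<bar> * \<bar>?b\<bar> \<le> \<bar>?a\<bar> * \<bar>?b\<bar>" by (intro mult_right_mono) auto
        then have "?b * ?b \<le> \<bar>?a * ?b\<bar>" by (simp only: abs_mult abs_mult_self_eq)
        then have "?b * ?b \<le> - (?a * ?b)" using True by linarith
        moreover have "?a\<^sup>2 \<le> 1" using *(1) by (simp add: abs_square_le_1)
        ultimately show ?thesis by (simp add: power2_eq_square)
      qed
    next
      case False
      have "(?a + ?b)\<^sup>2 \<le> 1" using *(3) by (simp add: abs_square_le_1)
      moreover have "(?a + ?b)\<^sup>2 = ?a\<^sup>2 + ?a * ?b + ?b\<^sup>2 + ?a * ?b" by (simp add: power2_eq_square algebra_simps)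
      ultimately show ?thesis using False by linarith
    qed
  qed
  finally show ?thesis by (simp add: dist_prod_def dist_real_def)
qed

text \<open>The seven lattice differences that are allowed here are those of translates of the basic triangle with a
  common vertex.\<close>

lemma corner_difference:
  fixes d e :: int
  assumes "\<bar>d\<bar> \<le> 1" "\<bar>e\<bar> \<le> 1" "\<bar>d + e\<bar> \<le> 1"
  shows "\<exists>a\<in>corners. \<exists>b\<in>corners. int (fst a) - int (fst b) = d \<and> int (snd a) - int (snd b) = e"
proof -
  have "d = -1 \<or> d = 0 \<or> d = 1" "e = -1 \<or> e = 0 \<or> e = 1" using assms by linarith+
  then show ?thesis using assms by (auto simp: corners_def)
qed

section \<open>Words and cells\<close>

fun word_map :: "(nat \<times> nat) list \<Rightarrow> plane \<Rightarrow> plane" where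
  "word_map [] x = x"
| "word_map (i # w) x = cell_map i (word_map w x)"

text \<open>The lattice position of the cell of a word, in units of the size of this cell; the letters are the
  digits in base 7.\<close>

fun word_pos :: "(nat \<times> nat) list \<Rightarrow> nat \<times> nat" where
  "word_pos [] = (0, 0)"
| "word_pos (i # w) = (fst (word_pos w) + 7 ^ length w * fst i, snd (word_pos w) + 7 ^ length w * snd i)"

lemma word_map_append [simp]: "word_map (v @ w) x = word_map v (word_map w x)"
  by (induction v) auto

lemma coord_word_map:
  "coordX (word_map w x) = (coordX x + real (fst (word_pos w))) / 7 ^ length w"
  "coordY (word_map w x) = (coordY x + real (snd (word_pos w))) / 7 ^ length w"
  by (induction w) (auto simp: field_simps)

lemma dist_cell_map: "dist (cell_map i x) (cell_map i y) = (1/7) * dist x y"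
  by (simp add: cell_map_def dist_norm flip: scaleR_diff_right)

lemma dist_word_map: "dist (word_map w x) (word_map w y) = dist x y / 7 ^ length w"
  by (induction w) (auto simp: dist_cell_map)

lemma cell_map_inj: "cell_map i x = cell_map i y \<longleftrightarrow> x = y"
  by (simp add: cell_map_def)

lemma cell_map_eq_iff:
  "cell_map i x = cell_map j y \<longleftrightarrow>
    coordX x + real (fst i) = coordX y + real (fst j) \<and> coordY x + real (snd i) = coordY y + real (snd j)"
  using coord_eqI[of "cell_map i x" "cell_map j y"] by auto (auto dest: arg_cong[where f=coordX] arg_cong[where f=coordY])

lemma cell_map_lattice_eq_iff:
  "cell_map i (lattice_pt a) = cell_map j (lattice_pt b) \<longleftrightarrow> a + i = b + j"
  unfolding cell_map_eq_iff coord_lattice prod_eq_iff[of "a + i"] fst_add snd_add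
  by (simp flip: of_nat_add del: of_nat_add)

locale triangular_ifs =
  fixes S :: "(nat \<times> nat) set" and K :: "plane set"
  assumes finite_S: "finite S"
    and S_le: "i \<in> S \<Longrightarrow> fst i + snd i \<le> 6"
    and S_corners: "(0,0) \<in> S" "(6,0) \<in> S" "(0,6) \<in> S"
    and compact_K: "compact K" and K_nonempty: "K \<noteq> {}"
    and K_eq: "K = (\<Union>i\<in>S. cell_map i ` K)"
begin

definition words :: "nat \<Rightarrow> (nat \<times> nat) list set" where
  "words n = {w. set w \<subseteq> S \<and> length w = n}"

abbreviation piece :: "(nat \<times> nat) list \<Rightarrow> plane set" where
  "piece w \<equiv> word_map w ` K"

lemma words_0 [simp]: "words 0 = {[]}" by (auto simp: words_def)

lemma length_words: "w \<in> words n \<Longrightarrow> length w = n" by (simp add: words_def)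

lemma words_Cons_iff: "i # w \<in> words (Suc n) \<longleftrightarrow> i \<in> S \<and> w \<in> words n"
  by (auto simp: words_def)

lemma words_append: "v \<in> words m \<Longrightarrow> w \<in> words n \<Longrightarrow> v @ w \<in> words (m + n)"
  by (auto simp: words_def)

lemma words_snoc: "v \<in> words m \<Longrightarrow> i \<in> S \<Longrightarrow> v @ [i] \<in> words (Suc m)"
  by (auto simp: words_def)

lemma words_replicate: "i \<in> S \<Longrightarrow> replicate n i \<in> words n"
  by (auto simp: words_def)

lemma finite_words [simp]: "finite (words n)"
  unfolding words_def using finite_lists_length_eq[OF finite_S] by simp

lemma card_words: "card (words n) = card S ^ n"
  unfolding words_def using card_lists_length_eq[OF finite_S] by simp

lemma words_Suc_Cons: "words (Suc n) = (\<lambda>(i, w). i # w) ` (S \<times> words n)"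
  by (auto simp: words_def length_Suc_conv image_iff)

lemma words_Suc_snoc: "words (Suc n) = (\<lambda>(w, i). w @ [i]) ` (words n \<times> S)"
proof -
  have "w \<in> (\<lambda>(w, i). w @ [i]) ` (words n \<times> S)" if "w \<in> words (Suc n)" for w
  proof -
    have "w \<noteq> []" using that by (auto simp: words_def)
    then have "w = butlast w @ [last w]" by simp
    moreover have "butlast w \<in> words n" "last w \<in> S"
      using that \<open>w \<noteq> []\<close> by (auto simp: words_def dest: in_set_butlastD)
    ultimately show ?thesis by (metis (no_types, lifting) SigmaI case_prod_conv image_eqI)
  qed
  then show ?thesis by (auto simp: words_def)
qed

lemma sum_words_Cons: "(\<Sum>w\<in>words (Suc n). f w) = (\<Sum>i\<in>S. \<Sum>w\<in>words n. f (i # w))"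
  unfolding words_Suc_Cons
  by (subst sum.reindex) (auto simp: inj_on_def sum.cartesian_product split_def)

lemma sum_words_snoc: "(\<Sum>w\<in>words (Suc n). f w) = (\<Sum>w\<in>words n. \<Sum>i\<in>S. f (w @ [i]))"
  unfolding words_Suc_snoc
  by (subst sum.reindex) (auto simp: inj_on_def sum.cartesian_product split_def)

lemma cell_map_in_K: "i \<in> S \<Longrightarrow> x \<in> K \<Longrightarrow> cell_map i x \<in> K"
  using K_eq by blast

lemma word_map_in_K: "w \<in> words n \<Longrightarrow> x \<in> K \<Longrightarrow> word_map w x \<in> K"
  by (induction w arbitrary: n) (auto simp: words_def intro: cell_map_in_K)

lemma in_word_cell:
  assumes "x \<in> K"
  obtains w y where "w \<in> words n" "y \<in> K" "x = word_map w y"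
proof -
  have "\<exists>w\<in>words n. \<exists>y\<in>K. x = word_map w y" if "x \<in> K" for x
    using that
  proof (induction n arbitrary: x)
    case (Suc n)
    then obtain i x' where "i \<in> S" "x' \<in> K" "x = cell_map i x'" using K_eq by blast
    moreover obtain w y where "w \<in> words n" "y \<in> K" "x' = word_map w y"
      using Suc.IH[OF \<open>x' \<in> K\<close>] by blast
    ultimately show ?case by (intro bexI[of _ "i # w"] bexI[of _ y]) (auto simp: words_Cons_iff)
  qed auto
  then show ?thesis using assms that by blast
qed

text \<open>Each of the three barycentric coordinates attains its minimum over \<open>K\<close> inside some cell, where it is a
  seventh of a value of the same coordinate plus a nonnegative constant.\<close>

lemma K_triangle:
  assumes "x \<in> K"
  shows "0 \<le> coordX x" "0 \<le> coordY x" "coordX x + coordY x \<le> 1"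
proof -
  have cX: "continuous_on K coordX" and cY: "continuous_on K coordY"
    unfolding coordX_def coordY_def by (auto intro!: continuous_intros)
  have split: "\<exists>i\<in>S. \<exists>y'\<in>K. y = cell_map i y'" if "y \<in> K" for y using K_eq that by blast
  obtain y where y: "y \<in> K" "\<And>x. x \<in> K \<Longrightarrow> coordX y \<le> coordX x"
    using continuous_attains_inf[OF compact_K K_nonempty cX] by blast
  obtain i y' where "y' \<in> K" "y = cell_map i y'" using split y by blast
  then have "coordX y \<ge> coordX y / 7" using y(2)[of y'] by simp
  then show "0 \<le> coordX x" using y(2)[OF assms] by simp
  obtain y where y: "y \<in> K" "\<And>x. x \<in> K \<Longrightarrow> coordY y \<le> coordY x"
    using continuous_attains_inf[OF compact_K K_nonempty cY] by blast
  obtain i y' where "y' \<in> K" "y = cell_map i y'" using split y by blast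
  then have "coordY y \<ge> coordY y / 7" using y(2)[of y'] by simp
  then show "0 \<le> coordY x" using y(2)[OF assms] by simp
  obtain y where y: "y \<in> K" "\<And>x. x \<in> K \<Longrightarrow> coordX x + coordY x \<le> coordX y + coordY y"
    using continuous_attains_sup[OF compact_K K_nonempty continuous_on_add[OF cX cY]] by auto
  obtain i y' where i: "i \<in> S" "y' \<in> K" "y = cell_map i y'" using split y by blast
  have "real (fst i) + real (snd i) \<le> 6" using S_le[OF i(1)] by linarith
  moreover have "coordX y + coordY y = (coordX y' + coordY y' + (real (fst i) + real (snd i))) / 7"
    unfolding i(3) by (simp add: add_divide_distrib)
  ultimately have "coordX y + coordY y \<le> 1" using y(2)[OF i(2)] by simp
  then show "coordX x + coordY x \<le> 1" using y(2)[OF assms] by linarith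
qed

lemma dist_K_le_1: "x \<in> K \<Longrightarrow> y \<in> K \<Longrightarrow> dist x y \<le> 1"
  by (intro coord_triangle_dist K_triangle)

lemma dist_word_le: "x \<in> K \<Longrightarrow> y \<in> K \<Longrightarrow> dist (word_map w x) (word_map w y) \<le> 1 / 7 ^ length w"
  unfolding dist_word_map using dist_K_le_1 by (intro divide_right_mono) auto

text \<open>The cell at a corner of the big triangle; its map fixes this corner.\<close>

definition corner_cell :: "nat \<times> nat \<Rightarrow> nat \<times> nat" where
  "corner_cell e = (6 * fst e, 6 * snd e)"

lemma corner_cell_in_S: "e \<in> corners \<Longrightarrow> corner_cell e \<in> S"
  using S_corners by (auto simp: corners_def corner_cell_def)

lemma cell_map_corner: "cell_map (corner_cell e) (lattice_pt e) = lattice_pt e"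
  by (rule coord_eqI) (simp_all add: corner_cell_def)

lemma word_map_corner: "word_map (replicate n (corner_cell e)) (lattice_pt e) = lattice_pt e"
  by (induction n) (simp_all add: cell_map_corner)

lemma corner_in_K:
  assumes "e \<in> corners"
  shows "lattice_pt e \<in> K"
proof -
  obtain y where y: "y \<in> K" using K_nonempty by blast
  define s where "s n = word_map (replicate n (corner_cell e)) y" for n
  have "s n \<in> K" for n
    unfolding s_def by (rule word_map_in_K[OF words_replicate[OF corner_cell_in_S[OF assms]] y])
  moreover have "s \<longlonglongrightarrow> lattice_pt e"
  proof (rule metric_LIMSEQ_I)
    fix r :: real assume "0 < r"
    have "dist (s n) (lattice_pt e) = dist y (lattice_pt e) / 7 ^ n" for n
      using dist_word_map[of "replicate n (corner_cell e)" y "lattice_pt e"]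
      by (simp add: s_def word_map_corner)
    moreover have "(\<lambda>n. dist y (lattice_pt e) / 7 ^ n) \<longlonglongrightarrow> 0"
      by (rule LIMSEQ_divide_realpow_zero) simp
    ultimately show "\<exists>no. \<forall>n\<ge>no. dist (s n) (lattice_pt e) < r"
      using \<open>0 < r\<close> by (auto simp: LIMSEQ_iff)
  qed
  ultimately show ?thesis
    using closed_sequentially[OF compact_imp_closed[OF compact_K]] by blast
qed

text \<open>Two distinct cells of the lattice are translates of the same closed triangle by different lattice
  vectors, so they have at most one point in common, and this is a vertex of both.\<close>

lemma cells_meet:
  assumes ij: "i \<noteq> j" and xy: "x \<in> K" "y \<in> K" and eq: "cell_map i x = cell_map j y"
  obtains a b where "a \<in> corners" "b \<in> corners" "x = lattice_pt a" "y = lattice_pt b" "a + i = b + j"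
proof -
  define d where "d = int (fst j) - int (fst i)"
  define e where "e = int (snd j) - int (snd i)"
  have X: "coordX x - coordX y = of_int d" and Y: "coordY x - coordY y = of_int e"
    using eq unfolding cell_map_eq_iff d_def e_def by auto
  note x = K_triangle[OF xy(1)] and y = K_triangle[OF xy(2)]
  have "\<bar>d\<bar> \<le> 1" "\<bar>e\<bar> \<le> 1" "\<bar>d + e\<bar> \<le> 1"
    using X Y x y by linarith+
  then have cases: "(d = 0 \<and> e = 0) \<or> (d = 1 \<and> e = 0) \<or> (d = -1 \<and> e = 0) \<or> (d = 0 \<and> e = 1) \<or> (d = 0 \<and> e = -1)
      \<or> (d = 1 \<and> e = -1) \<or> (d = -1 \<and> e = 1)"
    by presburger
  have "\<not> (d = 0 \<and> e = 0)" using ij by (auto simp: d_def e_def prod_eq_iff)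
  have "\<exists>a\<in>corners. \<exists>b\<in>corners. x = lattice_pt a \<and> y = lattice_pt b"
  proof -
    have eqI: "\<exists>a\<in>corners. \<exists>b\<in>corners. x = lattice_pt a \<and> y = lattice_pt b"
      if "a \<in> corners" "b \<in> corners" "coordX x = fst a" "coordY x = snd a" "coordX y = fst b" "coordY y = snd b" for a b
      using that by (intro bexI[of _ a] bexI[of _ b] conjI coord_eqI) auto
    consider "d = 1" "e = 0" | "d = -1" "e = 0" | "d = 0" "e = 1" | "d = 0" "e = -1"
      | "d = 1" "e = -1" | "d = -1" "e = 1"
      using cases \<open>\<not> (d = 0 \<and> e = 0)\<close> by blast
    then show ?thesis
    proof cases
      case 1 then show ?thesis using X Y x y by (intro eqI[of "(1,0)" "(0,0)"]) (auto simp: corners_def)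
    next
      case 2 then show ?thesis using X Y x y by (intro eqI[of "(0,0)" "(1,0)"]) (auto simp: corners_def)
    next
      case 3 then show ?thesis using X Y x y by (intro eqI[of "(0,1)" "(0,0)"]) (auto simp: corners_def)
    next
      case 4 then show ?thesis using X Y x y by (intro eqI[of "(0,0)" "(0,1)"]) (auto simp: corners_def)
    next
      case 5 then show ?thesis using X Y x y by (intro eqI[of "(1,0)" "(0,1)"]) (auto simp: corners_def)
    next
      case 6 then show ?thesis using X Y x y by (intro eqI[of "(0,1)" "(1,0)"]) (auto simp: corners_def)
    qed
  qed
  then obtain a b where "a \<in> corners" "b \<in> corners" "x = lattice_pt a" "y = lattice_pt b" by blast
  moreover from this have "a + i = b + j" using eq cell_map_lattice_eq_iff by blast
  ultimately show ?thesis using that by blast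
qed

lemma word_pos_less:
  assumes "w \<in> words n"
  shows "fst (word_pos w) < 7 ^ n" "snd (word_pos w) < 7 ^ n"
proof -
  have "fst (word_pos w) < 7 ^ length w \<and> snd (word_pos w) < 7 ^ length w" if "set w \<subseteq> S" for w
    using that
  proof (induction w)
    case (Cons i w)
    have "fst i \<le> 6" "snd i \<le> 6" using Cons.prems S_le[of i] by auto
    then have "7 ^ length w * fst i \<le> 7 ^ length w * 6" "7 ^ length w * snd i \<le> 7 ^ length w * (6::nat)"
      by (intro mult_left_mono; simp)+
    moreover have "fst (word_pos w) < 7 ^ length w" "snd (word_pos w) < 7 ^ length w" using Cons by auto
    ultimately have "fst (word_pos w) + 7 ^ length w * fst i < 7 ^ length w + 7 ^ length w * 6"
      "snd (word_pos w) + 7 ^ length w * snd i < 7 ^ length w + 7 ^ length w * 6"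
      by (blast intro: add_less_le_mono)+
    then show ?case by simp
  qed auto
  then show "fst (word_pos w) < 7 ^ n" "snd (word_pos w) < 7 ^ n"
    using assms by (auto simp: words_def)
qed

text \<open>Letters have coordinates at most 6, so the expansion of a lattice position in base 7 is unique.\<close>

lemma word_pos_inj: "inj_on word_pos (words n)"
proof (rule inj_onI)
  have "v = w" if "v \<in> words n" "w \<in> words n" "word_pos v = word_pos w" for v w
    using that
  proof (induction n arbitrary: v w)
    case (Suc n)
    obtain i v' where v: "v = i # v'" "i \<in> S" "v' \<in> words n" using Suc.prems(1) by (auto simp: words_Suc_Cons)
    obtain j w' where w: "w = j # w'" "j \<in> S" "w' \<in> words n" using Suc.prems(2) by (auto simp: words_Suc_Cons)
    have digit: "a = b \<and> p = q" if "p + 7 ^ n * a = q + 7 ^ n * b" "p < 7 ^ n" "q < 7 ^ n" for a b p q :: nat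
    proof -
      have "(p + 7 ^ n * a) div 7 ^ n = a" using that(2) by simp
      moreover have "(q + 7 ^ n * b) div 7 ^ n = b" using that(3) by simp
      ultimately have "a = b" using that(1) by (metis (no_types))
      then show ?thesis using that(1) by simp
    qed
    have "fst i = fst j \<and> fst (word_pos v') = fst (word_pos w')"
      "snd i = snd j \<and> snd (word_pos v') = snd (word_pos w')"
      using Suc.prems(3) v w word_pos_less[OF v(3)] word_pos_less[OF w(3)]
      by (intro digit; simp add: length_words)+
    then show ?case using Suc.IH[OF v(3) w(3)] v w by (auto simp: prod_eq_iff)
  qed auto
  then show "v = w" if "v \<in> words n" "w \<in> words n" "word_pos v = word_pos w" for v w using that .
qed

text \<open>Cells of equal size whose distance is at most this size have lattice positions differing by at most 3.\<close>

definition close_words :: "(nat \<times> nat) list \<Rightarrow> (nat \<times> nat) list \<Rightarrow> bool" where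
  "close_words v w \<longleftrightarrow> \<bar>int (fst (word_pos v)) - int (fst (word_pos w))\<bar> \<le> 3 \<and>
     \<bar>int (snd (word_pos v)) - int (snd (word_pos w))\<bar> \<le> 3"

lemma close_words_sym: "close_words v w \<longleftrightarrow> close_words w v"
  by (auto simp: close_words_def)

lemma card_close_words: "card {v \<in> words n. close_words v w} \<le> 49"
proof -
  let ?p = "\<lambda>v. (int (fst (word_pos v)) - int (fst (word_pos w)), int (snd (word_pos v)) - int (snd (word_pos w)))"
  have "inj_on ?p {v \<in> words n. close_words v w}"
    using word_pos_inj[of n] by (auto simp: inj_on_def prod_eq_iff)
  moreover have "?p ` {v \<in> words n. close_words v w} \<subseteq> {-3..3} \<times> {-3..3}"
    by (auto simp: close_words_def)
  moreover have "card ({-3..3::int} \<times> {-3..3::int}) = 49" by simp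
  ultimately show ?thesis
    using card_inj_on_le[of ?p "{v \<in> words n. close_words v w}" "{-3..3} \<times> {-3..3}"] by simp
qed

lemma words_close:
  assumes v: "v \<in> words n" and w: "w \<in> words n" and xy: "x \<in> K" "y \<in> K"
    and d: "dist (word_map v x) (word_map w y) \<le> 1 / 7 ^ n"
  shows "close_words v w"
proof -
  note x = K_triangle[OF xy(1)] and y = K_triangle[OF xy(2)]
  have le: "\<bar>s - t\<bar> \<le> 2" if "\<bar>s / 7 ^ n - t / 7 ^ n\<bar> \<le> 2 * dist (word_map v x) (word_map w y)" for s t :: real
  proof -
    have "\<bar>s - t\<bar> / 7 ^ n \<le> 2 / 7 ^ n" using that d by (simp add: diff_divide_distrib[symmetric])
    then show ?thesis by (simp add: divide_le_cancel)
  qed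
  have "\<bar>(coordX x + real (fst (word_pos v))) - (coordX y + real (fst (word_pos w)))\<bar> \<le> 2"
    "\<bar>(coordY x + real (snd (word_pos v))) - (coordY y + real (snd (word_pos w)))\<bar> \<le> 2"
    using coord_lipschitz[of "word_map v x" "word_map w y"]
    by (intro le; simp add: coord_word_map length_words[OF v] length_words[OF w])+
  then show ?thesis unfolding close_words_def using x y by linarith
qed

text \<open>At distance less than a seventh of the cell size, the lattice positions of the two cells differ by less
  than two in each of the three directions, so the cells have a common vertex.\<close>

lemma words_touch:
  assumes v: "v \<in> words n" and w: "w \<in> words n" and xy: "x \<in> K" "y \<in> K"
    and d: "dist (word_map v x) (word_map w y) < 1 / (7 * 7 ^ n)"
  obtains a b where "a \<in> corners" "b \<in> corners" "word_map v (lattice_pt a) = word_map w (lattice_pt b)"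
proof -
  note x = K_triangle[OF xy(1)] and y = K_triangle[OF xy(2)]
  have lt: "\<bar>s - t\<bar> < 1" if "\<bar>s / 7 ^ n - t / 7 ^ n\<bar> \<le> 2 * dist (word_map v x) (word_map w y)" for s t :: real
  proof -
    have "2 * (1 / (7 * 7 ^ n)) < (1::real) / 7 ^ n" by (simp add: field_simps)
    moreover have "\<bar>s - t\<bar> / 7 ^ n \<le> 2 * dist (word_map v x) (word_map w y)"
      using that by (simp add: diff_divide_distrib[symmetric])
    ultimately have "\<bar>s - t\<bar> / 7 ^ n < 1 / 7 ^ n" using d by linarith
    then show ?thesis by (simp add: divide_less_cancel)
  qed
  have 1: "\<bar>(coordX x + real (fst (word_pos v))) - (coordX y + real (fst (word_pos w)))\<bar> < 1"
    "\<bar>(coordY x + real (snd (word_pos v))) - (coordY y + real (snd (word_pos w)))\<bar> < 1"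
    "\<bar>((coordX x + coordY x) + real (fst (word_pos v) + snd (word_pos v))) -
      ((coordX y + coordY y) + real (fst (word_pos w) + snd (word_pos w)))\<bar> < 1"
    using coord_lipschitz[of "word_map v x" "word_map w y"]
    by (intro lt; simp add: coord_word_map length_words[OF v] length_words[OF w] algebra_simps add_divide_distrib)+
  define d where "d = int (fst (word_pos w)) - int (fst (word_pos v))"
  define e where "e = int (snd (word_pos w)) - int (snd (word_pos v))"
  have "\<bar>d\<bar> \<le> 1" "\<bar>e\<bar> \<le> 1" "\<bar>d + e\<bar> \<le> 1"
    using 1 x y unfolding d_def e_def by linarith+
  from corner_difference[OF this] obtain a b where ab: "a \<in> corners" "b \<in> corners"
    "int (fst a) - int (fst b) = d" "int (snd a) - int (snd b) = e" by blast
  have "fst a + fst (word_pos v) = fst b + fst (word_pos w)" "snd a + snd (word_pos v) = snd b + snd (word_pos w)"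
    using ab(3,4) unfolding d_def e_def by linarith+
  then have "word_map v (lattice_pt a) = word_map w (lattice_pt b)"
    by (intro coord_eqI) (simp_all add: coord_word_map length_words[OF v] length_words[OF w] flip: of_nat_add)
  then show ?thesis using that ab by blast
qed

end

section \<open>The normalized Hausdorff measure of the attractor\<close>

locale ifs17 = triangular_ifs +
  fixes \<alpha> :: real
  assumes card_S: "card S = 17" and alpha: "\<alpha> = ln 17 / ln 7"
begin

abbreviation mu :: "plane measure" where "mu \<equiv> normalized_hausdorff \<alpha> K"

lemma alpha_pos: "\<alpha> > 0" by (simp add: alpha)

lemma powr_7_alpha: "7 powr \<alpha> = 17"
  by (simp add: alpha powr_def)

lemma inverse_powr_alpha: "(1 / 7 ^ n) powr \<alpha> = 1 / 17 ^ n"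
proof -
  have "(7 ^ n) powr \<alpha> = (7 powr \<alpha>) ^ n"
    by (simp add: powr_realpow[symmetric] powr_powr mult.commute)
  then show ?thesis by (simp add: powr_divide powr_7_alpha)
qed

lemma card_words17: "card (words n) = 17 ^ n"
  by (simp add: card_words card_S)

lemma continuous_word_map: "continuous_on A (word_map w)"
proof (induction w)
  case (Cons i w)
  then show ?case unfolding word_map.simps cell_map_def by (intro continuous_intros) simp
qed (simp add: continuous_on_id)

lemma surj_word_map: "surj (word_map w)"
proof (induction w)
  case (Cons i w)
  have "surj (cell_map i)"
  proof (rule surjI)
    show "cell_map i (7 *\<^sub>R (x - grid_pt i)) = x" for x by (simp add: cell_map_def)
  qed
  moreover have "word_map (i # w) = cell_map i \<circ> word_map w" by (simp add: fun_eq_iff)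
  ultimately show ?case using comp_surj[OF Cons] by (metis (no_types))
qed (simp add: surj_def)

lemma word_cell_compact: "compact (piece w)"
  by (rule compact_continuous_image[OF continuous_word_map compact_K])

lemma word_cell_borel: "piece w \<in> sets borel"
  by (intro borel_closed compact_imp_closed word_cell_compact)

text \<open>The \<open>17 ^ n\<close> cells of level \<open>n\<close> form a cover by sets of diameter \<open>7 ^ (- n)\<close>, and \<open>7 powr \<alpha> = 17\<close>.\<close>

lemma outer_K_le: "hausdorff_outer \<alpha> K \<le> 1"
  unfolding hausdorff_outer_def
proof (rule SUP_least)
  fix \<delta> :: real assume "\<delta> \<in> {0<..}"
  then obtain n where n: "(1/7) ^ n < \<delta>" using real_arch_pow_inv[of \<delta> "1/7"] by auto
  obtain h where h: "bij_betw h {0..<card (words n)} (words n)"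
    using ex_bij_betw_nat_finite[OF finite_words] by blast
  define U where "U k = (if k < 17 ^ n then piece (h k) else {})" for k
  have hw: "h k \<in> words n" if "k < 17 ^ n" for k
    using h that by (auto simp: bij_betw_def card_words17)
  have diam: "diameter (piece w) \<le> 1 / 7 ^ n" if "w \<in> words n" for w
    using dist_word_le[of _ _ w] length_words[OF that]
    by (intro diameter_le) (auto simp: dist_norm)
  have "U \<in> hausdorff_covers \<delta> K"
  proof (intro CollectI conjI allI)
    show "K \<subseteq> (\<Union>k. U k)"
    proof
      fix x assume "x \<in> K"
      then obtain w y where w: "w \<in> words n" "y \<in> K" "x = word_map w y" by (rule in_word_cell)
      then have "w \<in> h ` {0..<17 ^ n}" using h by (simp add: bij_betw_def card_words17)
      then obtain k where "k < 17 ^ n" "w = h k" by auto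
      then show "x \<in> (\<Union>k. U k)" using w by (auto simp: U_def intro!: exI[of _ k])
    qed
    fix k
    show "bounded (U k)" by (auto simp: U_def intro: compact_imp_bounded word_cell_compact)
    have "1 / 7 ^ n \<le> \<delta>" using n by (simp add: power_one_over)
    then show "diameter (U k) \<le> \<delta>"
      using diam[OF hw[of k]] \<open>\<delta> \<in> {0<..}\<close> by (auto simp: U_def)
  qed
  then have "hausdorff_content \<alpha> \<delta> K \<le> (\<Sum>k. ennreal (diameter (U k) powr \<alpha>))" by (rule content_le)
  also have "\<dots> = (\<Sum>k<17 ^ n. ennreal (diameter (U k) powr \<alpha>))"
    by (rule suminf_finite) (auto simp: U_def)
  also have "\<dots> \<le> (\<Sum>k<17 ^ n::nat. ennreal (1 / 17 ^ n))"
  proof (intro sum_mono ennreal_leI)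
    fix k :: nat assume "k \<in> {..<17 ^ n}"
    then have "diameter (U k) \<le> 1 / 7 ^ n" using diam[OF hw[of k]] by (auto simp: U_def)
    moreover have "0 \<le> diameter (U k)"
      by (auto simp: U_def intro!: diameter_ge_0 compact_imp_bounded word_cell_compact)
    ultimately show "diameter (U k) powr \<alpha> \<le> 1 / 17 ^ n"
      unfolding inverse_powr_alpha[symmetric] using alpha_pos by (intro powr_mono2) auto
  qed
  also have "\<dots> = ennreal (\<Sum>k<17 ^ n::nat. 1 / 17 ^ n)" by (rule sum_ennreal) simp
  also have "\<dots> = 1" by simp
  finally show "hausdorff_content \<alpha> \<delta> K \<le> 1" .
qed

text \<open>The cells of level \<open>k\<close> that meet \<open>V\<close> are all close to any one of them, so there are at most 49 of them,
  and each is the union of \<open>17 ^ (N - k)\<close> cells of level \<open>N\<close>.\<close>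

lemma card_words_meeting:
  assumes V: "\<And>x y. x \<in> V \<Longrightarrow> y \<in> V \<Longrightarrow> dist x y \<le> 1 / 7 ^ k" and p: "p \<in> K" and kN: "k \<le> N"
  shows "card {w \<in> words N. word_map w p \<in> V} \<le> 49 * 17 ^ (N - k)"
proof (cases "{w \<in> words N. word_map w p \<in> V} = {}")
  case False
  then obtain w0 where w0: "w0 \<in> words N" "word_map w0 p \<in> V" by blast
  have split: "take k w \<in> words k \<and> drop k w \<in> words (N - k) \<and> w = take k w @ drop k w" if "w \<in> words N" for w
    using that kN by (auto simp: words_def dest: in_set_takeD in_set_dropD)
  let ?C = "{v \<in> words k. close_words v (take k w0)}"
  have "{w \<in> words N. word_map w p \<in> V} \<subseteq> (\<lambda>(v, u). v @ u) ` (?C \<times> words (N - k))"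
  proof
    fix w assume "w \<in> {w \<in> words N. word_map w p \<in> V}"
    then have w: "w \<in> words N" "word_map w p \<in> V" by auto
    have eq: "word_map w p = word_map (take k w) (word_map (drop k w) p)" for w
      by (metis append_take_drop_id word_map_append)
    have "close_words (take k w) (take k w0)"
    proof (rule words_close[of _ k _ "word_map (drop k w) p" "word_map (drop k w0) p"])
      show "dist (word_map (take k w) (word_map (drop k w) p)) (word_map (take k w0) (word_map (drop k w0) p)) \<le> 1 / 7 ^ k"
        using V[OF w(2) w0(2)] by (simp flip: eq)
    qed (use split[OF w(1)] split[OF w0(1)] p in \<open>auto intro: word_map_in_K\<close>)
    then show "w \<in> (\<lambda>(v, u). v @ u) ` (?C \<times> words (N - k))"
      using split[OF w(1)] by (intro image_eqI[of _ _ "(take k w, drop k w)"]) auto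
  qed
  then have "card {w \<in> words N. word_map w p \<in> V} \<le> card ((\<lambda>(v, u). v @ u) ` (?C \<times> words (N - k)))"
    by (intro card_mono) auto
  also have "\<dots> \<le> card (?C \<times> words (N - k))" by (intro card_image_le) auto
  also have "\<dots> \<le> 49 * 17 ^ (N - k)"
    using card_close_words by (simp add: card_cartesian_product card_words17)
  finally show ?thesis .
next
  case True
  show ?thesis unfolding True by simp
qed

text \<open>After slightly enlarging the sets of a cover to open sets of diameters at most \<open>t n\<close> and passing to a
  finite subcover, count the cells of a fine level \<open>N\<close>: a set of diameter \<open>t\<close> accounts for at most
  \<open>833 * t powr \<alpha> * 17 ^ N\<close> of the \<open>17 ^ N\<close> cells, where \<open>833 = 49 * 17\<close>. This is the mass distribution
  principle for the measure that gives mass \<open>17 ^ (- N)\<close> to each cell of level \<open>N\<close>.\<close>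

lemma content_K_ge:
  assumes U: "U \<in> hausdorff_covers \<delta> K"
  shows "ennreal (1/1666) \<le> (\<Sum>n. ennreal (diameter (U n) powr \<alpha>))"
proof (rule ccontr)
  assume "\<not> ?thesis"
  then have small: "(\<Sum>n. ennreal (diameter (U n) powr \<alpha>)) < ennreal (1/1666)" by simp
  define d where "d n = diameter (U n)" for n
  have d0: "0 \<le> d n" for n using U by (auto simp: d_def intro: diameter_ge_0)
  \<comment> \<open>Half of the available mass \<open>1/833\<close> is left for the enlargement of the covering sets.\<close>
  define e :: "nat \<Rightarrow> real" where "e n = (1/2)^Suc n / 1666" for n
  have e0: "e n > 0" for n by (simp add: e_def)
  define t where "t n = (d n powr \<alpha> + e n) powr (1/\<alpha>)" for n
  have t_alpha: "t n powr \<alpha> = d n powr \<alpha> + e n" for n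
  proof -
    have "0 \<le> d n powr \<alpha> + e n" using e0[of n] by (simp add: add_nonneg_pos less_imp_le)
    then show ?thesis using alpha_pos by (simp add: t_def powr_powr)
  qed
  have dt: "d n < t n" for n
  proof (rule ccontr)
    assume "\<not> d n < t n"
    then have "t n powr \<alpha> \<le> d n powr \<alpha>"
      using alpha_pos by (intro powr_mono2) (auto simp: t_def)
    then show False using t_alpha[of n] e0[of n] by simp
  qed
  define V where "V n = (\<Union>x\<in>U n. ball x ((t n - d n) / 2))" for n
  have V_open: "open (V n)" for n by (auto simp: V_def)
  have UV: "U n \<subseteq> V n" for n using dt[of n] by (auto simp: V_def)
  have V_dist: "dist x y \<le> t n" if "x \<in> V n" "y \<in> V n" for x y n
  proof -
    obtain x' y' where *: "x' \<in> U n" "y' \<in> U n" "dist x' x < (t n - d n) / 2" "dist y' y < (t n - d n) / 2"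
      using \<open>x \<in> V n\<close> \<open>y \<in> V n\<close> by (auto simp: V_def)
    have "dist x' y' \<le> d n" unfolding d_def using U * by (intro diameter_bounded_bound) auto
    moreover have "dist x y \<le> dist x' x + dist x' y' + dist y' y"
      using dist_triangle[of x y x'] dist_triangle[of x' y y'] by (simp add: dist_commute)
    ultimately show ?thesis using * by argo
  qed
  have "K \<subseteq> (\<Union>n\<in>UNIV. V n)" using U UV by blast
  then obtain F where F: "finite F" "K \<subseteq> (\<Union>n\<in>F. V n)"
    using compactE_image[OF compact_K, of UNIV V] V_open by (metis)
  have half: "(\<Sum>n\<in>F. e n) \<le> 1/1666"
  proof -
    have "(\<Sum>n\<in>F. (1/2)^Suc n) \<le> (\<Sum>n. (1/2::real)^Suc n)"
      using F(1) power_half_series by (intro sum_le_suminf) (auto simp: sums_iff)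
    then have "(\<Sum>n\<in>F. (1/2)^Suc n) / 1666 \<le> (1::real) / 1666"
      using power_half_series by (auto simp: sums_iff)
    then show ?thesis unfolding e_def sum_divide_distrib .
  qed
  have "ennreal (\<Sum>n\<in>F. d n powr \<alpha>) = (\<Sum>n\<in>F. ennreal (diameter (U n) powr \<alpha>))"
    by (simp add: d_def sum_ennreal)
  also have "\<dots> \<le> (\<Sum>n. ennreal (diameter (U n) powr \<alpha>))"
    using F(1) by (intro sum_le_suminf) auto
  also note small
  finally have dsum: "(\<Sum>n\<in>F. d n powr \<alpha>) < 1/1666"
    by (simp add: ennreal_less_iff sum_nonneg)
  have tsum: "(\<Sum>n\<in>F. t n powr \<alpha>) < 1/833"
    using dsum half by (simp add: t_alpha sum.distrib)
  have t1: "t n \<le> 1" if "n \<in> F" for n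
  proof (rule ccontr)
    assume "\<not> t n \<le> 1"
    then have "1 \<le> t n powr \<alpha>" using alpha_pos by (simp add: ge_one_powr_ge_zero)
    also have "\<dots> \<le> (\<Sum>n\<in>F. t n powr \<alpha>)" using F(1) that by (intro member_le_sum) auto
    finally show False using tsum by simp
  qed
  have "\<exists>k. 1 / 7 ^ Suc k < t n \<and> t n \<le> 1 / 7 ^ k" if "n \<in> F" for n
  proof -
    have "0 < t n" using d0[of n] dt[of n] by linarith
    then obtain m where "(1/7) ^ m < t n" using real_arch_pow_inv[of "t n" "1/7"] by auto
    then have ex: "\<exists>m. 1 / 7 ^ m < t n" by (auto simp: power_one_over)
    define m where "m = (LEAST m. 1 / 7 ^ m < t n)"
    have m: "1 / 7 ^ m < t n" "\<And>l. l < m \<Longrightarrow> \<not> 1 / 7 ^ l < t n"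
      unfolding m_def using LeastI_ex[OF ex] not_less_Least by blast+
    have "m \<noteq> 0" using m(1) t1[OF that] by (cases m) auto
    then obtain k where "m = Suc k" by (cases m) auto
    then show ?thesis using m(1) m(2)[of k] by auto
  qed
  then obtain k where k: "\<And>n. n \<in> F \<Longrightarrow> 1 / 7 ^ Suc (k n) < t n \<and> t n \<le> 1 / 7 ^ k n" by metis
  obtain N where N: "\<And>n. n \<in> F \<Longrightarrow> k n \<le> N"
    using finite_nat_set_iff_bounded_le[of "k ` F"] F(1) by auto
  obtain p where p: "p \<in> K" using K_nonempty by blast
  have "words N \<subseteq> (\<Union>n\<in>F. {w \<in> words N. word_map w p \<in> V n})"
    using word_map_in_K[OF _ p] F(2) by blast
  then have "17 ^ N \<le> card (\<Union>n\<in>F. {w \<in> words N. word_map w p \<in> V n})"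
    unfolding card_words17[symmetric] using F(1) by (intro card_mono) auto
  also have "\<dots> \<le> (\<Sum>n\<in>F. card {w \<in> words N. word_map w p \<in> V n})"
    using F(1) by (rule card_UN_le)
  finally have "real (17 ^ N) \<le> real (\<Sum>n\<in>F. card {w \<in> words N. word_map w p \<in> V n})"
    by (rule of_nat_mono)
  also have "\<dots> = (\<Sum>n\<in>F. real (card {w \<in> words N. word_map w p \<in> V n}))" by simp
  also have "\<dots> \<le> (\<Sum>n\<in>F. 833 * 17 ^ N * (t n powr \<alpha>))"
  proof (rule sum_mono)
    fix n assume n: "n \<in> F"
    have "card {w \<in> words N. word_map w p \<in> V n} \<le> 49 * 17 ^ (N - k n)"
      using V_dist[of _ n] k[OF n] N[OF n] p by (intro card_words_meeting) (blast intro: order_trans)+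
    then have "real (card {w \<in> words N. word_map w p \<in> V n}) \<le> real (49 * 17 ^ (N - k n))"
      by (rule of_nat_mono)
    also have "real (49 * 17 ^ (N - k n)) = 833 * 17 ^ N * (1 / 17 ^ Suc (k n))"
    proof -
      have "(17::real) ^ N = 17 ^ (N - k n) * 17 ^ k n" using N[OF n] by (simp add: power_add[symmetric])
      then show ?thesis by simp
    qed
    also have "\<dots> \<le> 833 * 17 ^ N * (t n powr \<alpha>)"
      unfolding inverse_powr_alpha[symmetric]
      using k[OF n] alpha_pos by (intro mult_left_mono powr_mono2) auto
    finally show "real (card {w \<in> words N. word_map w p \<in> V n}) \<le> 833 * 17 ^ N * (t n powr \<alpha>)" .
  qed
  also have "\<dots> = 833 * 17 ^ N * (\<Sum>n\<in>F. t n powr \<alpha>)" by (simp add: sum_distrib_left)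
  also have "\<dots> < 833 * 17 ^ N * (1 / 833)" using tsum by (intro mult_strict_left_mono) auto
  finally show False by simp
qed

lemma outer_K_pos: "hausdorff_outer \<alpha> K > 0"
proof -
  have "ennreal (1/1666) \<le> hausdorff_content \<alpha> 1 K"
    unfolding hausdorff_content_def by (rule INF_greatest) (rule content_K_ge)
  also have "\<dots> \<le> hausdorff_outer \<alpha> K" by (rule content_le_outer) simp
  finally show ?thesis by (rule less_le_trans[rotated]) simp
qed

lemma outer_word_cell:
  assumes "w \<in> words n"
  shows "hausdorff_outer \<alpha> (piece w) = ennreal (1 / 17 ^ n) * hausdorff_outer \<alpha> K"
proof -
  have "hausdorff_outer \<alpha> (piece w) = ennreal ((1 / 7 ^ n) powr \<alpha>) * hausdorff_outer \<alpha> K"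
    by (rule outer_similarity[where G = "inv (word_map w)"])
      (simp_all add: dist_word_map length_words[OF assms] surj_f_inv_f[OF surj_word_map] alpha_pos)
  then show ?thesis by (simp add: inverse_powr_alpha)
qed

lemma K_borel: "K \<in> sets borel"
  by (intro borel_closed compact_imp_closed compact_K)

lemma space_mu [simp]: "space mu = K"
  by (simp add: normalized_hausdorff_def space_restrict_space space_scale_measure)

lemma sets_mu [measurable_cong]: "sets mu = sets (restrict_space borel K)"
  by (simp add: normalized_hausdorff_def sets_restrict_space)

lemma sets_mu_iff: "A \<in> sets mu \<longleftrightarrow> A \<in> sets borel \<and> A \<subseteq> K"
  unfolding sets_mu using sets_restrict_space_iff[of K borel A] K_borel by auto

lemma emeasure_mu:
  assumes "A \<in> sets borel" "A \<subseteq> K"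
  shows "emeasure mu A = inverse (hausdorff_outer \<alpha> K) * hausdorff_outer \<alpha> A"
proof -
  have "emeasure mu A = inverse (emeasure (hausdorff_measure \<alpha>) K) * emeasure (hausdorff_measure \<alpha>) A"
    using assms K_borel by (simp add: normalized_hausdorff_def emeasure_restrict_space)
  then show ?thesis using assms K_borel by (simp add: emeasure_hausdorff)
qed

lemma emeasure_word_cell:
  assumes "w \<in> words n"
  shows "emeasure mu (piece w) = ennreal (1 / 17 ^ n)"
proof -
  have "piece w \<subseteq> K" using word_map_in_K[OF assms] by blast
  then have "emeasure mu (piece w) =
      ennreal (1 / 17 ^ n) * (inverse (hausdorff_outer \<alpha> K) * hausdorff_outer \<alpha> K)"
    using word_cell_borel by (simp add: emeasure_mu outer_word_cell[OF assms] mult_ac)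
  also have "inverse (hausdorff_outer \<alpha> K) * hausdorff_outer \<alpha> K = 1"
    using outer_K_pos outer_K_le ennreal_divide_self[of "hausdorff_outer \<alpha> K"]
    by (simp add: divide_ennreal_def mult.commute order_le_less_trans[OF _ ennreal_one_less_top])
  finally show ?thesis by simp
qed

lemma word_cell_sets: "w \<in> words n \<Longrightarrow> piece w \<in> sets mu"
  using word_cell_borel word_map_in_K by (auto simp: sets_mu_iff)

lemma measure_word_cell: "w \<in> words n \<Longrightarrow> measure mu (piece w) = 1 / 17 ^ n"
  using emeasure_word_cell by (simp add: measure_def)

lemma emeasure_K: "emeasure mu K = 1"
  using emeasure_word_cell[of "[]" 0] by simp

sublocale mu: finite_measure mu
  by (rule finite_measureI) (simp add: emeasure_K)

lemma measure_mu_K: "measure mu K = 1"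
  by (simp add: measure_def emeasure_K)

end

section \<open>Functions with square summable oscillations on cells\<close>

context triangular_ifs
begin

lemma in_cell:
  assumes "x \<in> K"
  obtains i y where "i \<in> S" "y \<in> K" "x = cell_map i y"
proof -
  have "x \<in> (\<Union>i\<in>S. cell_map i ` K)" using assms K_eq by simp
  then show ?thesis using that by blast
qed

definition osc_le :: "(plane \<Rightarrow> real) \<Rightarrow> nat \<Rightarrow> ((nat \<times> nat) list \<Rightarrow> real) \<Rightarrow> bool" where
  "osc_le u n b \<longleftrightarrow> (\<forall>w\<in>words n. \<forall>x\<in>K. \<forall>y\<in>K. \<bar>u (word_map w x) - u (word_map w y)\<bar> \<le> b w)"

text \<open>The functions whose squared oscillations on the cells of level \<open>n\<close> add up to \<open>O(\<rho> ^ n)\<close>. All members of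
  Besov spaces that are constructed below are obtained in this form, with \<open>\<rho> = 1/7\<close> at the exponent for
  density in \<open>C(K)\<close> and \<open>\<rho> = 2/17\<close> at the second critical exponent.\<close>

definition osc_class :: "real \<Rightarrow> (plane \<Rightarrow> real) set" where
  "osc_class \<rho> = {u. \<exists>C. \<forall>n. \<exists>b. osc_le u n b \<and> (\<Sum>w\<in>words n. (b w)\<^sup>2) \<le> C * \<rho> ^ n}"

lemma osc_leD: "osc_le u n b \<Longrightarrow> w \<in> words n \<Longrightarrow> x \<in> K \<Longrightarrow> y \<in> K \<Longrightarrow>
    \<bar>u (word_map w x) - u (word_map w y)\<bar> \<le> b w"
  by (simp add: osc_le_def)

lemma osc_classI:
  assumes "\<And>n. osc_le u n (b n)" "\<And>n. (\<Sum>w\<in>words n. (b n w)\<^sup>2) \<le> C * \<rho> ^ n"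
  shows "u \<in> osc_class \<rho>"
  unfolding osc_class_def using assms by blast

lemma osc_classE:
  assumes "u \<in> osc_class \<rho>"
  obtains C b where "\<forall>n. osc_le u n (b n)" "\<forall>n. (\<Sum>w\<in>words n. (b n w)\<^sup>2) \<le> C * \<rho> ^ n"
proof -
  obtain C where "\<forall>n. \<exists>b. osc_le u n b \<and> (\<Sum>w\<in>words n. (b w)\<^sup>2) \<le> C * \<rho> ^ n"
    using assms unfolding osc_class_def by blast
  from choice[OF this] show ?thesis using that by blast
qed

lemma osc_class_add:
  assumes u: "u \<in> osc_class \<rho>" and v: "v \<in> osc_class \<rho>"
  shows "(\<lambda>x. u x + v x) \<in> osc_class \<rho>"
proof -
  obtain C b where "\<forall>n. osc_le u n (b n)" "\<forall>n. (\<Sum>w\<in>words n. (b n w)\<^sup>2) \<le> C * \<rho> ^ n"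
    by (rule osc_classE[OF u])
  note b = this[rule_format]
  obtain D d where "\<forall>n. osc_le v n (d n)" "\<forall>n. (\<Sum>w\<in>words n. (d n w)\<^sup>2) \<le> D * \<rho> ^ n"
    by (rule osc_classE[OF v])
  note d = this[rule_format]
  show ?thesis
  proof (rule osc_classI[of _ "\<lambda>n w. b n w + d n w" "2 * C + 2 * D"])
    fix n
    show "osc_le (\<lambda>x. u x + v x) n (\<lambda>w. b n w + d n w)"
      unfolding osc_le_def
    proof (intro ballI)
      fix w x y assume "w \<in> words n" "x \<in> K" "y \<in> K"
      from osc_leD[OF b(1) this] osc_leD[OF d(1) this]
      show "\<bar>u (word_map w x) + v (word_map w x) - (u (word_map w y) + v (word_map w y))\<bar> \<le> b n w + d n w"
        by linarith
    qed
    have "(\<Sum>w\<in>words n. (b n w + d n w)\<^sup>2) \<le> (\<Sum>w\<in>words n. 2 * (b n w)\<^sup>2 + 2 * (d n w)\<^sup>2)"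
    proof (rule sum_mono)
      fix w
      show "(b n w + d n w)\<^sup>2 \<le> 2 * (b n w)\<^sup>2 + 2 * (d n w)\<^sup>2"
        using sum_squares_bound[of "b n w" "d n w"] by (simp add: power2_sum)
    qed
    also have "\<dots> \<le> 2 * (C * \<rho> ^ n) + 2 * (D * \<rho> ^ n)"
      unfolding sum.distrib sum_distrib_left[symmetric] using b(2)[of n] d(2)[of n] by linarith
    finally show "(\<Sum>w\<in>words n. (b n w + d n w)\<^sup>2) \<le> (2 * C + 2 * D) * \<rho> ^ n"
      by (simp add: algebra_simps)
  qed
qed

lemma osc_class_scale:
  assumes u: "u \<in> osc_class \<rho>"
  shows "(\<lambda>x. t * u x) \<in> osc_class \<rho>"
proof -
  obtain C b where "\<forall>n. osc_le u n (b n)" "\<forall>n. (\<Sum>w\<in>words n. (b n w)\<^sup>2) \<le> C * \<rho> ^ n"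
    by (rule osc_classE[OF u])
  note b = this[rule_format]
  show ?thesis
  proof (rule osc_classI[of _ "\<lambda>n w. \<bar>t\<bar> * b n w" "t\<^sup>2 * C"])
    fix n
    show "osc_le (\<lambda>x. t * u x) n (\<lambda>w. \<bar>t\<bar> * b n w)"
      using b(1)[of n] by (auto simp: osc_le_def right_diff_distrib[symmetric] abs_mult intro!: mult_left_mono)
    show "(\<Sum>w\<in>words n. (\<bar>t\<bar> * b n w)\<^sup>2) \<le> t\<^sup>2 * C * \<rho> ^ n"
      using b(2)[of n] mult_left_mono[of _ _ "t\<^sup>2"]
      by (simp add: power_mult_distrib sum_distrib_left[symmetric] mult.assoc)
  qed
qed

lemma osc_class_const:
  assumes "\<rho> \<ge> 0"
  shows "(\<lambda>x. t) \<in> osc_class \<rho>"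
  by (rule osc_classI[of _ "\<lambda>n w. 0" 0]) (auto simp: osc_le_def)

lemma osc_class_cong:
  assumes "u \<in> osc_class \<rho>" "\<And>x. x \<in> K \<Longrightarrow> v x = u x"
  shows "v \<in> osc_class \<rho>"
proof -
  have "osc_le v n b \<longleftrightarrow> osc_le u n b" for n b
    unfolding osc_le_def using assms(2) word_map_in_K by (metis (no_types, lifting))
  then show ?thesis using assms(1) by (simp add: osc_class_def)
qed

lemma osc_class_bounded:
  assumes u: "u \<in> osc_class \<rho>"
  obtains B where "\<forall>x\<in>K. \<bar>u x\<bar> \<le> B"
proof -
  obtain C b where "\<forall>n. osc_le u n (b n)" "\<forall>n. (\<Sum>w\<in>words n. (b n w)\<^sup>2) \<le> C * \<rho> ^ n"
    by (rule osc_classE[OF u])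
  note b = this[rule_format]
  obtain x0 where x0: "x0 \<in> K" using K_nonempty by blast
  have "\<bar>u x\<bar> \<le> \<bar>u x0\<bar> + b 0 []" if "x \<in> K" for x
    using osc_leD[OF b(1), of "[]" 0 x x0] that x0 by simp
  then show ?thesis using that by blast
qed

text \<open>The oscillation sum of level \<open>n + 1\<close> is the sum of those of level \<open>n\<close> of the finitely many pieces. On
  level 0 the pieces bound the function itself.\<close>

lemma osc_class_pieces:
  assumes u: "\<And>i. i \<in> S \<Longrightarrow> (\<lambda>x. u (cell_map i x)) \<in> osc_class \<rho>" and rho: "\<rho> > 0"
  shows "u \<in> osc_class \<rho>"
proof -
  have "\<forall>i\<in>S. \<exists>Cb. (\<forall>n. osc_le (\<lambda>x. u (cell_map i x)) n (snd Cb n)) \<and>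
      (\<forall>n. (\<Sum>w\<in>words n. (snd Cb n w)\<^sup>2) \<le> fst Cb * \<rho> ^ n)"
  proof
    fix i assume "i \<in> S"
    obtain C b where "\<forall>n. osc_le (\<lambda>x. u (cell_map i x)) n (b n)" "\<forall>n. (\<Sum>w\<in>words n. (b n w)\<^sup>2) \<le> C * \<rho> ^ n"
      by (rule osc_classE[OF u[OF \<open>i \<in> S\<close>]])
    then show "\<exists>Cb. (\<forall>n. osc_le (\<lambda>x. u (cell_map i x)) n (snd Cb n)) \<and>
        (\<forall>n. (\<Sum>w\<in>words n. (snd Cb n w)\<^sup>2) \<le> fst Cb * \<rho> ^ n)"
      by (intro exI[of _ "(C, b)"]) simp
  qed
  from bchoice[OF this] obtain Cb where
    "\<forall>i\<in>S. (\<forall>n. osc_le (\<lambda>x. u (cell_map i x)) n (snd (Cb i) n)) \<and>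
      (\<forall>n. (\<Sum>w\<in>words n. (snd (Cb i) n w)\<^sup>2) \<le> fst (Cb i) * \<rho> ^ n)" ..
  then have Cb: "\<And>i n. i \<in> S \<Longrightarrow> osc_le (\<lambda>x. u (cell_map i x)) n (snd (Cb i) n)"
    "\<And>i n. i \<in> S \<Longrightarrow> (\<Sum>w\<in>words n. (snd (Cb i) n w)\<^sup>2) \<le> fst (Cb i) * \<rho> ^ n"
    by simp_all
  have "\<forall>i\<in>S. \<exists>B. \<forall>x\<in>K. \<bar>u (cell_map i x)\<bar> \<le> B"
  proof
    fix i assume "i \<in> S"
    obtain B where "\<forall>x\<in>K. \<bar>u (cell_map i x)\<bar> \<le> B" by (rule osc_class_bounded[OF u[OF \<open>i \<in> S\<close>]])
    then show "\<exists>B. \<forall>x\<in>K. \<bar>u (cell_map i x)\<bar> \<le> B" by blast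
  qed
  from bchoice[OF this] obtain B where "\<forall>i\<in>S. \<forall>x\<in>K. \<bar>u (cell_map i x)\<bar> \<le> B i" ..
  note B = this[rule_format]
  define M where "M = (\<Sum>i\<in>S. \<bar>B i\<bar>)"
  have M: "\<bar>u x\<bar> \<le> M" if "x \<in> K" for x
  proof -
    obtain i y where i: "i \<in> S" "y \<in> K" "x = cell_map i y" using in_cell[OF \<open>x \<in> K\<close>] .
    have "\<bar>B i\<bar> \<le> M" unfolding M_def using finite_S i(1) by (intro member_le_sum) auto
    then show ?thesis unfolding i(3) using B[OF i(1,2)] by linarith
  qed
  define C where "C = 4 * M\<^sup>2 + (\<Sum>i\<in>S. \<bar>fst (Cb i)\<bar>) / \<rho>"
  define b where "b n w = (if n = 0 then 2 * M else snd (Cb (hd w)) (n - 1) (tl w))" for n w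
  show ?thesis
  proof (rule osc_classI[of _ b C])
    fix n
    show "osc_le u n (b n)"
    proof (cases n)
      case 0
      have "\<bar>u x - u y\<bar> \<le> 2 * M" if "x \<in> K" "y \<in> K" for x y
        using M[OF that(1)] M[OF that(2)] by linarith
      then show ?thesis using 0 by (auto simp: osc_le_def b_def)
    next
      case (Suc m)
      then show ?thesis using Cb(1) by (auto simp: osc_le_def b_def words_Suc_Cons)
    qed
    show "(\<Sum>w\<in>words n. (b n w)\<^sup>2) \<le> C * \<rho> ^ n"
    proof (cases n)
      case 0
      have "0 \<le> (\<Sum>i\<in>S. \<bar>fst (Cb i)\<bar>) / \<rho>" using rho by (intro divide_nonneg_pos sum_nonneg) auto
      then show ?thesis using 0 by (simp add: b_def C_def power_mult_distrib)
    next
      case (Suc m)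
      have "(\<Sum>w\<in>words n. (b n w)\<^sup>2) = (\<Sum>i\<in>S. \<Sum>w\<in>words m. (snd (Cb i) m w)\<^sup>2)"
        unfolding Suc sum_words_Cons by (simp add: b_def)
      also have "\<dots> \<le> (\<Sum>i\<in>S. \<bar>fst (Cb i)\<bar> * \<rho> ^ m)"
      proof (rule sum_mono)
        fix i assume "i \<in> S"
        have "fst (Cb i) * \<rho> ^ m \<le> \<bar>fst (Cb i)\<bar> * \<rho> ^ m" using rho by (intro mult_right_mono) auto
        then show "(\<Sum>w\<in>words m. (snd (Cb i) m w)\<^sup>2) \<le> \<bar>fst (Cb i)\<bar> * \<rho> ^ m"
          using Cb(2)[OF \<open>i \<in> S\<close>, of m] by linarith
      qed
      also have "\<dots> = (\<Sum>i\<in>S. \<bar>fst (Cb i)\<bar>) / \<rho> * \<rho> ^ n"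
        using rho Suc by (simp flip: sum_distrib_right)
      also have "\<dots> \<le> C * \<rho> ^ n"
        unfolding C_def using rho by (intro mult_right_mono) auto
      finally show ?thesis .
    qed
  qed
qed

text \<open>The oscillations on single cells tend to zero uniformly, and points that are close compared with the
  cell size lie in cells with a common vertex.\<close>

lemma osc_class_continuous:
  assumes u: "u \<in> osc_class \<rho>" and rho: "0 \<le> \<rho>" "\<rho> < 1"
  shows "continuous_on K u"
proof -
  obtain C b where "\<forall>n. osc_le u n (b n)" "\<forall>n. (\<Sum>w\<in>words n. (b n w)\<^sup>2) \<le> C * \<rho> ^ n"
    by (rule osc_classE[OF u])
  note b = this[rule_format]
  show ?thesis
    unfolding continuous_on_iff
  proof (intro ballI allI impI)
    fix x e assume x: "x \<in> K" and e: "(0::real) < e"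
    have "(\<lambda>n. C * \<rho> ^ n) \<longlonglongrightarrow> C * 0"
      using rho by (intro tendsto_mult tendsto_const LIMSEQ_realpow_zero)
    then have "\<forall>\<^sub>F n in sequentially. C * \<rho> ^ n < (e / 2)\<^sup>2"
      using e by (intro order_tendstoD) auto
    then obtain n where n: "C * \<rho> ^ n < (e / 2)\<^sup>2" by (auto simp: eventually_sequentially)
    have small: "b n w < e / 2" if "w \<in> words n" for w
    proof -
      have "(b n w)\<^sup>2 \<le> (\<Sum>w\<in>words n. (b n w)\<^sup>2)" using that by (intro member_le_sum) auto
      then have "(b n w)\<^sup>2 < (e / 2)\<^sup>2" using b(2)[of n] n by linarith
      then show ?thesis using e by (intro power2_less_imp_less[of _ "e / 2"]) auto
    qed
    show "\<exists>d>0. \<forall>y\<in>K. dist y x < d \<longrightarrow> dist (u y) (u x) < e"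
    proof (intro exI[of _ "1 / (7 * 7 ^ n)"] conjI ballI impI)
      fix y assume y: "y \<in> K" and d: "dist y x < 1 / (7 * 7 ^ n)"
      obtain v x' where v: "v \<in> words n" "x' \<in> K" "x = word_map v x'" using in_word_cell[OF x] .
      obtain w y' where w: "w \<in> words n" "y' \<in> K" "y = word_map w y'" using in_word_cell[OF y] .
      obtain a c where ac: "a \<in> corners" "c \<in> corners" "word_map w (lattice_pt a) = word_map v (lattice_pt c)"
        by (rule words_touch[OF w(1) v(1) w(2) v(2) d[unfolded v(3) w(3)]])
      have "\<bar>u y - u (word_map w (lattice_pt a))\<bar> \<le> b n w"
        unfolding w(3) by (rule osc_leD[OF b(1) w(1,2) corner_in_K[OF ac(1)]])
      moreover have "\<bar>u (word_map v (lattice_pt c)) - u x\<bar> \<le> b n v"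
        unfolding v(3) by (rule osc_leD[OF b(1) v(1) corner_in_K[OF ac(2)] v(2)])
      ultimately show "dist (u y) (u x) < e"
        using small[OF v(1)] small[OF w(1)] ac(3) by (auto simp: dist_real_def)
    qed simp
  qed
qed

end

text \<open>The scale \<open>r\<close> is compared with the cells of level \<open>m\<close>, whose size exceeds \<open>7 * r\<close>; for \<open>r \<ge> 1/7\<close> the
  whole attractor is the only cell available.\<close>

lemma scale_level:
  assumes "0 < r" "r < (1::real)"
  obtains m where "1 / 7 ^ (m + 2) \<le> r" "m = 0 \<or> r < 1 / (7 * 7 ^ m)"
proof (cases "r < 1 / 7")
  case True
  obtain l where "(1/7) ^ l < r" using real_arch_pow_inv[of r "1/7"] assms by auto
  then have ex: "\<exists>l. 1 / 7 ^ l \<le> r" by (auto simp: power_one_over intro: less_imp_le)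
  define l where "l = (LEAST l. 1 / 7 ^ l \<le> r)"
  have l: "1 / 7 ^ l \<le> r" "\<And>k. k < l \<Longrightarrow> \<not> 1 / 7 ^ k \<le> r"
    unfolding l_def using LeastI_ex[OF ex] not_less_Least by blast+
  have "l \<noteq> 0" "l \<noteq> 1" using l(1) True assms by (auto intro: ccontr)
  then obtain m where m: "l = m + 2" by (metis One_nat_def add_2_eq_Suc' nat.exhaust)
  show ?thesis
    using that[of m] l(1) l(2)[of "Suc m"] unfolding m by simp
next
  case False
  then show ?thesis using that[of 0] by simp
qed

context ifs17
begin

lemma osc_class_L2:
  assumes "u \<in> osc_class \<rho>" "0 \<le> \<rho>" "\<rho> < 1"
  shows "u \<in> L2_space mu"
proof -
  have [measurable]: "u \<in> borel_measurable mu"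
    using borel_measurable_continuous_on_restrict[OF osc_class_continuous[OF assms]]
    by (simp add: measurable_cong_sets[OF sets_mu])
  obtain B where B: "\<forall>x\<in>K. \<bar>u x\<bar> \<le> B" using assms(1) by (rule osc_class_bounded)
  have "integrable mu (\<lambda>x. (u x)\<^sup>2)"
  proof (rule mu.integrable_const_bound[of _ "B\<^sup>2"])
    have "(u x)\<^sup>2 \<le> B\<^sup>2" if "x \<in> K" for x using power_mono[OF B[rule_format, OF that], of 2] by simp
    then show "AE x in mu. norm ((u x)\<^sup>2) \<le> B\<^sup>2" by (intro AE_I2) simp
  qed measurable
  then show ?thesis by (simp add: L2_space_def)
qed

text \<open>At distance less than \<open>r\<close> two points lie in close cells \<open>v\<close>, \<open>w\<close> with a common vertex, so their values
  differ by at most \<open>b v + b w\<close>. Each cell is close to at most 49 others, and a pair of cells has measure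
  \<open>17 ^ (- 2 * m)\<close>.\<close>

lemma osc_class_double_integral:
  assumes b: "osc_le u m b" and r: "m = 0 \<or> r < 1 / (7 * 7 ^ m)"
  shows "(\<integral>\<^sup>+x. (\<integral>\<^sup>+y\<in>ball x r. ennreal (\<bar>u x - u y\<bar>\<^sup>2) \<partial>mu) \<partial>mu)
    \<le> ennreal (196 * (\<Sum>w\<in>words m. (b w)\<^sup>2) / (17 ^ m * 17 ^ m))"
proof -
  let ?N = "\<lambda>v. {w \<in> words m. close_words w v}"
  define a where "a v w = 2 * ((b v)\<^sup>2 + (b w)\<^sup>2)" for v w
  have a0: "0 \<le> a v w" for v w by (simp add: a_def)
  have pointwise: "ennreal (\<bar>u x - u y\<bar>\<^sup>2) * indicator (ball x r) y \<le>
      (\<Sum>v\<in>words m. \<Sum>w\<in>?N v. ennreal (a v w) * indicator (piece v) x * indicator (piece w) y)"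
    if x: "x \<in> K" and y: "y \<in> K" for x y
  proof (cases "y \<in> ball x r")
    case True
    then have d: "dist x y < r" by simp
    obtain v x' where v: "v \<in> words m" "x' \<in> K" "x = word_map v x'" using in_word_cell[OF x] .
    obtain w y' where w: "w \<in> words m" "y' \<in> K" "y = word_map w y'" using in_word_cell[OF y] .
    have "close_words w v \<and> (\<exists>c\<in>corners. \<exists>e\<in>corners. word_map v (lattice_pt c) = word_map w (lattice_pt e))"
    proof (cases "m = 0")
      case True
      then have "v = []" "w = []" using v w by auto
      then show ?thesis by (auto simp: close_words_def corners_def)
    next
      case False
      with r d have "dist x y < 1 / (7 * 7 ^ m)" by linarith
      moreover have "1 / (7 * 7 ^ m) \<le> (1::real) / 7 ^ m" by (simp add: field_simps)
      ultimately show ?thesis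
        using words_touch[OF v(1) w(1) v(2) w(2)] words_close[OF w(1) v(1) w(2) v(2)] v(3) w(3)
        by (metis dist_commute less_imp_le less_le_trans)
    qed
    then obtain c e where ce: "close_words w v" "c \<in> corners" "e \<in> corners"
      "word_map v (lattice_pt c) = word_map w (lattice_pt e)" by blast
    have "\<bar>u x - u (word_map v (lattice_pt c))\<bar> \<le> b v"
      unfolding v(3) by (rule osc_leD[OF b v(1,2) corner_in_K[OF ce(2)]])
    moreover have "\<bar>u (word_map w (lattice_pt e)) - u y\<bar> \<le> b w"
      unfolding w(3) by (rule osc_leD[OF b w(1) corner_in_K[OF ce(3)] w(2)])
    ultimately have "\<bar>u x - u y\<bar> \<le> b v + b w" unfolding ce(4) by linarith
    then have "\<bar>u x - u y\<bar>\<^sup>2 \<le> (b v + b w)\<^sup>2" by (intro power_mono) auto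
    also have "\<dots> \<le> a v w" using sum_squares_bound[of "b v" "b w"] by (simp add: a_def power2_sum)
    finally have "ennreal (\<bar>u x - u y\<bar>\<^sup>2) \<le>
        ennreal (a v w) * indicator (piece v) x * indicator (piece w) y"
      using v w by (simp add: ennreal_leI)
    also have "\<dots> \<le> (\<Sum>w\<in>?N v. ennreal (a v w) * indicator (piece v) x * indicator (piece w) y)"
      using w ce(1) by (intro member_le_sum[of w "?N v"
          "\<lambda>w. ennreal (a v w) * indicator (piece v) x * indicator (piece w) y"]) auto
    also have "\<dots> \<le> (\<Sum>v\<in>words m. \<Sum>w\<in>?N v.
        ennreal (a v w) * indicator (piece v) x * indicator (piece w) y)"
      using v by (intro member_le_sum[of v "words m"
          "\<lambda>v. \<Sum>w\<in>?N v. ennreal (a v w) * indicator (piece v) x * indicator (piece w) y"]) auto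
    finally show ?thesis using True by simp
  qed simp
  have [measurable]: "piece w \<in> sets mu" if "w \<in> words m" for w
    using that by (rule word_cell_sets)
  have inner: "(\<integral>\<^sup>+y\<in>ball x r. ennreal (\<bar>u x - u y\<bar>\<^sup>2) \<partial>mu) \<le>
      (\<Sum>v\<in>words m. (\<Sum>w\<in>?N v. ennreal (a v w) * ennreal (1 / 17 ^ m)) * indicator (piece v) x)"
    if x: "x \<in> K" for x
  proof -
    have "(\<integral>\<^sup>+y\<in>ball x r. ennreal (\<bar>u x - u y\<bar>\<^sup>2) \<partial>mu) \<le>
      (\<integral>\<^sup>+y. (\<Sum>v\<in>words m. \<Sum>w\<in>?N v. ennreal (a v w) * indicator (piece v) x * indicator (piece w) y) \<partial>mu)"
      using x pointwise by (intro nn_integral_mono) auto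
    also have "\<dots> = (\<Sum>v\<in>words m. \<Sum>w\<in>?N v.
        (\<integral>\<^sup>+y. ennreal (a v w) * indicator (piece v) x * indicator (piece w) y \<partial>mu))"
    proof (subst nn_integral_sum)
      show "(\<lambda>y. \<Sum>w\<in>?N v. ennreal (a v w) * indicator (piece v) x * indicator (piece w) y)
          \<in> borel_measurable mu" if "v \<in> words m" for v
        by (rule borel_measurable_sum) simp
    qed (intro sum.cong refl nn_integral_sum, simp)
    also have "\<dots> = (\<Sum>v\<in>words m. \<Sum>w\<in>?N v. ennreal (a v w) * indicator (piece v) x * ennreal (1 / 17 ^ m))"
      by (intro sum.cong refl) (auto simp: nn_integral_cmult_indicator emeasure_word_cell)
    finally show ?thesis by (simp add: sum_distrib_left sum_distrib_right mult_ac)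
  qed
  have "(\<integral>\<^sup>+x. (\<integral>\<^sup>+y\<in>ball x r. ennreal (\<bar>u x - u y\<bar>\<^sup>2) \<partial>mu) \<partial>mu) \<le>
      (\<integral>\<^sup>+x. (\<Sum>v\<in>words m. (\<Sum>w\<in>?N v. ennreal (a v w) * ennreal (1 / 17 ^ m)) * indicator (piece v) x) \<partial>mu)"
    using inner by (intro nn_integral_mono) auto
  also have "\<dots> = (\<Sum>v\<in>words m. (\<integral>\<^sup>+x. (\<Sum>w\<in>?N v. ennreal (a v w) * ennreal (1 / 17 ^ m)) * indicator (piece v) x \<partial>mu))"
    by (rule nn_integral_sum) auto
  also have "\<dots> = (\<Sum>v\<in>words m. (\<Sum>w\<in>?N v. ennreal (a v w) * ennreal (1 / 17 ^ m)) * ennreal (1 / 17 ^ m))"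
    by (intro sum.cong refl) (simp add: nn_integral_cmult_indicator emeasure_word_cell)
  also have "\<dots> = ennreal ((\<Sum>v\<in>words m. \<Sum>w\<in>?N v. a v w) / (17 ^ m * 17 ^ m))"
    using a0 by (simp add: ennreal_mult[symmetric] sum_ennreal sum_nonneg sum_divide_distrib)
  \<comment> \<open>Each \<open>(b w)\<^sup>2\<close> occurs with the factor 2 in at most 49 pairs for either position of \<open>w\<close>, and \<open>196 = 2 * 2 * 49\<close>.\<close>
  also have "\<dots> \<le> ennreal (196 * (\<Sum>w\<in>words m. (b w)\<^sup>2) / (17 ^ m * 17 ^ m))"
  proof (intro ennreal_leI divide_right_mono)
    have card: "(\<Sum>w\<in>?N v. (b v)\<^sup>2) \<le> 49 * (b v)\<^sup>2" for v
      using card_close_words[of m v] by (simp add: mult_right_mono)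
    have "(\<Sum>v\<in>words m. \<Sum>w\<in>?N v. a v w) =
        2 * (\<Sum>v\<in>words m. \<Sum>w\<in>?N v. (b v)\<^sup>2) + 2 * (\<Sum>v\<in>words m. \<Sum>w\<in>?N v. (b w)\<^sup>2)"
      by (simp add: a_def sum.distrib sum_distrib_left distrib_left mult.left_commute)
    also have "(\<Sum>v\<in>words m. \<Sum>w\<in>?N v. (b w)\<^sup>2) = (\<Sum>v\<in>words m. \<Sum>w\<in>?N v. (b v)\<^sup>2)"
      by (subst sum.swap_restrict) (auto simp: close_words_sym intro!: sum.cong)
    finally show "(\<Sum>v\<in>words m. \<Sum>w\<in>?N v. a v w) \<le> 196 * (\<Sum>w\<in>words m. (b w)\<^sup>2)"
      using sum_mono[of "words m" "\<lambda>v. \<Sum>w\<in>?N v. (b v)\<^sup>2" "\<lambda>v. 49 * (b v)\<^sup>2"] card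
      by (simp add: sum_distrib_left[symmetric])
  qed simp
  finally show ?thesis .
qed

text \<open>For \<open>r\<close> comparable with \<open>7 ^ (- m)\<close> the factor \<open>r powr (- \<alpha> - 2 * \<sigma>)\<close> grows like the \<open>m\<close>-th power of
  \<open>7 powr (\<alpha> + 2 * \<sigma>)\<close>, whereas the double integral decays like \<open>(\<rho> / 289) ^ m\<close>.\<close>

lemma osc_class_besov:
  assumes u: "u \<in> osc_class \<rho>" and rho: "0 \<le> \<rho>" "\<rho> < 1" and s: "\<sigma> > 0"
    and crit: "7 powr (\<alpha> + 2 * \<sigma>) * \<rho> \<le> 289"
  shows "u \<in> besov_space \<alpha> K \<sigma>"
proof -
  obtain C b where "\<forall>n. osc_le u n (b n)" "\<forall>n. (\<Sum>w\<in>words n. (b n w)\<^sup>2) \<le> C * \<rho> ^ n"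
    by (rule osc_classE[OF u])
  note b = this[rule_format]
  have C0: "0 \<le> C" using b(2)[of 0] by (simp add: order_trans[OF zero_le_power2])
  define q where "q = 7 powr (\<alpha> + 2 * \<sigma>)"
  have q0: "q > 0" by (simp add: q_def)
  have "besov_seminorm_sq \<alpha> mu \<sigma> u \<le> ennreal (196 * C * q\<^sup>2)"
    unfolding besov_seminorm_sq_def
  proof (rule SUP_least)
    fix r :: real assume "r \<in> {0<..<1}"
    then have r: "0 < r" "r < 1" by auto
    obtain m where m: "1 / 7 ^ (m + 2) \<le> r" "m = 0 \<or> r < 1 / (7 * 7 ^ m)" using scale_level[OF r] .
    have "r powr (- \<alpha> - 2 * \<sigma>) \<le> (1 / 7 ^ (m + 2)) powr (- \<alpha> - 2 * \<sigma>)"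
      using m(1) alpha_pos s by (intro powr_mono2') auto
    also have "\<dots> = q ^ (m + 2)"
    proof -
      have "(1 / 7 ^ (m + 2)) = (7::real) powr (- real (m + 2))"
        by (simp only: powr_minus powr_realpow inverse_eq_divide zero_less_numeral)
      then have "(1 / 7 ^ (m + 2)) powr (- \<alpha> - 2 * \<sigma>) = 7 powr (real (m + 2) * (\<alpha> + 2 * \<sigma>))"
        by (simp add: powr_powr algebra_simps)
      also have "\<dots> = q ^ (m + 2)"
        unfolding q_def by (subst powr_realpow[symmetric]) (simp_all add: powr_powr mult.commute)
      finally show ?thesis .
    qed
    finally have 1: "r powr (- \<alpha> - 2 * \<sigma>) \<le> q ^ (m + 2)" .
    have "ennreal (r powr (- \<alpha> - 2 * \<sigma>)) * (\<integral>\<^sup>+x. (\<integral>\<^sup>+y\<in>ball x r. ennreal (\<bar>u x - u y\<bar>\<^sup>2) \<partial>mu) \<partial>mu)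
        \<le> ennreal (q ^ (m + 2)) * ennreal (196 * (C * \<rho> ^ m) / (17 ^ m * 17 ^ m))"
      using b(2)[of m] 1
      by (intro mult_mono ennreal_leI order_trans[OF osc_class_double_integral[OF b(1) m(2)]] divide_right_mono) (auto intro: sum_nonneg)
    also have "\<dots> = ennreal (196 * C * q\<^sup>2 * (q * \<rho> / 289) ^ m)"
    proof -
      have "(17::real) ^ m * 17 ^ m = 289 ^ m" by (simp flip: power_mult_distrib)
      then show ?thesis using q0 C0 rho
        by (simp add: ennreal_mult[symmetric] power_mult_distrib power_divide power_add power2_eq_square mult_ac)
    qed
    also have "\<dots> \<le> ennreal (196 * C * q\<^sup>2)"
      using C0 q0 rho crit unfolding q_def[symmetric]
      by (intro ennreal_leI mult_right_le_one_le power_le_one) auto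
    finally show "ennreal (r powr (- \<alpha> - 2 * \<sigma>)) * (\<integral>\<^sup>+x. (\<integral>\<^sup>+y\<in>ball x r. ennreal (\<bar>u x - u y\<bar>\<^sup>2) \<partial>mu) \<partial>mu)
        \<le> ennreal (196 * C * q\<^sup>2)" .
  qed
  then have "besov_seminorm_sq \<alpha> mu \<sigma> u < \<infinity>"
    by (rule le_less_trans) simp
  then show ?thesis using osc_class_L2[OF u rho] by (simp add: besov_space_def)
qed

end

section \<open>Gluing functions along common vertices\<close>

context triangular_ifs
begin

text \<open>A choice of a cell containing \<open>x\<close>, and the preimage of \<open>x\<close> under its map; \<open>shift\<close> acts on addresses by
  deleting the first letter.\<close>

definition cell_of :: "plane \<Rightarrow> nat \<times> nat" where
  "cell_of x = (SOME i. i \<in> S \<and> x \<in> cell_map i ` K)"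

definition shift :: "plane \<Rightarrow> plane" where
  "shift x = (SOME y. y \<in> K \<and> x = cell_map (cell_of x) y)"

text \<open>Here \<open>v i a\<close> is the value prescribed at the vertex \<open>a\<close> of the cell \<open>i\<close>.\<close>

definition compatible :: "(nat \<times> nat \<Rightarrow> nat \<times> nat \<Rightarrow> real) \<Rightarrow> bool" where
  "compatible v \<longleftrightarrow> (\<forall>i\<in>S. \<forall>j\<in>S. \<forall>a\<in>corners. \<forall>b\<in>corners. i \<noteq> j \<longrightarrow> a + i = b + j \<longrightarrow> v i a = v j b)"

lemma cell_of:
  assumes "x \<in> K"
  shows "cell_of x \<in> S" "shift x \<in> K" "cell_map (cell_of x) (shift x) = x"
proof -
  have "\<exists>i. i \<in> S \<and> x \<in> cell_map i ` K" using in_cell[OF assms] by blast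
  from someI_ex[OF this] have 1: "cell_of x \<in> S \<and> x \<in> cell_map (cell_of x) ` K"
    by (simp add: cell_of_def)
  then have "\<exists>y. y \<in> K \<and> x = cell_map (cell_of x) y" by blast
  from someI_ex[OF this] have "shift x \<in> K \<and> x = cell_map (cell_of x) (shift x)"
    by (simp add: shift_def)
  with 1 show "cell_of x \<in> S" "shift x \<in> K" "cell_map (cell_of x) (shift x) = x" by auto
qed

text \<open>The choice of a cell containing \<open>F\<^sub>i x\<close> can only differ from \<open>i\<close> at a common vertex.\<close>

lemma glue_eq:
  assumes v: "compatible (\<lambda>i a. v i (lattice_pt a))" and i: "i \<in> S" and x: "x \<in> K"
  shows "v (cell_of (cell_map i x)) (shift (cell_map i x)) = v i x"
proof -
  let ?j = "cell_of (cell_map i x)" and ?y = "shift (cell_map i x)"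
  note j = cell_of[OF cell_map_in_K[OF i x]]
  show ?thesis
  proof (cases "?j = i")
    case True
    then have "?y = x" using j(3) cell_map_inj by metis
    then show ?thesis using True by simp
  next
    case False
    obtain a b where "a \<in> corners" "b \<in> corners" "?y = lattice_pt a" "x = lattice_pt b" "a + ?j = b + i"
      by (rule cells_meet[OF False j(2) x j(3)])
    then show ?thesis using v False i j(1) unfolding compatible_def by metis
  qed
qed

lemma glue:
  assumes "compatible (\<lambda>i a. v i (lattice_pt a))"
  obtains u where "\<forall>i\<in>S. \<forall>x\<in>K. u (cell_map i x) = v i x"
  using glue_eq[OF assms] that[of "\<lambda>x. v (cell_of x) (shift x)"] by blast

lemma corner_cell_unique:
  assumes a: "a \<in> corners" and b: "b \<in> corners" and i: "i \<in> S" and eq: "b + i = a + corner_cell a" and "a \<noteq> (0,0)"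
  shows "i = corner_cell a"
  using assms S_le[OF i] by (auto simp: corners_def corner_cell_def prod_eq_iff)

text \<open>Lattice positions of cells have coordinate sum at most 6, which leaves only one cell with a given corner of
  the big triangle as a vertex.\<close>

lemma cell_of_corner:
  assumes a: "a \<in> corners"
  shows "cell_of (lattice_pt a) = corner_cell a" "shift (lattice_pt a) = lattice_pt a"
proof -
  note c = cell_of[OF corner_in_K[OF a]]
  show 1: "cell_of (lattice_pt a) = corner_cell a"
  proof (rule ccontr)
    assume neq: "\<not> ?thesis"
    have eq: "cell_map (cell_of (lattice_pt a)) (shift (lattice_pt a)) = cell_map (corner_cell a) (lattice_pt a)"
      by (simp add: c(3) cell_map_corner)
    obtain b e where be: "b \<in> corners" "e \<in> corners" "lattice_pt a = lattice_pt e"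
        "b + cell_of (lattice_pt a) = e + corner_cell a"
      by (rule cells_meet[OF neq c(2) corner_in_K[OF a] eq])
    have "e = a" using arg_cong[OF be(3), of coordX] arg_cong[OF be(3), of coordY] by (simp add: prod_eq_iff)
    then show False
      using neq corner_cell_unique[OF a be(1) c(1)] be(4) by (auto simp: corner_cell_def prod_eq_iff)
  qed
  then show "shift (lattice_pt a) = lattice_pt a"
    using c(3) cell_map_corner[of a] cell_map_inj by metis
qed

lemma corners_fixed:
  assumes u: "\<forall>i\<in>S. \<forall>x\<in>K. u (cell_map i x) = v i x" and a: "a \<in> corners"
  shows "u (lattice_pt a) = v (corner_cell a) (lattice_pt a)"
  using u[rule_format, OF corner_cell_in_S[OF a] corner_in_K[OF a]] by (simp add: cell_map_corner)

text \<open>Iterating the equation along the orbit of \<open>x\<close> under \<open>shift\<close> gives the solution as a series dominated by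
  a geometric one.\<close>

lemma shift_equation:
  fixes A :: "plane \<Rightarrow> real"
  assumes q: "0 \<le> q" "q < 1" and d: "\<And>i. i \<in> S \<Longrightarrow> \<bar>d i\<bar> \<le> q" and A: "\<And>x. x \<in> K \<Longrightarrow> \<bar>A x\<bar> \<le> M"
  obtains h B where "\<forall>x\<in>K. h x = A x + d (cell_of x) * h (shift x)" "\<forall>x\<in>K. \<bar>h x\<bar> \<le> B"
proof -
  define t where "t n x = (\<Prod>k<n. d (cell_of ((shift ^^ k) x))) * A ((shift ^^ n) x)" for n x
  have orbit: "(shift ^^ n) x \<in> K" if "x \<in> K" for n x
    by (induction n) (use that cell_of in auto)
  obtain x0 where "x0 \<in> K" using K_nonempty by blast
  then have M: "0 \<le> M" using A[of x0] by (simp add: order_trans[OF abs_ge_zero])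
  have bound: "\<bar>t n x\<bar> \<le> M * q ^ n" if "x \<in> K" for n x
  proof -
    have "(\<Prod>k<n. \<bar>d (cell_of ((shift ^^ k) x))\<bar>) \<le> (\<Prod>k<n. q)"
      using d cell_of(1)[OF orbit[OF that]] by (intro prod_mono) auto
    then show ?thesis
      using A[OF orbit[OF that]] M q unfolding t_def abs_mult abs_prod
      by (subst mult.commute) (auto intro!: mult_mono prod_nonneg)
  qed
  have geo: "summable (\<lambda>n. M * q ^ n)" using q by (intro summable_mult summable_geometric) auto
  have summ: "summable (\<lambda>n. t n x)" if "x \<in> K" for x
    by (rule summable_comparison_test'[OF geo]) (simp add: bound[OF that])
  define h where "h x = (\<Sum>n. t n x)" for x
  have "h x = A x + d (cell_of x) * h (shift x)" if "x \<in> K" for x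
  proof -
    have "h x = t 0 x + (\<Sum>n. t (Suc n) x)"
      unfolding h_def using suminf_split_head[OF summ[OF that]] by simp
    also have "(\<lambda>n. t (Suc n) x) = (\<lambda>n. d (cell_of x) * t n (shift x))"
      unfolding t_def by (simp add: prod.lessThan_Suc_shift funpow_swap1 mult.assoc del: prod.lessThan_Suc)
    also have "(\<Sum>n. d (cell_of x) * t n (shift x)) = d (cell_of x) * h (shift x)"
      unfolding h_def using summ[OF cell_of(2)[OF that]] by (rule suminf_mult)
    finally show ?thesis by (simp add: t_def)
  qed
  moreover have "\<bar>h x\<bar> \<le> (\<Sum>n. M * q ^ n)" if "x \<in> K" for x
  proof -
    have abs_summ: "summable (\<lambda>n. \<bar>t n x\<bar>)"
      by (rule summable_comparison_test'[OF geo]) (simp add: bound[OF that])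
    have "\<bar>h x\<bar> \<le> (\<Sum>n. \<bar>t n x\<bar>)" unfolding h_def by (rule summable_rabs[OF abs_summ])
    also have "\<dots> \<le> (\<Sum>n. M * q ^ n)" by (rule suminf_le[OF bound[OF that] abs_summ geo])
    finally show ?thesis .
  qed
  ultimately show ?thesis using that by blast
qed

text \<open>The corner values are forced by the equation for the three corner cells, and compatibility only involves
  them.\<close>

lemma self_similar_function:
  fixes A :: "nat \<times> nat \<Rightarrow> plane \<Rightarrow> real"
  assumes q: "0 \<le> q" "q < 1" and d: "\<And>i. i \<in> S \<Longrightarrow> \<bar>d i\<bar> \<le> q"
    and A: "\<And>i x. i \<in> S \<Longrightarrow> x \<in> K \<Longrightarrow> \<bar>A i x\<bar> \<le> M"
    and corner: "\<And>a. a \<in> corners \<Longrightarrow>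
        p a = A (corner_cell a) (lattice_pt a) + d (corner_cell a) * p a"
    and comp: "compatible (\<lambda>i a. A i (lattice_pt a) + d i * p a)"
  obtains h B where "\<forall>i\<in>S. \<forall>x\<in>K. h (cell_map i x) = A i x + d i * h x"
    "\<forall>a\<in>corners. h (lattice_pt a) = p a" "\<forall>x\<in>K. \<bar>h x\<bar> \<le> B"
proof -
  obtain h B where h: "\<forall>x\<in>K. h x = A (cell_of x) (shift x) + d (cell_of x) * h (shift x)"
      and B: "\<forall>x\<in>K. \<bar>h x\<bar> \<le> B"
    by (rule shift_equation[OF q d, where A = "\<lambda>x. A (cell_of x) (shift x)" and M = M]) (auto intro: A cell_of)
  have hp: "h (lattice_pt a) = p a" if a: "a \<in> corners" for a
  proof -
    have "h (lattice_pt a) = A (corner_cell a) (lattice_pt a) + d (corner_cell a) * h (lattice_pt a)"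
      using h[rule_format, OF corner_in_K[OF a]] by (simp add: cell_of_corner[OF a])
    then have "(1 - d (corner_cell a)) * (h (lattice_pt a) - p a) = 0"
      using corner[OF a] by (simp add: algebra_simps)
    moreover have "d (corner_cell a) < 1"
      using d[OF corner_cell_in_S[OF a]] q by linarith
    ultimately show ?thesis by simp
  qed
  have "compatible (\<lambda>i a. A i (lattice_pt a) + d i * h (lattice_pt a))"
  proof -
    have "compatible (\<lambda>i a. A i (lattice_pt a) + d i * h (lattice_pt a)) \<longleftrightarrow>
        compatible (\<lambda>i a. A i (lattice_pt a) + d i * p a)"
      unfolding compatible_def by (intro ball_cong refl) (simp add: hp)
    then show ?thesis using comp by (rule iffD2)
  qed
  from glue_eq[where v = "\<lambda>i x. A i x + d i * h x", OF this]
  have "h (cell_map i x) = A i x + d i * h x" if "i \<in> S" "x \<in> K" for i x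
    using h[rule_format, OF cell_map_in_K[OF that]] that by simp
  then show ?thesis using hp B by (intro that[of h B] ballI) simp_all
qed

text \<open>Minkowski's inequality shows that the root of the oscillation sum is multiplied in each step by at most
  the root \<open>t\<close> of the sum of the \<open>(d i)\<^sup>2\<close>, up to a perturbation that decays like \<open>s ^ n\<close> with \<open>s < t\<close> and
  can therefore be absorbed.\<close>

lemma self_similar_osc_class:
  assumes h: "\<forall>i\<in>S. \<forall>x\<in>K. h (cell_map i x) = a i + k i * g x + d i * h x"
    and B: "\<forall>x\<in>K. \<bar>h x\<bar> \<le> B"
    and g: "g \<in> osc_class \<rho>'" and rho': "0 \<le> \<rho>'" "\<rho>' < \<rho>" and rho: "(\<Sum>i\<in>S. (d i)\<^sup>2) = \<rho>"
  shows "h \<in> osc_class \<rho>"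
proof -
  obtain C bg where "\<forall>n. osc_le g n (bg n)" "\<forall>n. (\<Sum>w\<in>words n. (bg n w)\<^sup>2) \<le> C * \<rho>' ^ n"
    by (rule osc_classE[OF g])
  note bg = this[rule_format]
  define bh where "bh = rec_nat (\<lambda>w. 2 * B) (\<lambda>n b w. \<bar>d (hd w)\<bar> * b (tl w) + \<bar>k (hd w)\<bar> * bg n (tl w))"
  have bh_0: "bh 0 w = 2 * B" and
    bh_Suc: "bh (Suc n) w = \<bar>d (hd w)\<bar> * bh n (tl w) + \<bar>k (hd w)\<bar> * bg n (tl w)" for n w
    by (simp_all add: bh_def)
  have osc: "osc_le h n (bh n)" for n
  proof (induction n)
    case 0
    have "\<bar>h x - h y\<bar> \<le> 2 * B" if "x \<in> K" "y \<in> K" for x y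
      using B[rule_format, OF that(1)] B[rule_format, OF that(2)] by linarith
    then show ?case by (simp add: osc_le_def bh_0)
  next
    case (Suc n)
    have "\<bar>h (word_map (i # w) x) - h (word_map (i # w) y)\<bar> \<le> bh (Suc n) (i # w)"
      if "i \<in> S" "w \<in> words n" "x \<in> K" "y \<in> K" for i w x y
    proof -
      have "h (word_map (i # w) x) - h (word_map (i # w) y) =
          d i * (h (word_map w x) - h (word_map w y)) + k i * (g (word_map w x) - g (word_map w y))"
        using h that word_map_in_K[OF that(2)] by (simp add: algebra_simps)
      also have "\<bar>\<dots>\<bar> \<le> \<bar>d i\<bar> * bh n w + \<bar>k i\<bar> * bg n w"
        using osc_leD[OF Suc that(2-4)] osc_leD[OF bg(1) that(2-4)]
        by (intro order_trans[OF abs_triangle_ineq]) (auto simp: abs_mult intro!: add_mono mult_left_mono)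
      finally show ?thesis by (simp add: bh_Suc)
    qed
    then show ?case by (auto simp: osc_le_def words_Suc_Cons)
  qed
  define E where "E n = L2_set (bh n) (words n)" for n
  define t where "t = sqrt \<rho>"
  define s where "s = sqrt \<rho>'"
  define c where "c = L2_set k S * sqrt C"
  have C0: "0 \<le> C" using bg(2)[of 0] by (simp add: order_trans[OF zero_le_power2])
  have st: "0 \<le> s" "s < t" using rho' by (simp_all add: s_def t_def)
  have prod: "L2_set (\<lambda>w. \<bar>e (hd w)\<bar> * b (tl w)) (words (Suc n)) = L2_set e S * L2_set b (words n)" for e b n
    unfolding L2_set_def sum_words_Cons
    by (simp add: power_mult_distrib sum_distrib_left[symmetric] sum_distrib_right[symmetric] real_sqrt_mult)
  have step: "E (Suc n) \<le> t * E n + c * s ^ n" for n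
  proof -
    have "E (Suc n) \<le> L2_set (\<lambda>w. \<bar>d (hd w)\<bar> * bh n (tl w)) (words (Suc n)) +
        L2_set (\<lambda>w. \<bar>k (hd w)\<bar> * bg n (tl w)) (words (Suc n))"
      unfolding E_def bh_Suc by (rule L2_set_triangle_ineq)
    also have "\<dots> = t * E n + L2_set k S * L2_set (bg n) (words n)"
      unfolding prod E_def t_def rho[symmetric] by (simp add: L2_set_def)
    also have "L2_set (bg n) (words n) \<le> sqrt (C * \<rho>' ^ n)"
      unfolding L2_set_def using bg(2) by (intro real_sqrt_le_mono)
    also have "sqrt (C * \<rho>' ^ n) = sqrt C * s ^ n"
      by (simp add: s_def real_sqrt_mult real_sqrt_power)
    finally show ?thesis by (simp add: c_def mult.assoc mult_left_mono L2_set_nonneg)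
  qed
  \<comment> \<open>With this \<open>D\<close>, the quantity \<open>E n + D * s ^ n\<close> grows in each step at most by the factor \<open>t\<close>.\<close>
  define D where "D = c / (t - s)"
  have c0: "0 \<le> c" using C0 by (simp add: c_def L2_set_nonneg)
  then have D0: "0 \<le> D" using st by (simp add: D_def)
  have D: "c + D * s = D * t" using st by (simp add: D_def field_simps)
  have inv: "E n + D * s ^ n \<le> (E 0 + D) * t ^ n" for n
  proof (induction n)
    case (Suc n)
    have "E (Suc n) + D * s ^ Suc n \<le> t * E n + (c + D * s) * s ^ n"
      using step[of n] by (simp add: algebra_simps)
    also have "\<dots> = t * (E n + D * s ^ n)" unfolding D by (simp add: algebra_simps)
    also have "\<dots> \<le> t * ((E 0 + D) * t ^ n)" using Suc st by (intro mult_left_mono) auto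
    finally show ?case by (simp add: mult_ac)
  qed simp
  show ?thesis
  proof (rule osc_classI[OF osc])
    fix n
    have "E n \<le> (E 0 + D) * t ^ n" using inv[of n] D0 st zero_le_power[of s n]
      by (smt (verit) mult_nonneg_nonneg)
    then have "(E n)\<^sup>2 \<le> ((E 0 + D) * t ^ n)\<^sup>2" by (intro power_mono) (simp_all add: E_def L2_set_nonneg)
    also have "\<dots> = (E 0 + D)\<^sup>2 * (t\<^sup>2) ^ n" by (simp add: power_mult_distrib flip: power_mult) (simp add: mult.commute)
    also have "t\<^sup>2 = \<rho>" using rho' by (simp add: t_def)
    also have "(E n)\<^sup>2 = (\<Sum>w\<in>words n. (bh n w)\<^sup>2)" by (simp add: E_def L2_set_def sum_nonneg)
    finally show "(\<Sum>w\<in>words n. (bh n w)\<^sup>2) \<le> (E 0 + D)\<^sup>2 * \<rho> ^ n" .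
  qed
qed

end

section \<open>The combinatorics of the sickle\<close>

lemma lattice_corners: "{p1, p2, p3} = lattice_pt ` corners"
  by (auto simp: corners_def lattice_pt_def p1_def zero_prod_def)

lemma corner_in_triangle: "a \<in> corners \<Longrightarrow> cell_map i (lattice_pt a) \<in> cell i"
  unfolding cell_def lattice_corners by (intro imageI hull_inc)

lemma lattice_corner_simps: "p1 = lattice_pt (0,0)" "p2 = lattice_pt (1,0)" "p3 = lattice_pt (0,1)"
  by (simp_all add: lattice_pt_def p1_def zero_prod_def)

lemma grid_pt_cell_map: "grid_pt (a + i) = cell_map i (lattice_pt a)"
  by (rule coord_eqI) (simp_all add: grid_pt_lattice)

lemma grid_pt_inj: "grid_pt p = grid_pt q \<longleftrightarrow> p = q"
proof
  assume "grid_pt p = grid_pt q"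
  from arg_cong[OF this, of coordX] arg_cong[OF this, of coordY] show "p = q"
    by (simp add: grid_pt_lattice prod_eq_iff)
qed simp

locale sickle =
  fixes c :: "nat \<Rightarrow> nat \<times> nat" and z :: "nat \<Rightarrow> plane" and K :: "plane set" and \<alpha> :: real
  assumes chain: "right_chain c z" and sickle: "is_sickle c K" and alpha: "\<alpha> = ln 17 / ln 7"
begin

lemma chain_conditions:
  "\<forall>k\<in>{1..9}. fst (c k) + snd (c k) \<le> 6"
  "z 0 = grid_pt (2, 5)" "z 9 = grid_pt (7, 0)"
  "\<forall>k\<in>{1..9}. z (k - 1) \<noteq> z k \<and> {z (k - 1), z k} \<subseteq> cell_map (c k) ` {p1, p2, p3}"
  "\<forall>k\<in>{1..8}. cell (c k) \<inter> cell (c (k + 1)) = {z k}"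
  "\<forall>k\<in>{1..9}. \<forall>l\<in>{1..9}. k + 1 < l \<longrightarrow> cell (c k) \<inter> cell (c l) = {}"
  "(\<Union>k\<in>{1..9}. cell (c k)) \<inter> (\<Union>ij\<in>left_cells \<union> top_cells. cell ij) = {z 0}"
  "card {k\<in>{1..9}. {z (k - 1), z k} = cell_map (c k) ` {p3, p1}} = 2"
  using chain unfolding right_chain_def by - (elim conjE, assumption)+

lemmas c_le = chain_conditions(1)[rule_format]

lemmas z_ends = chain_conditions(2,3)

lemmas meet_next = chain_conditions(5)[rule_format]

lemmas meet_far = chain_conditions(6)[rule_format]

lemma z_neq: "k \<in> {1..9} \<Longrightarrow> z (k - 1) \<noteq> z k"
  using chain_conditions(4) by simp

lemma z_corner:
  assumes "k \<in> {1..9}"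
  obtains a b where "a \<in> corners" "b \<in> corners" "z (k - 1) = cell_map (c k) (lattice_pt a)"
    "z k = cell_map (c k) (lattice_pt b)"
proof -
  have "{z (k - 1), z k} \<subseteq> cell_map (c k) ` {p1, p2, p3}"
    using bspec[OF chain_conditions(4) assms] by (rule conjunct2)
  then show ?thesis using that unfolding lattice_corners image_image by blast
qed

lemma z_in_cell: "k \<in> {1..9} \<Longrightarrow> z (k - 1) \<in> cell (c k)" "k \<in> {1..9} \<Longrightarrow> z k \<in> cell (c k)"
  using z_corner corner_in_triangle by metis+

lemma meet_left_top:
  "k \<in> {1..9} \<Longrightarrow> i \<in> left_cells \<union> top_cells \<Longrightarrow> x \<in> cell (c k) \<Longrightarrow> x \<in> cell i \<Longrightarrow> x = z 0"
proof -
  assume "k \<in> {1..9}" "i \<in> left_cells \<union> top_cells" "x \<in> cell (c k)" "x \<in> cell i"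
  then have "x \<in> (\<Union>k\<in>{1..9}. cell (c k)) \<inter> (\<Union>ij\<in>left_cells \<union> top_cells. cell ij)" by blast
  then show "x = z 0" unfolding chain_conditions(7) by simp
qed

lemma right_meets_right:
  assumes k: "k \<in> {1..9}" and l: "l \<in> {1..9}" and kl: "k < l"
    and ab: "a \<in> corners" "b \<in> corners" and eq: "a + c k = b + c l"
  shows "l = k + 1" "cell_map (c k) (lattice_pt a) = z k"
proof -
  have x: "cell_map (c k) (lattice_pt a) \<in> cell (c k)" "cell_map (c k) (lattice_pt a) \<in> cell (c l)"
    using corner_in_triangle[OF ab(1), of "c k"] corner_in_triangle[OF ab(2), of "c l"] eq
    unfolding cell_map_lattice_eq_iff[symmetric] by simp_all
  then show lk: "l = k + 1" using meet_far[OF k l] kl by (cases "k + 1 < l") auto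
  then show "cell_map (c k) (lattice_pt a) = z k" using meet_next[of k] x k l by auto
qed

text \<open>The point \<open>z 0\<close> lies in the first cell of the chain, and a later cell is disjoint from this one or meets
  it only in \<open>z 1 \<noteq> z 0\<close>.\<close>

lemma z0_only_first: "k \<in> {1..9} \<Longrightarrow> z 0 \<in> cell (c k) \<Longrightarrow> k = 1"
proof -
  assume k: "k \<in> {1..9}" and z0: "z 0 \<in> cell (c k)"
  have 1: "z 0 \<in> cell (c 1)" "z 0 \<noteq> z 1" using z_in_cell(1)[of 1] z_neq[of 1] by auto
  consider "k = 1" | "k = 2" | "1 + 1 < k" using k by force
  then show "k = 1"
  proof cases
    case 2
    then show ?thesis using meet_next[of 1] 1 z0 by (auto simp: numeral_2_eq_2)
  next
    case 3
    then show ?thesis using meet_far[of 1 k] 1 z0 k by auto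
  qed
qed

lemma right_meets_left_top:
  assumes k: "k \<in> {1..9}" and i: "i \<in> left_cells \<union> top_cells"
    and ab: "a \<in> corners" "b \<in> corners" and eq: "a + c k = b + i"
  shows "k = 1" "cell_map (c k) (lattice_pt a) = z 0"
proof -
  have x: "cell_map (c k) (lattice_pt a) \<in> cell (c k)" "cell_map (c k) (lattice_pt a) \<in> cell i"
    using corner_in_triangle[OF ab(1), of "c k"] corner_in_triangle[OF ab(2), of i] eq
    unfolding cell_map_lattice_eq_iff[symmetric] by simp_all
  then show "cell_map (c k) (lattice_pt a) = z 0" using meet_left_top[OF k i] by blast
  then show "k = 1" using z0_only_first[OF k] x(1) by simp
qed

text \<open>Distinct cells share at most one vertex, whereas a cell has three of them. This shows below that the
  seventeen cells are distinct.\<close>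

lemma two_corners: "cell_map i (lattice_pt (0,0)) \<noteq> cell_map i (lattice_pt (1,0))"
  unfolding cell_map_lattice_eq_iff by (simp add: prod_eq_iff)

lemma c_inj: "inj_on c {1..9}"
proof -
  have False if kl: "k \<in> {1..9}" "l \<in> {1..9}" "k < l" "c k = c l" for k l
  proof -
    have "cell_map (c k) (lattice_pt a) = z k" if "a \<in> corners" for a
      using right_meets_right(2)[OF kl(1-3) that that] kl(4) by simp
    then show False using two_corners[of "c k"] by (simp add: corners_def)
  qed
  then show ?thesis by (metis inj_onI linorder_neqE_nat)
qed

lemma c_not_left_top: "k \<in> {1..9} \<Longrightarrow> c k \<notin> left_cells \<union> top_cells"
proof
  assume k: "k \<in> {1..9}" "c k \<in> left_cells \<union> top_cells"
  have "cell_map (c k) (lattice_pt a) = z 0" if "a \<in> corners" for a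
    using right_meets_left_top(2)[OF k that that] by simp
  then show False using two_corners[of "c k"] by (simp add: corners_def)
qed

lemma c_last: "c 9 = (6, 0)" "z 9 = cell_map (c 9) (lattice_pt (1,0))"
proof -
  have nine: "(9::nat) \<in> {1..9}" by simp
  obtain a b where b: "a \<in> corners" "b \<in> corners" "z (9 - 1) = cell_map (c 9) (lattice_pt a)"
    "z 9 = cell_map (c 9) (lattice_pt b)" using z_corner[OF nine] .
  then have "grid_pt (b + c 9) = grid_pt (7,0)" using z_ends grid_pt_cell_map by metis
  then have "b + c 9 = (7,0)" unfolding grid_pt_inj .
  then have "c 9 = (6,0) \<and> b = (1,0)" using b(2) c_le[OF nine] by (auto simp: corners_def prod_eq_iff)
  then show "c 9 = (6, 0)" "z 9 = cell_map (c 9) (lattice_pt (1,0))" using b(4) by simp_all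
qed

lemma sum_cells:
  "(\<Sum>i\<in>sickle_cells c. f i) = (\<Sum>i\<in>left_cells \<union> top_cells. f i) + (\<Sum>k\<in>{1..9}. f (c k))"
proof -
  have "(left_cells \<union> top_cells) \<inter> c ` {1..9} = {}" using c_not_left_top by blast
  then have "(\<Sum>i\<in>sickle_cells c. f i) = (\<Sum>i\<in>left_cells \<union> top_cells. f i) + (\<Sum>i\<in>c ` {1..9}. f i)"
    unfolding sickle_cells_def by (intro sum.union_disjoint) (auto simp: left_cells_def top_cells_def)
  then show ?thesis using c_inj by (simp add: sum.reindex)
qed

sublocale ifs17 "sickle_cells c" K \<alpha>
proof
  show "finite (sickle_cells c)"
    by (simp add: sickle_cells_def left_cells_def top_cells_def)
  show "fst i + snd i \<le> 6" if "i \<in> sickle_cells c" for i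
    using that c_le by (auto simp: sickle_cells_def left_cells_def top_cells_def)
  show "(0,0) \<in> sickle_cells c" "(0,6) \<in> sickle_cells c"
    by (auto simp: sickle_cells_def left_cells_def top_cells_def)
  show "(6,0) \<in> sickle_cells c"
    unfolding sickle_cells_def c_last(1)[symmetric] by (intro UnI2 imageI) auto
  show "compact K" "K \<noteq> {}" "K = (\<Union>i\<in>sickle_cells c. cell_map i ` K)"
    using sickle by (auto simp: is_sickle_def)
  have "card (sickle_cells c) = card (left_cells \<union> top_cells) + card ({1..9} :: nat set)"
    using sum_cells[of "\<lambda>_. 1::nat"] by (simp only: card_eq_sum)
  then show "card (sickle_cells c) = 17"
    by (simp add: left_cells_def top_cells_def)
  show "\<alpha> = ln 17 / ln 7" by (rule alpha)
qed

abbreviation S where "S \<equiv> sickle_cells c"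

lemma S_cases:
  assumes "i \<in> S"
  obtains "i \<in> left_cells \<union> top_cells" | k where "k \<in> {1..9}" "i = c k"
  using assms unfolding sickle_cells_def by blast

lemma left_top_in_S: "i \<in> left_cells \<union> top_cells \<Longrightarrow> i \<in> S"
  unfolding sickle_cells_def by blast

lemma c_in_S: "k \<in> {1..9} \<Longrightarrow> c k \<in> S"
  unfolding sickle_cells_def by blast

lemma column_left_top: "i \<in> S \<Longrightarrow> fst i = 0 \<Longrightarrow> i \<in> left_cells \<union> top_cells"
proof -
  assume "i \<in> S" "fst i = 0"
  then have "snd i \<le> 6" "i = (0, snd i)" using S_le[of i] by (auto simp: prod_eq_iff)
  then show "i \<in> left_cells \<union> top_cells"
    by (cases i) (auto simp: left_cells_def top_cells_def)
qed

lemma column: "{i \<in> S. fst i = 0} = {(0,0), (0,1), (0,2), (0,3), (0,4), (0,5), (0,6)}"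
proof (intro equalityI subsetI)
  fix i assume "i \<in> {i \<in> S. fst i = 0}"
  then have "i \<in> left_cells \<union> top_cells" "fst i = 0" using column_left_top[of i] by simp_all
  then show "i \<in> {(0,0), (0,1), (0,2), (0,3), (0,4), (0,5), (0,6)}"
    by (auto simp: left_cells_def top_cells_def)
next
  fix i :: "nat \<times> nat" assume i: "i \<in> {(0,0), (0,1), (0,2), (0,3), (0,4), (0,5), (0,6)}"
  then have "i \<in> left_cells \<union> top_cells" by (auto simp: left_cells_def top_cells_def)
  then show "i \<in> {i \<in> S. fst i = 0}" using i left_top_in_S[of i] by auto
qed

text \<open>The right vertices of the five left cells are end points of the sickle, where gluing imposes no
  condition on the values of a function.\<close>

lemma dangling:
  assumes "i \<in> S" "a \<in> corners" "a + i = (1, j)" "j \<le> 4"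
  shows "i = (0, j) \<and> a = (1, 0)"
  using assms(1)
proof (cases rule: S_cases)
  case 1
  then show ?thesis using assms(2-4) by (auto simp: left_cells_def top_cells_def corners_def)
next
  case (2 k)
  have "(1,0) + (0, j) = (1::nat, j)" by simp
  then have "a + c k = (1,0) + (0, j)" using assms(3) 2 by simp
  moreover have "(0, j) \<in> left_cells \<union> top_cells"
    using assms(4) by (auto simp: left_cells_def)
  ultimately have "cell_map (c k) (lattice_pt a) = z 0"
    using right_meets_left_top(2)[of k "(0,j)" a "(1,0)"] 2(1) assms(2) by (auto simp: corners_def)
  then have "grid_pt (a + c k) = grid_pt (2,5)" using z_ends(1) grid_pt_cell_map by metis
  then show ?thesis unfolding grid_pt_inj using assms(3) 2 by simp
qed

section \<open>The profile along the right arc\<close>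

definition tip :: "nat \<Rightarrow> plane" where
  "tip k = cell_map (c k) (lattice_pt (1,0))"

text \<open>The active cells of the right arc are those traversed from \<open>p2\<close> to \<open>p1\<close> or \<open>p3\<close> or conversely. The
  function \<open>g\<close> constructed below takes equal values at \<open>p1\<close> and \<open>p3\<close>, so it can vary along the arc only in
  active cells.\<close>

definition active :: "nat \<Rightarrow> bool" where
  "active k \<longleftrightarrow> tip k \<in> {z (k - 1), z k}"

text \<open>A cell of the arc is inactive precisely if its two connecting points are the images of \<open>p3\<close> and \<open>p1\<close>,
  which happens for two of the nine cells.\<close>

lemma card_active: "card {k \<in> {1..9}. active k} = 7"
proof -
  let ?T = "{k \<in> {1..9}. {z (k - 1), z k} = cell_map (c k) ` {p3, p1}}"
  note T = chain_conditions(8)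
  have "\<not> active k \<longleftrightarrow> {z (k - 1), z k} = cell_map (c k) ` {p3, p1}" if k: "k \<in> {1..9}" for k
  proof -
    obtain a b where ab: "a \<in> corners" "b \<in> corners" "z (k - 1) = cell_map (c k) (lattice_pt a)"
      "z k = cell_map (c k) (lattice_pt b)" using z_corner[OF k] .
    have "a \<noteq> b" using z_neq[OF k] ab by auto
    have eq: "cell_map (c k) (lattice_pt p) = cell_map (c k) (lattice_pt q) \<longleftrightarrow> p = q" for p q
      unfolding cell_map_lattice_eq_iff by simp
    show ?thesis
      unfolding active_def tip_def lattice_corner_simps ab(3,4) image_insert image_empty insert_iff eq
        doubleton_eq_iff empty_iff
      using ab(1,2) \<open>a \<noteq> b\<close> by (auto simp: corners_def)
  qed
  then have "?T = {1..9} - {k \<in> {1..9}. active k}" by blast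
  with T have "card ({1..9} - {k \<in> {1..9}. active k}) = 2" by (simp only:)
  moreover have "card ({1..9} - {k \<in> {1..9}. active k}) = card {1..9::nat} - card {k \<in> {1..9}. active k}"
    by (rule card_Diff_subset) auto
  ultimately show ?thesis by simp
qed

text \<open>The value of \<open>g\<close> at the point \<open>z k\<close> of the arc: the unit flow from \<open>p1\<close> to \<open>p2\<close> meets the resistance
  \<open>1/2\<close> in two parallel cells of the top triangle, 1 in its third cell and 1 in each of the seven active
  cells, in total \<open>17/2\<close>, of which \<open>3/2\<close> lie before \<open>z 0\<close>.\<close>

definition height :: "nat \<Rightarrow> real" where
  "height k = 3/17 + 2/17 * card {l \<in> {1..k}. active l}"

lemma height_0: "height 0 = 3/17" by (simp add: height_def)

lemma height_9: "height 9 = 1" using card_active by (simp add: height_def)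

lemma height_step: "1 \<le> k \<Longrightarrow> height k = height (k - 1) + (if active k then 2/17 else 0)"
proof -
  assume k: "1 \<le> k"
  then have "{1..k} = insert k {1..k-1}" by auto
  then have "{l \<in> {1..k}. active l} =
      (if active k then insert k {l \<in> {1..k-1}. active l} else {l \<in> {1..k-1}. active l})" by auto
  then show ?thesis using k by (simp add: height_def algebra_simps)
qed

text \<open>On the \<open>k\<close>-th cell of the arc, \<open>g\<close> has the value \<open>g_base k\<close> at the vertices \<open>p1\<close>, \<open>p3\<close> and \<open>g_top k\<close> at
  the vertex \<open>p2\<close> of the cell. A vertex that is not a connecting point takes over the value of its
  partner.\<close>

definition g_base :: "nat \<Rightarrow> real" where
  "g_base k = (if z k = tip k then height (k - 1) else height k)"

definition g_top :: "nat \<Rightarrow> real" where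
  "g_top k = (if z k \<noteq> tip k \<and> z (k - 1) = tip k then height (k - 1) else height k)"

text \<open>The function \<open>g\<close> with values 0, 1, 0 at \<open>p1\<close>, \<open>p2\<close>, \<open>p3\<close> satisfies
  \<open>g (F x) = g_offset i + g_slope i * g x\<close> for the map \<open>F\<close> of each cell \<open>i\<close>.\<close>

definition g_offset :: "nat \<times> nat \<Rightarrow> real" where
  "g_offset i = (if i \<in> c ` {1..9} then g_base (inv_into {1..9} c i) else if i = (1,5) then 1/17 else 0)"

definition g_slope :: "nat \<times> nat \<Rightarrow> real" where
  "g_slope i = (if i \<in> c ` {1..9} then g_top (inv_into {1..9} c i) - g_base (inv_into {1..9} c i)
     else if i = (1,5) then 2/17 else if i = (0,5) \<or> i = (0,6) then 1/17 else 0)"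

definition g_vertex :: "nat \<times> nat \<Rightarrow> nat \<times> nat \<Rightarrow> real" where
  "g_vertex i a = g_offset i + g_slope i * (if a = (1,0) then 1 else 0)"

lemma g_right:
  assumes "k \<in> {1..9}"
  shows "g_offset (c k) = g_base k" "g_slope (c k) = g_top k - g_base k"
proof -
  have "c k \<in> c ` {1..9}" "inv_into {1..9} c (c k) = k" using assms c_inj by auto
  then show "g_offset (c k) = g_base k" "g_slope (c k) = g_top k - g_base k"
    by (simp_all add: g_offset_def g_slope_def)
qed

lemma g_vertex_right:
  assumes k: "k \<in> {1..9}" and a: "a \<in> corners"
  shows "cell_map (c k) (lattice_pt a) = z k \<Longrightarrow> g_vertex (c k) a = height k"
    and "cell_map (c k) (lattice_pt a) = z (k - 1) \<Longrightarrow> g_vertex (c k) a = height (k - 1)"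
proof -
  have eq: "cell_map (c k) (lattice_pt a) = tip k \<longleftrightarrow> a = (1,0)"
    unfolding tip_def cell_map_lattice_eq_iff by simp
  note s = height_step[of k]
  show "g_vertex (c k) a = height k" if "cell_map (c k) (lattice_pt a) = z k"
    using that eq s k z_neq[OF k] by (auto simp: g_vertex_def g_right g_base_def g_top_def active_def)
  show "g_vertex (c k) a = height (k - 1)" if "cell_map (c k) (lattice_pt a) = z (k - 1)"
    using that eq s k z_neq[OF k] by (auto simp: g_vertex_def g_right g_base_def g_top_def active_def)
qed

lemma g_left_top:
  assumes "i \<in> left_cells \<union> top_cells"
  shows "g_offset i = (if i = (1,5) then 1/17 else 0)"
    "g_slope i = (if i = (1,5) then 2/17 else if i = (0,5) \<or> i = (0,6) then 1/17 else 0)"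
proof -
  have "i \<notin> c ` {1..9}" using assms c_not_left_top by blast
  then show "g_offset i = (if i = (1,5) then 1/17 else 0)"
    "g_slope i = (if i = (1,5) then 2/17 else if i = (0,5) \<or> i = (0,6) then 1/17 else 0)"
    by (simp_all add: g_offset_def g_slope_def)
qed

lemma g_vertex_left_top:
  assumes "i \<in> left_cells \<union> top_cells" "a \<in> corners"
  shows "g_vertex i a = (if a + i = (1,5) \<or> a + i = (1,6) then 1/17 else if a + i = (2,5) then 3/17 else 0)"
proof -
  have "i = (0,0) \<or> i = (0,1) \<or> i = (0,2) \<or> i = (0,3) \<or> i = (0,4) \<or> i = (0,5) \<or> i = (1,5) \<or> i = (0,6)"
    using assms(1) by (auto simp: left_cells_def top_cells_def)
  moreover have "a = (0,0) \<or> a = (1,0) \<or> a = (0,1)" using assms(2) by (simp add: corners_def)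
  ultimately show ?thesis
    unfolding g_vertex_def g_left_top[OF assms(1)] by (elim disjE) simp_all
qed

lemma g_compatible: "compatible g_vertex"
proof -
  have main: "g_vertex i a = g_vertex j b"
    if i: "i \<in> left_cells \<union> top_cells" and j: "j \<in> S" and ab: "a \<in> corners" "b \<in> corners" and eq: "a + i = b + j" for i j a b
    using j
  proof (cases rule: S_cases)
    case 1
    then show ?thesis using i ab eq by (simp add: g_vertex_left_top)
  next
    case (2 k)
    note m = right_meets_left_top[OF 2(1) i ab(2,1) eq[unfolded 2, symmetric]]
    have "g_vertex j b = 3/17"
      using g_vertex_right(2)[OF 2(1) ab(2)] m 2 height_0 by simp
    moreover have "a + i = (2,5)"
      using m(2) z_ends(1) grid_pt_inj grid_pt_cell_map eq 2(2) by metis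
    ultimately show ?thesis using i ab by (simp add: g_vertex_left_top)
  qed
  have right: "g_vertex (c k) a = g_vertex (c l) b"
    if kl: "k \<in> {1..9}" "l \<in> {1..9}" "k < l" and ab: "a \<in> corners" "b \<in> corners" and eq: "a + c k = b + c l" for k l a b
  proof -
    note m = right_meets_right[OF kl ab eq]
    have "cell_map (c l) (lattice_pt b) = z (l - 1)"
      using m eq cell_map_lattice_eq_iff by (metis add_diff_cancel_right')
    then show ?thesis
      using g_vertex_right(1)[OF kl(1) ab(1) m(2)] g_vertex_right(2)[OF kl(2) ab(2)] m(1) by simp
  qed
  show ?thesis
    unfolding compatible_def
  proof (intro ballI impI)
    fix i j a b assume *: "i \<in> S" "j \<in> S" "a \<in> corners" "b \<in> corners" "i \<noteq> j" "a + i = b + j"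
    show "g_vertex i a = g_vertex j b"
      using *(1)
    proof (cases rule: S_cases)
      case 1
      then show ?thesis using main * by blast
    next
      case k: (2 k)
      show ?thesis
        using *(2)
      proof (cases rule: S_cases)
        case 1
        then show ?thesis using main[of j i b a] * by simp
      next
        case l: (2 l)
        have "k < l \<or> l < k" using k l *(5) by (metis linorder_neqE_nat)
        then show ?thesis using right[of k l a b] right[of l k b a] k l * by auto
      qed
    qed
  qed
qed

lemma sum_left_top: "(\<Sum>i\<in>left_cells \<union> top_cells. f i) =
    f (0,0) + f (0,1) + f (0,2) + f (0,3) + f (0,4) + f (0,5) + f (1,5) + (f (0,6) :: real)"
  by (simp add: left_cells_def top_cells_def insert_commute)

lemma g_slope_right:
  assumes "k \<in> {1..9}"
  shows "\<bar>g_slope (c k)\<bar> = (if active k then 2/17 else 0)"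
  using assms height_step[of k] z_neq[of k]
  by (auto simp: g_right g_base_def g_top_def active_def)

text \<open>Two cells of slope \<open>1/17\<close>, one of slope \<open>2/17\<close> in the top triangle and seven active cells of slope
  \<open>2/17\<close> up to sign: the energy of the unit potential drop is the reciprocal of the resistance \<open>17/2\<close>.\<close>

lemma g_slope_sum: "(\<Sum>i\<in>S. (g_slope i)\<^sup>2) = 2/17"
proof -
  have "(\<Sum>k\<in>{1..9}. (g_slope (c k))\<^sup>2) = (\<Sum>k\<in>{1..9}. if active k then 4/289 else 0)"
  proof (rule sum.cong)
    fix k :: nat assume "k \<in> {1..9}"
    then have "(g_slope (c k))\<^sup>2 = (if active k then 2/17 else 0)\<^sup>2"
      by (simp only: g_slope_right[symmetric] power2_abs)
    then show "(g_slope (c k))\<^sup>2 = (if active k then 4/289 else 0)"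
      by (simp add: power2_eq_square)
  qed simp
  also have "\<dots> = 28/289"
    using card_active by (simp add: sum.If_cases Int_def)
  finally have r: "(\<Sum>k\<in>{1..9}. (g_slope (c k))\<^sup>2) = 28/289" .
  have "(\<Sum>i\<in>left_cells \<union> top_cells. (g_slope i)\<^sup>2) = 6/289"
    unfolding sum_left_top by (subst g_left_top(2), simp add: left_cells_def top_cells_def)+ (simp add: power2_eq_square)
  then show ?thesis unfolding sum_cells r by simp
qed

lemma g_slope_le:
  assumes "i \<in> S"
  shows "\<bar>g_slope i\<bar> \<le> 2/17"
  using assms
proof (cases rule: S_cases)
  case 1 then show ?thesis by (simp add: g_left_top)
next
  case (2 k) then show ?thesis by (simp add: g_slope_right)
qed

lemma g_exists:
  obtains g where "g \<in> osc_class (2/17)" "g (lattice_pt (0,0)) = 0" "g (lattice_pt (1,0)) = 1" "g (lattice_pt (0,1)) = 0"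
proof -
  define p :: "nat \<times> nat \<Rightarrow> real" where "p a = (if a = (1,0) then 1 else 0)" for a
  have corner: "p a = g_offset (corner_cell a) + g_slope (corner_cell a) * p a" if "a \<in> corners" for a
  proof -
    have lt: "(0,0) \<in> left_cells \<union> top_cells" "(0,6) \<in> left_cells \<union> top_cells"
      by (auto simp: left_cells_def top_cells_def)
    have "g_offset (6,0) + g_slope (6,0) = 1"
    proof -
      have "g_vertex (c 9) (1,0) = height 9"
        using c_last(2) g_vertex_right(1)[of 9 "(1,0)"] by (simp add: corners_def)
      then show ?thesis by (simp add: g_vertex_def c_last(1) height_9)
    qed
    then show ?thesis using that lt by (auto simp: corners_def corner_cell_def p_def g_left_top)
  qed
  have comp: "compatible (\<lambda>i a. g_offset i + g_slope i * p a)"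
    using g_compatible unfolding g_vertex_def p_def .
  have bd: "\<bar>g_offset i\<bar> \<le> (\<Sum>i\<in>S. \<bar>g_offset i\<bar>)" if "i \<in> S" for i
    using that finite_S by (intro member_le_sum) auto
  obtain g B where g: "\<forall>i\<in>S. \<forall>x\<in>K. g (cell_map i x) = g_offset i + g_slope i * g x"
    "\<forall>a\<in>corners. g (lattice_pt a) = p a" "\<forall>x\<in>K. \<bar>g x\<bar> \<le> B"
    by (rule self_similar_function[where A = "\<lambda>i x. g_offset i" and d = g_slope and q = "2/17" and p = p
          and M = "\<Sum>i\<in>S. \<bar>g_offset i\<bar>", OF _ _ g_slope_le bd corner comp]) simp_all
  have "g \<in> osc_class (2/17)"
    by (rule self_similar_osc_class[where a = g_offset and k = "\<lambda>_. 0" and g = "\<lambda>_. 0" and d = g_slope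
          and B = B and \<rho>' = 0]) (use g g_slope_sum osc_class_const[of 0 0] in auto)
  then show ?thesis using that g(2) by (simp add: corners_def p_def)
qed

text \<open>A function with a linear profile on the segment from \<open>p1\<close> to \<open>p3\<close>. The summand \<open>- g / 7\<close> on the
  uppermost cell lowers the value at its right vertex to \<open>5/6\<close>, which is also the value at the right
  vertex of the cell below it, so that the function can be constant on all cells that do not have an edge
  on the segment. The seven slopes \<open>1/7\<close> give \<open>\<rho> = 7/49\<close>.\<close>

lemma f_exists:
  obtains f where "f \<in> osc_class (1/7)" "f (lattice_pt (0,0)) = 0" "f (lattice_pt (1,0)) = 5/6" "f (lattice_pt (0,1)) = 1"
proof -
  obtain g where g: "g \<in> osc_class (2/17)" "g (lattice_pt (0,0)) = 0" "g (lattice_pt (1,0)) = 1" "g (lattice_pt (0,1)) = 0"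
    using g_exists .
  obtain Bg where Bg: "\<forall>x\<in>K. \<bar>g x\<bar> \<le> Bg" using osc_class_bounded[OF g(1)] .
  define a :: "nat \<times> nat \<Rightarrow> real" where "a i = (if fst i = 0 then real (snd i) / 7 else 5/6)" for i
  define d :: "nat \<times> nat \<Rightarrow> real" where "d i = (if fst i = 0 then 1/7 else 0)" for i
  define k :: "nat \<times> nat \<Rightarrow> real" where "k i = (if i = (0,6) then -1/7 else 0)" for i
  define p :: "nat \<times> nat \<Rightarrow> real" where "p e = (if e = (0,0) then 0 else if e = (1,0) then 5/6 else 1)" for e
  define v where "v i e = (a i + k i * g (lattice_pt e)) + d i * p e" for i e
  have corner: "p e = v (corner_cell e) e" if "e \<in> corners" for e
    using that g by (auto simp: corners_def corner_cell_def p_def a_def d_def k_def v_def)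
  have v_col: "v i e = (if e = (1,0) then (if snd i = 6 then 5/6 else (real (snd i) + 5/6) / 7) else real (snd (e + i)) / 7)"
    if "e \<in> corners" "fst i = 0" for i e
    using that g by (cases i) (auto simp: corners_def p_def a_def d_def k_def v_def add_divide_distrib)
  have v_off: "v i e = 5/6" if "fst i \<noteq> 0" for i e
    using that by (auto simp: a_def d_def k_def v_def)
  have col_off: "v i e = 5/6" if i: "i \<in> S" "fst i = 0" and j: "j \<in> S" "fst j \<noteq> 0"
    and eb: "e \<in> corners" "b \<in> corners" and eq: "e + i = b + j" for i j e b
  proof -
    have e: "e = (1,0)" using eq i(2) j(2) eb by (auto simp: corners_def prod_eq_iff)
    then have "b + j = (1, snd i)" using eq i(2) by (simp add: prod_eq_iff)
    then have "\<not> snd i \<le> 4" using dangling[OF j(1) eb(2)] j(2) by auto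
    then have "snd i = 5 \<or> snd i = 6" using S_le[OF i(1)] by auto
    then show ?thesis using v_col[OF eb(1) i(2)] e by auto
  qed
  have comp: "compatible v"
    unfolding compatible_def
  proof (intro ballI impI)
    fix i j e b assume *: "i \<in> S" "j \<in> S" "e \<in> corners" "b \<in> corners" "i \<noteq> j" "e + i = b + j"
    show "v i e = v j b"
    proof (cases "fst i = 0")
      case i: True
      show ?thesis
      proof (cases "fst j = 0")
        case j: True
        have "e \<noteq> (1,0)" "b \<noteq> (1,0)"
          using * i j by (auto simp: corners_def prod_eq_iff)
        then show ?thesis using v_col[OF *(3) i] v_col[OF *(4) j] *(6) by simp
      next
        case False
        then show ?thesis using col_off[OF *(1) i *(2) False *(3,4,6)] v_off[OF False, of b] by (simp only:)
      qed
    next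
      case i: False
      have "v j b = 5/6"
        using v_off[of j b] col_off[OF *(2) _ *(1) i *(4,3) *(6)[symmetric]] by (cases "fst j = 0") simp_all
      then show ?thesis using v_off[OF i, of e] by (simp only:)
    qed
  qed
  have bd: "\<bar>a i + k i * g x\<bar> \<le> 1 + Bg" if "i \<in> S" "x \<in> K" for i x
  proof -
    have "snd i \<le> 6" using S_le[OF that(1)] by simp
    then have "\<bar>a i\<bar> \<le> 1" by (auto simp: a_def)
    moreover have "\<bar>k i * g x\<bar> \<le> 1 * Bg" 
      unfolding abs_mult using Bg that(2) by (intro mult_mono) (auto simp: k_def)
    ultimately show ?thesis by (intro order_trans[OF abs_triangle_ineq]) linarith
  qed
  have d_le: "\<bar>d i\<bar> \<le> 1/7" for i by (simp add: d_def)
  obtain f B where f: "\<forall>i\<in>S. \<forall>x\<in>K. f (cell_map i x) = a i + k i * g x + d i * f x"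
    "\<forall>e\<in>corners. f (lattice_pt e) = p e" "\<forall>x\<in>K. \<bar>f x\<bar> \<le> B"
    by (rule self_similar_function[where A = "\<lambda>i x. a i + k i * g x" and d = d and q = "1/7" and p = p
          and M = "1 + Bg", OF _ _ d_le bd corner[unfolded v_def] comp[unfolded v_def[abs_def]]]) simp_all
  have "(\<Sum>i\<in>S. (d i)\<^sup>2) = (\<Sum>i\<in>{i \<in> S. fst i = 0}. (1/49::real))"
    using finite_S by (intro sum.mono_neutral_cong_right) (auto simp: d_def power2_eq_square)
  also have "\<dots> = 1/7" unfolding column by simp
  finally have "f \<in> osc_class (1/7)"
    by (intro self_similar_osc_class[OF f(1,3) g(1)]) auto
  then show ?thesis using that f(2) by (simp add: corners_def p_def)
qed

section \<open>Plateau functions\<close>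

text \<open>Replacing \<open>g\<close> on all cells outside \<open>T\<close> by the constant 1, and on the cells in \<open>T\<close> by the function of the
  previous level, pushes the region where the function differs from 1 into the cells of level \<open>m\<close> with all
  letters in \<open>T\<close>.\<close>

lemma cutoff_exists:
  fixes p :: "nat \<times> nat \<Rightarrow> real"
  assumes g: "g \<in> osc_class \<rho>" "0 < \<rho>" "\<forall>a\<in>corners. g (lattice_pt a) = p a" "\<forall>x\<in>K. \<bar>g x\<bar> \<le> B" and B: "1 \<le> B"
    and comp: "compatible (\<lambda>i a. if i \<in> T then p a else 1)"
    and T: "\<And>a. a \<in> corners \<Longrightarrow> corner_cell a \<notin> T \<Longrightarrow> p a = 1"
  shows "\<exists>u\<in>osc_class \<rho>. (\<forall>a\<in>corners. u (lattice_pt a) = p a) \<and> (\<forall>x\<in>K. \<bar>u x\<bar> \<le> B) \<and>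
    (\<forall>w\<in>words m. \<not> set w \<subseteq> T \<longrightarrow> (\<forall>x\<in>K. u (word_map w x) = 1))"
proof (induction m)
  case 0
  show ?case using g by (intro bexI[of _ g]) auto
next
  case (Suc m)
  obtain u where u: "u \<in> osc_class \<rho>" "\<forall>a\<in>corners. u (lattice_pt a) = p a" "\<forall>x\<in>K. \<bar>u x\<bar> \<le> B"
    "\<forall>w\<in>words m. \<not> set w \<subseteq> T \<longrightarrow> (\<forall>x\<in>K. u (word_map w x) = 1)" using Suc by blast
  define v where "v i x = (if i \<in> T then u x else 1)" for i x
  have "compatible (\<lambda>i a. v i (lattice_pt a)) \<longleftrightarrow> compatible (\<lambda>i a. if i \<in> T then p a else 1)"
    unfolding compatible_def v_def using u(2) by (intro ball_cong refl) simp
  with comp have "compatible (\<lambda>i a. v i (lattice_pt a))" by (rule iffD2[rotated])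
  then obtain u' where u': "\<forall>i\<in>S. \<forall>x\<in>K. u' (cell_map i x) = v i x" by (rule glue)
  have "u' \<in> osc_class \<rho>"
  proof (rule osc_class_pieces[OF _ g(2)])
    fix i assume i: "i \<in> S"
    have "v i \<in> osc_class \<rho>"
      using u(1) osc_class_const[of \<rho> 1] g(2) by (cases "i \<in> T") (simp_all add: v_def[abs_def])
    then show "(\<lambda>x. u' (cell_map i x)) \<in> osc_class \<rho>"
      by (rule osc_class_cong) (use u' i in simp)
  qed
  moreover have "u' (lattice_pt a) = p a" if a: "a \<in> corners" for a
    using corners_fixed[OF u' a] u(2) T[OF a] a by (auto simp: v_def)
  moreover have "\<bar>u' x\<bar> \<le> B" if "x \<in> K" for x
  proof -
    obtain i y where i: "i \<in> S" "y \<in> K" "x = cell_map i y" using in_cell[OF \<open>x \<in> K\<close>] .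
    then show ?thesis using u' u(3) B by (simp add: v_def)
  qed
  moreover have "u' (word_map w x) = 1" if w: "w \<in> words (Suc m)" "\<not> set w \<subseteq> T" and x: "x \<in> K" for w x
  proof -
    obtain i w' where iw: "i \<in> S" "w' \<in> words m" "w = i # w'" using w(1) by (auto simp: words_Suc_Cons)
    then have "u' (word_map w x) = v i (word_map w' x)" using u' word_map_in_K[OF iw(2) x] by simp
    then show ?thesis using u(4) iw w(2) x by (auto simp: v_def)
  qed
  ultimately show ?case by (intro bexI[of _ u'] conjI ballI impI) auto
qed

text \<open>One cutoff keeps a copy of \<open>g\<close> only on the \<open>7 ^ m\<close> cells along the segment from \<open>p1\<close> to \<open>p3\<close>, the other
  a copy of \<open>1 - g\<close> only on the one cell at \<open>p2\<close>. Their sum minus one vanishes at the three corners and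
  equals one on all but a small proportion of the \<open>17 ^ m\<close> cells.\<close>

lemma plateau_exists:
  obtains B where "\<forall>m. \<exists>u\<in>osc_class (2/17). \<exists>Bad. finite Bad \<and> card Bad \<le> 7 ^ m + 1 \<and>
    (\<forall>a\<in>corners. u (lattice_pt a) = 0) \<and> (\<forall>x\<in>K. \<bar>u x\<bar> \<le> B) \<and>
    (\<forall>w\<in>words m - Bad. \<forall>x\<in>K. u (word_map w x) = 1)"
proof -
  obtain g where g: "g \<in> osc_class (2/17)" "g (lattice_pt (0,0)) = 0" "g (lattice_pt (1,0)) = 1" "g (lattice_pt (0,1)) = 0"
    using g_exists .
  obtain B where B: "\<forall>x\<in>K. \<bar>g x\<bar> \<le> B" using osc_class_bounded[OF g(1)] .
  have B1: "1 \<le> B" using B[rule_format, OF corner_in_K[of "(1,0)"]] g(3) by (simp add: corners_def)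
  let ?T = "{i. fst i = 0} :: (nat \<times> nat) set" and ?p = "\<lambda>a. real (fst a)" and ?q = "\<lambda>a. 1 - real (fst a)"
  have comp_p: "compatible (\<lambda>i a. if i \<in> ?T then ?p a else 1)"
    unfolding compatible_def by (auto simp: corners_def prod_eq_iff)
  have q: "?q a = 1" if "(6,0) \<in> S" "j \<in> S" "a \<in> corners" "b \<in> corners" "(6,0) \<noteq> j" "a + (6,0) = b + j" for j a b
    using that S_le[OF that(2)] by (auto simp: corners_def prod_eq_iff)
  have comp_q: "compatible (\<lambda>i a. if i \<in> {(6,0)} then ?q a else 1)"
    unfolding compatible_def
  proof (intro ballI impI)
    fix i j a b assume "i \<in> S" "j \<in> S" "a \<in> corners" "b \<in> corners" "i \<noteq> j" "a + i = b + j"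
    then show "(if i \<in> {(6,0)} then ?q a else 1) = (if j \<in> {(6,0)} then ?q b else 1)"
      using q[of j a b] q[of i b a] by auto
  qed
  have h: "(\<lambda>x. 1 + (-1) * g x) \<in> osc_class (2/17)"
    by (intro osc_class_add osc_class_const osc_class_scale g(1)) simp
  have h': "\<forall>a\<in>corners. 1 + (-1) * g (lattice_pt a) = ?q a" "\<forall>x\<in>K. \<bar>1 + (-1) * g x\<bar> \<le> 1 + B"
    using g(2-4) B by (auto simp: corners_def)
  have "\<exists>u\<in>osc_class (2/17). \<exists>Bad. finite Bad \<and> card Bad \<le> 7 ^ m + 1 \<and>
    (\<forall>a\<in>corners. u (lattice_pt a) = 0) \<and> (\<forall>x\<in>K. \<bar>u x\<bar> \<le> 2 + 2 * B) \<and>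
    (\<forall>w\<in>words m - Bad. \<forall>x\<in>K. u (word_map w x) = 1)" for m
  proof -
    have "\<exists>u\<in>osc_class (2/17). (\<forall>a\<in>corners. u (lattice_pt a) = ?p a) \<and> (\<forall>x\<in>K. \<bar>u x\<bar> \<le> B) \<and>
      (\<forall>w\<in>words m. \<not> set w \<subseteq> ?T \<longrightarrow> (\<forall>x\<in>K. u (word_map w x) = 1))"
      by (rule cutoff_exists[OF g(1) _ _ B B1 comp_p]) (use g in \<open>auto simp: corners_def corner_cell_def\<close>)
    then obtain u where u: "u \<in> osc_class (2/17)" "\<forall>a\<in>corners. u (lattice_pt a) = ?p a" "\<forall>x\<in>K. \<bar>u x\<bar> \<le> B"
      "\<forall>w\<in>words m. \<not> set w \<subseteq> ?T \<longrightarrow> (\<forall>x\<in>K. u (word_map w x) = 1)" by blast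
    have "\<exists>v\<in>osc_class (2/17). (\<forall>a\<in>corners. v (lattice_pt a) = ?q a) \<and> (\<forall>x\<in>K. \<bar>v x\<bar> \<le> 1 + B) \<and>
      (\<forall>w\<in>words m. \<not> set w \<subseteq> {(6,0)} \<longrightarrow> (\<forall>x\<in>K. v (word_map w x) = 1))"
      by (rule cutoff_exists[OF h _ h' _ comp_q]) (use B1 in \<open>auto simp: corners_def corner_cell_def\<close>)
    then obtain v where v0: "v \<in> osc_class (2/17)" and v1: "(\<forall>a\<in>corners. v (lattice_pt a) = ?q a) \<and>
      (\<forall>x\<in>K. \<bar>v x\<bar> \<le> 1 + B) \<and> (\<forall>w\<in>words m. \<not> set w \<subseteq> {(6,0)} \<longrightarrow> (\<forall>x\<in>K. v (word_map w x) = 1))"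
      by (rule bexE)
    note v = v0 v1[THEN conjunct1] v1[THEN conjunct2, THEN conjunct1] v1[THEN conjunct2, THEN conjunct2]
    define Bad where "Bad = {w. set w \<subseteq> {i \<in> S. fst i = 0} \<and> length w = m} \<union> {w. set w \<subseteq> {(6,0)} \<and> length w = m}"
    have fin: "finite {i \<in> S. fst i = 0}" and card: "card {i \<in> S. fst i = 0} = 7" unfolding column by simp_all
    have "card Bad \<le> card {w. set w \<subseteq> {i \<in> S. fst i = 0} \<and> length w = m} +
        card {w. set w \<subseteq> {(6::nat,0::nat)} \<and> length w = m}"
      unfolding Bad_def by (rule card_Un_le)
    then have "card Bad \<le> 7 ^ m + 1"
      using card_lists_length_eq[OF fin, of m] card_lists_length_eq[of "{(6::nat,0::nat)}" m] card by simp
    moreover have "finite Bad"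
      unfolding Bad_def using finite_lists_length_eq[OF fin, of m] finite_lists_length_eq[of "{(6::nat,0::nat)}" m] by simp
    moreover have "(\<lambda>x. u x + (v x + (-1))) \<in> osc_class (2/17)"
      by (intro osc_class_add osc_class_const u v) simp
    moreover have "\<bar>u x + (v x + (-1))\<bar> \<le> 2 + 2 * B" if "x \<in> K" for x
      using u(3)[rule_format, OF that] v(3)[rule_format, OF that] by linarith
    moreover have "u (word_map w x) + (v (word_map w x) + (-1)) = 1" if "w \<in> words m - Bad" "x \<in> K" for w x
    proof -
      have "\<not> set w \<subseteq> ?T" "\<not> set w \<subseteq> {(6,0)}" "w \<in> words m"
        using that by (auto simp: Bad_def words_def)
      then show ?thesis using u(4) v(4) that by auto
    qed
    ultimately show ?thesis using u(2) v(2)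
      by (intro bexI[of _ "\<lambda>x. u x + (v x + (-1))"] exI[of _ Bad]) auto
  qed
  then show ?thesis using that by blast
qed

end

section \<open>Cell averages of Besov functions\<close>

text \<open>With the mean \<open>a\<close> of \<open>u\<close> over \<open>A\<close>, the two sides differ by the integral of \<open>(u - a)\<^sup>2\<close>.\<close>

lemma (in finite_measure) mean_square_deviation:
  fixes u :: "'a \<Rightarrow> real"
  assumes A: "A \<in> sets M" and u: "integrable M u" "integrable M (\<lambda>x. (u x)\<^sup>2)"
    and a: "(\<integral>x. indicator A x * u x \<partial>M) = a * measure M A"
  shows "ennreal (measure M A * (a - t)\<^sup>2) \<le> (\<integral>\<^sup>+x\<in>A. ennreal ((u x - t)\<^sup>2) \<partial>M)"
proof -
  have iA: "integrable M (\<lambda>x. indicator A x * f x)" if "integrable M f" for f :: "'a \<Rightarrow> real"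
    using integrable_mult_indicator[OF A that] by simp
  have i2: "integrable M (\<lambda>x. indicator A x * (u x - t)\<^sup>2)"
  proof (rule iA)
    have "integrable M (\<lambda>x. (u x)\<^sup>2 + t\<^sup>2 - 2 * t * u x)" using u by simp
    then show "integrable M (\<lambda>x. (u x - t)\<^sup>2)" by (simp add: power2_diff mult_ac)
  qed
  have i1: "integrable M (\<lambda>x. indicator A x * ((a - t)\<^sup>2 - 2 * (a - t) * a))"
    by (rule iA) simp
  have i3: "integrable M (\<lambda>x. 2 * (a - t) * (indicator A x * u x))"
    using iA[OF u(1)] by simp
  have "measure M A * (a - t)\<^sup>2 =
      (\<integral>x. indicator A x * ((a - t)\<^sup>2 - 2 * (a - t) * a) \<partial>M) + (\<integral>x. 2 * (a - t) * (indicator A x * u x) \<partial>M)"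
  proof -
    have "(\<integral>x. indicator A x * k \<partial>M) = measure M A * k" for k :: real
      using A by simp
    moreover have "(\<integral>x. 2 * (a - t) * (indicator A x * u x) \<partial>M) = 2 * (a - t) * (a * measure M A)"
      unfolding integral_mult_right_zero a by simp
    ultimately show ?thesis by (simp only:) (simp add: right_diff_distrib)
  qed
  also have "\<dots> = (\<integral>x. indicator A x * ((a - t)\<^sup>2 - 2 * (a - t) * a) + 2 * (a - t) * (indicator A x * u x) \<partial>M)"
    by (rule Bochner_Integration.integral_add[symmetric, OF i1 i3])
  also have "\<dots> \<le> (\<integral>x. indicator A x * (u x - t)\<^sup>2 \<partial>M)"
  proof (rule integral_mono[OF Bochner_Integration.integrable_add[OF i1 i3] i2])
    fix x
    have "(u x - t)\<^sup>2 - ((a - t)\<^sup>2 - 2 * (a - t) * a + 2 * (a - t) * u x) = (u x - a)\<^sup>2"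
      by (simp add: power2_eq_square algebra_simps)
    then have "(a - t)\<^sup>2 - 2 * (a - t) * a + 2 * (a - t) * u x \<le> (u x - t)\<^sup>2"
      using zero_le_power2[of "u x - a"] by linarith
    then show "indicator A x * ((a - t)\<^sup>2 - 2 * (a - t) * a) + 2 * (a - t) * (indicator A x * u x)
        \<le> indicator A x * (u x - t)\<^sup>2"
      by (simp split: split_indicator)
  qed
  finally have "ennreal (measure M A * (a - t)\<^sup>2) \<le> ennreal (\<integral>x. indicator A x * (u x - t)\<^sup>2 \<partial>M)"
    by (rule ennreal_leI)
  also have "\<dots> = (\<integral>\<^sup>+x. ennreal (indicator A x * (u x - t)\<^sup>2) \<partial>M)"
    by (rule nn_integral_eq_integral[symmetric, OF i2]) simp
  also have "\<dots> = (\<integral>\<^sup>+x\<in>A. ennreal ((u x - t)\<^sup>2) \<partial>M)"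
    by (rule nn_integral_cong) (simp split: split_indicator)
  finally show ?thesis .
qed

context ifs17
begin

definition avg :: "(plane \<Rightarrow> real) \<Rightarrow> (nat \<times> nat) list \<Rightarrow> real" where
  "avg u w = 17 ^ length w * (\<integral>x. indicator (piece w) x * u x \<partial>mu)"

abbreviation variation :: "(plane \<Rightarrow> real) \<Rightarrow> (nat \<times> nat) list \<Rightarrow> ennreal" where
  "variation u w \<equiv> (\<integral>\<^sup>+x\<in>piece w. ennreal ((u x - avg u w)\<^sup>2) \<partial>mu)"

definition double_integral :: "(plane \<Rightarrow> real) \<Rightarrow> real \<Rightarrow> ennreal" where
  "double_integral u r = (\<integral>\<^sup>+x. (\<integral>\<^sup>+y\<in>ball x r. ennreal (\<bar>u x - u y\<bar>\<^sup>2) \<partial>mu) \<partial>mu)"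

lemma L2_integrable:
  assumes "u \<in> L2_space mu"
  shows "u \<in> borel_measurable mu" "integrable mu u" "integrable mu (\<lambda>x. (u x)\<^sup>2)"
proof -
  show m[measurable]: "u \<in> borel_measurable mu" and i: "integrable mu (\<lambda>x. (u x)\<^sup>2)"
    using assms by (auto simp: L2_space_def)
  show "integrable mu u"
  proof (rule Bochner_Integration.integrable_bound[of mu "\<lambda>x. 1 + (u x)\<^sup>2"])
    have "\<bar>t\<bar> \<le> 1 + t\<^sup>2" for t :: real
      using sum_squares_bound[of 1 "\<bar>t\<bar>"] zero_le_power2[of t] by (simp add: power2_eq_square[of 1])
    then show "AE x in mu. norm (u x) \<le> norm (1 + (u x)\<^sup>2)" by (intro AE_I2) simp
  qed (use i in auto)
qed

lemma cell_dist_le: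
  assumes w: "w \<in> words n" and "x \<in> piece w" "y \<in> piece w"
  shows "dist x y \<le> 1 / 7 ^ n"
  using assms(2,3) dist_word_le[of _ _ w] length_words[OF w] by auto

lemma avg_deviation:
  assumes u: "u \<in> L2_space mu" and w: "w \<in> words n"
  shows "ennreal ((avg u w - t)\<^sup>2 / 17 ^ n) \<le> (\<integral>\<^sup>+x\<in>piece w. ennreal ((u x - t)\<^sup>2) \<partial>mu)"
  using mu.mean_square_deviation[OF word_cell_sets[OF w] L2_integrable(2,3)[OF u], of "avg u w" t]
  by (simp add: measure_word_cell[OF w] avg_def length_words[OF w])

lemma besov_bound:
  assumes "u \<in> besov_space \<alpha> K \<sigma>"
  obtains D where "0 \<le> D" "\<forall>r\<in>{0<..<1}. double_integral u r \<le> ennreal (D * r powr (\<alpha> + 2 * \<sigma>))"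
proof -
  have fin: "besov_seminorm_sq \<alpha> mu \<sigma> u < \<infinity>" using assms by (simp add: besov_space_def)
  define D where "D = enn2real (besov_seminorm_sq \<alpha> mu \<sigma> u)"
  have D: "besov_seminorm_sq \<alpha> mu \<sigma> u = ennreal D" and D0: "0 \<le> D"
    using fin by (simp_all add: D_def)
  have "double_integral u r \<le> ennreal (D * r powr (\<alpha> + 2 * \<sigma>))" if r: "r \<in> {0<..<1}" for r
  proof -
    have "ennreal (r powr (- \<alpha> - 2 * \<sigma>)) * double_integral u r \<le> ennreal D"
      unfolding D[symmetric] besov_seminorm_sq_def double_integral_def using r by (rule SUP_upper)
    note le = mult_left_mono[OF this zero_le, of "ennreal (r powr (\<alpha> + 2 * \<sigma>))"]
    have one: "ennreal (r powr (\<alpha> + 2 * \<sigma>)) * ennreal (r powr (- \<alpha> - 2 * \<sigma>)) = 1"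
      using r by (simp add: ennreal_mult[symmetric] powr_add[symmetric])
    have "double_integral u r \<le> ennreal (r powr (\<alpha> + 2 * \<sigma>)) * ennreal D"
      using le unfolding mult.assoc[symmetric] one by simp
    also have "\<dots> = ennreal (D * r powr (\<alpha> + 2 * \<sigma>))"
      using D0 by (subst ennreal_mult[symmetric]) (simp_all add: mult.commute)
    finally show ?thesis .
  qed
  then show ?thesis using that[of D] D0 by simp
qed

lemma card_cells_containing:
  "card {w \<in> words n. x \<in> piece w} \<le> 49"
proof (cases "{w \<in> words n. x \<in> piece w} = {}")
  case False
  then obtain w0 y0 where w0: "w0 \<in> words n" "y0 \<in> K" "x = word_map w0 y0" by blast
  have "{w \<in> words n. x \<in> piece w} \<subseteq> {w \<in> words n. close_words w w0}"
  proof
    fix w assume "w \<in> {w \<in> words n. x \<in> piece w}"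
    then obtain y where w: "w \<in> words n" "y \<in> K" "x = word_map w y" by blast
    have "close_words w w0"
      by (rule words_close[OF w(1) w0(1) w(2) w0(2)]) (simp flip: w(3) w0(3))
    then show "w \<in> {w \<in> words n. close_words w w0}" using w by simp
  qed
  then have "card {w \<in> words n. x \<in> piece w} \<le> card {w \<in> words n. close_words w w0}"
    by (intro card_mono) simp_all
  then show ?thesis using card_close_words[of n w0] by (rule order_trans)
next
  case True
  show ?thesis unfolding True by simp
qed

text \<open>For fixed \<open>x\<close> in a cell, the squared deviation of \<open>u x\<close> from the average is at most the average of
  \<open>(u x - u y)\<^sup>2\<close> over the points \<open>y\<close> of the cell, all of which lie in the ball around \<open>x\<close>. A point
  belongs to at most 49 cells of level \<open>n\<close>.\<close>

lemma variance_sum_le: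
  assumes u: "u \<in> L2_space mu" and r: "1 / 7 ^ n < r"
  shows "(\<Sum>w\<in>words n. variation u w) \<le> ennreal (49 * 17 ^ n) * double_integral u r"
proof -
  note [measurable] = L2_integrable(1)[OF u]
  have [measurable]: "piece w \<in> sets mu" if "w \<in> words n" for w
    using that by (rule word_cell_sets)
  let ?I = "\<lambda>x. (\<integral>\<^sup>+y\<in>ball x r. ennreal (\<bar>u x - u y\<bar>\<^sup>2) \<partial>mu)"
  have "ennreal (1 / (49 * 17 ^ n)) * (\<Sum>w\<in>words n. variation u w)
      = (\<Sum>w\<in>words n. (\<integral>\<^sup>+x. ennreal ((avg u w - u x)\<^sup>2 / (49 * 17 ^ n)) * indicator (piece w) x \<partial>mu))"
    unfolding sum_distrib_left
  proof (rule sum.cong[OF refl])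
    fix w assume w: "w \<in> words n"
    have "ennreal (1 / (49 * 17 ^ n)) * variation u w
        = (\<integral>\<^sup>+x. ennreal (1 / (49 * 17 ^ n)) * (ennreal ((u x - avg u w)\<^sup>2) * indicator (piece w) x) \<partial>mu)"
      using w by (intro nn_integral_cmult[symmetric]) measurable
    also have "\<dots> = (\<integral>\<^sup>+x. ennreal ((avg u w - u x)\<^sup>2 / (49 * 17 ^ n)) * indicator (piece w) x \<partial>mu)"
      by (intro nn_integral_cong) (simp add: mult.assoc[symmetric] ennreal_mult[symmetric] power2_commute)
    finally show "ennreal (1 / (49 * 17 ^ n)) * variation u w = \<dots>" .
  qed
  also have "\<dots> = (\<integral>\<^sup>+x. (\<Sum>w\<in>words n. ennreal ((avg u w - u x)\<^sup>2 / (49 * 17 ^ n)) * indicator (piece w) x) \<partial>mu)"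
    by (rule nn_integral_sum[symmetric]) measurable
  also have "\<dots> \<le> double_integral u r"
    unfolding double_integral_def
  proof (rule nn_integral_mono)
    fix x assume "x \<in> space mu"
    have "(\<Sum>w\<in>words n. ennreal ((avg u w - u x)\<^sup>2 / (49 * 17 ^ n)) * indicator (piece w) x)
        \<le> (\<Sum>w\<in>words n. ennreal (1/49) * ?I x * indicator (piece w) x)"
    proof (rule sum_mono)
      fix w assume w: "w \<in> words n"
      show "ennreal ((avg u w - u x)\<^sup>2 / (49 * 17 ^ n)) * indicator (piece w) x
          \<le> ennreal (1/49) * ?I x * indicator (piece w) x"
      proof (cases "x \<in> piece w")
        case True
        have "ennreal ((avg u w - u x)\<^sup>2 / 17 ^ n) \<le> (\<integral>\<^sup>+y\<in>piece w. ennreal ((u y - u x)\<^sup>2) \<partial>mu)"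
          by (rule avg_deviation[OF u w])
        also have "\<dots> \<le> ?I x"
        proof (rule nn_integral_mono)
          fix y
          have "dist x y < r" if "y \<in> piece w"
          proof -
            have "dist x y \<le> 1 / 7 ^ n"
              by (rule cell_dist_le[OF w True that])
            then show ?thesis using r by linarith
          qed
          then show "ennreal ((u y - u x)\<^sup>2) * indicator (piece w) y \<le>
              ennreal (\<bar>u x - u y\<bar>\<^sup>2) * indicator (ball x r) y"
            by (auto simp: power2_commute split: split_indicator)
        qed
        finally have "ennreal (1/49) * ennreal ((avg u w - u x)\<^sup>2 / 17 ^ n) \<le> ennreal (1/49) * ?I x"
          by (rule mult_left_mono) simp
        then show ?thesis using True by (simp add: ennreal_mult[symmetric])
      qed simp
    qed
    also have "\<dots> = ennreal (1/49) * ?I x * of_nat (card {w \<in> words n. x \<in> piece w})"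
      unfolding sum_distrib_left[symmetric]
      by (simp add: indicator_def sum.If_cases Int_def)
    also have "\<dots> \<le> ennreal (1/49) * ?I x * ennreal 49"
    proof (rule mult_left_mono)
      show "of_nat (card {w \<in> words n. x \<in> piece w}) \<le> ennreal 49"
        using of_nat_mono[OF card_cells_containing[of n x], where 'a=ennreal] by simp
    qed simp
    also have "\<dots> = ?I x"
      by (simp add: mult.commute[of _ "ennreal 49"] mult.assoc[symmetric] ennreal_mult[symmetric] del: ennreal_numeral)
    finally show "(\<Sum>w\<in>words n. ennreal ((avg u w - u x)\<^sup>2 / (49 * 17 ^ n)) * indicator (piece w) x) \<le> ?I x" .
  qed
  finally have *: "ennreal (1 / (49 * 17 ^ n)) * (\<Sum>w\<in>words n. variation u w)
      \<le> double_integral u r" .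
  have "ennreal (49 * 17 ^ n) * ennreal (1 / (49 * 17 ^ n)) = 1"
    by (subst ennreal_mult[symmetric]) simp_all
  then show ?thesis using mult_left_mono[OF *, of "ennreal (49 * 17 ^ n)"]
    by (simp add: mult.assoc[symmetric])
qed

text \<open>Replacing first \<open>u y\<close> by its average over the second cell and then \<open>u x\<close> by its average over the first
  one does not increase the mean of \<open>(u x - u y)\<^sup>2\<close>.\<close>

lemma avg_difference_le:
  assumes u: "u \<in> L2_space mu" and v: "v \<in> words n" and w: "w \<in> words n"
    and d: "\<And>x y. x \<in> piece v \<Longrightarrow> y \<in> piece w \<Longrightarrow> dist x y < r"
  shows "ennreal ((avg u v - avg u w)\<^sup>2 / (17 ^ n * 17 ^ n)) \<le> double_integral u r"
proof -
  note [measurable] = L2_integrable(1)[OF u]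
  have [measurable]: "piece v \<in> sets mu" by (rule word_cell_sets[OF v])
  have "ennreal ((avg u v - avg u w)\<^sup>2 / (17 ^ n * 17 ^ n)) = ennreal (1 / 17 ^ n) * ennreal ((avg u v - avg u w)\<^sup>2 / 17 ^ n)"
    by (simp add: ennreal_mult[symmetric])
  also have "\<dots> \<le> ennreal (1 / 17 ^ n) * (\<integral>\<^sup>+x\<in>piece v. ennreal ((u x - avg u w)\<^sup>2) \<partial>mu)"
    by (intro mult_left_mono avg_deviation[OF u v]) simp
  also have "\<dots> = (\<integral>\<^sup>+x. ennreal (1 / 17 ^ n) * (ennreal ((u x - avg u w)\<^sup>2) * indicator (piece v) x) \<partial>mu)"
    by (intro nn_integral_cmult[symmetric]) measurable
  also have "\<dots> = (\<integral>\<^sup>+x. ennreal ((avg u w - u x)\<^sup>2 / 17 ^ n) * indicator (piece v) x \<partial>mu)"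
    by (intro nn_integral_cong) (simp add: mult.assoc[symmetric] ennreal_mult[symmetric] power2_commute)
  also have "\<dots> \<le> double_integral u r"
    unfolding double_integral_def
  proof (rule nn_integral_mono)
    fix x
    show "ennreal ((avg u w - u x)\<^sup>2 / 17 ^ n) * indicator (piece v) x
        \<le> (\<integral>\<^sup>+y\<in>ball x r. ennreal (\<bar>u x - u y\<bar>\<^sup>2) \<partial>mu)"
    proof (cases "x \<in> piece v")
      case True
      have "ennreal ((avg u w - u x)\<^sup>2 / 17 ^ n) \<le> (\<integral>\<^sup>+y\<in>piece w. ennreal ((u y - u x)\<^sup>2) \<partial>mu)"
        by (rule avg_deviation[OF u w])
      also have "\<dots> \<le> (\<integral>\<^sup>+y\<in>ball x r. ennreal (\<bar>u x - u y\<bar>\<^sup>2) \<partial>mu)"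
        using d[OF True] by (intro nn_integral_mono) (auto simp: power2_commute split: split_indicator)
      finally show ?thesis using True by simp
    qed simp
  qed
  finally show ?thesis .
qed

text \<open>This is \<open>7 powr (\<alpha> - 2 * \<sigma>)\<close>, as \<open>289 = 7 powr (2 * \<alpha>)\<close>. For \<open>u\<close> in the Besov space of exponent \<open>\<sigma>\<close>,
  sums over the cells of level \<open>n\<close> of squared differences of averages decay like its \<open>n\<close>-th power.\<close>

definition decay_rate :: "real \<Rightarrow> real" where
  "decay_rate \<sigma> = 289 / 7 powr (\<alpha> + 2 * \<sigma>)"

lemma decay_rate_pos: "0 < decay_rate \<sigma>"
  by (simp add: decay_rate_def)

lemma radius_powr: "(3 / 7 ^ n) powr (\<alpha> + 2 * \<sigma>) = 3 powr (\<alpha> + 2 * \<sigma>) * (decay_rate \<sigma> / 289) ^ n"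
proof -
  have "(7 ^ n) powr (\<alpha> + 2 * \<sigma>) = (7 powr (\<alpha> + 2 * \<sigma>)) ^ n"
    by (simp add: powr_realpow[symmetric] powr_powr mult.commute)
  moreover have "decay_rate \<sigma> / 289 = 1 / 7 powr (\<alpha> + 2 * \<sigma>)" by (simp add: decay_rate_def)
  ultimately show ?thesis by (simp add: powr_divide power_one_over)
qed

lemma square_17: "(17::real) ^ n * 17 ^ n = 289 ^ n"
  by (simp flip: power_mult_distrib)

text \<open>Two cells of level \<open>n\<close> with a common point lie in the ball of radius \<open>3 / 7 ^ n\<close> around each of their
  points. This radius is admissible in the seminorm if \<open>n \<ge> 1\<close>.\<close>

lemma avg_neighbours:
  assumes u: "u \<in> besov_space \<alpha> K \<sigma>"
  obtains C where "0 \<le> C" "\<forall>n\<ge>1. \<forall>v\<in>words n. \<forall>w\<in>words n. piece v \<inter> piece w \<noteq> {} \<longrightarrow>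
    (avg u v - avg u w)\<^sup>2 \<le> C * decay_rate \<sigma> ^ n"
proof -
  obtain D where D: "0 \<le> D" "\<forall>r\<in>{0<..<1}. double_integral u r \<le> ennreal (D * r powr (\<alpha> + 2 * \<sigma>))"
    by (rule besov_bound[OF u])
  have L2: "u \<in> L2_space mu" using u by (simp add: besov_space_def)
  have "(avg u v - avg u w)\<^sup>2 \<le> D * 3 powr (\<alpha> + 2 * \<sigma>) * decay_rate \<sigma> ^ n"
    if n: "n \<ge> 1" and vw: "v \<in> words n" "w \<in> words n" "piece v \<inter> piece w \<noteq> {}" for n v w
  proof -
    have r: "3 / 7 ^ n \<in> {0<..<1::real}"
      using power_increasing[OF n, of "7::real"] by simp
    obtain p where p: "p \<in> piece v" "p \<in> piece w" using vw(3) by blast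
    have "dist x y < 3 / 7 ^ n" if "x \<in> piece v" "y \<in> piece w" for x y
    proof -
      have "dist x p \<le> 1 / 7 ^ n" "dist p y \<le> 1 / 7 ^ n"
        using cell_dist_le[OF vw(1) that(1) p(1)] cell_dist_le[OF vw(2) p(2) that(2)] by auto
      moreover have "1 / 7 ^ n + 1 / 7 ^ n < 3 / (7::real) ^ n" by (simp add: field_simps)
      ultimately show ?thesis using dist_triangle[of x y p] by linarith
    qed
    then have "ennreal ((avg u v - avg u w)\<^sup>2 / (17 ^ n * 17 ^ n)) \<le> double_integral u (3 / 7 ^ n)"
      by (intro avg_difference_le[OF L2 vw(1,2)])
    also have "\<dots> \<le> ennreal (D * (3 / 7 ^ n) powr (\<alpha> + 2 * \<sigma>))" by (rule D(2)[rule_format, OF r])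
    finally have "ennreal ((avg u v - avg u w)\<^sup>2 / (17 ^ n * 17 ^ n)) \<le> ennreal (D * (3 / 7 ^ n) powr (\<alpha> + 2 * \<sigma>))" .
    then have "(avg u v - avg u w)\<^sup>2 / 289 ^ n \<le> D * (3 powr (\<alpha> + 2 * \<sigma>) * (decay_rate \<sigma> / 289) ^ n)"
      using D(1) decay_rate_pos[of \<sigma>] unfolding radius_powr square_17 by (subst (asm) ennreal_le_iff) auto
    then show ?thesis by (simp add: power_divide field_simps)
  qed
  then show ?thesis using that[of "D * 3 powr (\<alpha> + 2 * \<sigma>)"] D(1) by simp
qed

lemma variance_sum_decay:
  assumes u: "u \<in> besov_space \<alpha> K \<sigma>"
  obtains C where "0 \<le> C" "\<forall>n\<ge>1. (\<Sum>w\<in>words n. variation u w)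
    \<le> ennreal (C * decay_rate \<sigma> ^ n / 17 ^ n)"
proof -
  obtain D where D: "0 \<le> D" "\<forall>r\<in>{0<..<1}. double_integral u r \<le> ennreal (D * r powr (\<alpha> + 2 * \<sigma>))"
    by (rule besov_bound[OF u])
  have L2: "u \<in> L2_space mu" using u by (simp add: besov_space_def)
  have "(\<Sum>w\<in>words n. variation u w)
      \<le> ennreal (49 * D * 3 powr (\<alpha> + 2 * \<sigma>) * decay_rate \<sigma> ^ n / 17 ^ n)" if n: "n \<ge> 1" for n
  proof -
    have r: "3 / 7 ^ n \<in> {0<..<1::real}"
      using power_increasing[OF n, of "7::real"] by simp
    have "(\<Sum>w\<in>words n. variation u w)
        \<le> ennreal (49 * 17 ^ n) * double_integral u (3 / 7 ^ n)"
      by (rule variance_sum_le[OF L2]) (simp add: divide_strict_right_mono)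
    also have "\<dots> \<le> ennreal (49 * 17 ^ n) * ennreal (D * (3 / 7 ^ n) powr (\<alpha> + 2 * \<sigma>))"
      using D(2) r by (intro mult_left_mono) auto
    also have "\<dots> = ennreal (49 * 17 ^ n * (D * (3 powr (\<alpha> + 2 * \<sigma>) * (decay_rate \<sigma> / 289) ^ n)))"
      unfolding radius_powr using D(1) decay_rate_pos[of \<sigma>] by (subst ennreal_mult[symmetric]) auto
    also have "49 * 17 ^ n * (D * (3 powr (\<alpha> + 2 * \<sigma>) * (decay_rate \<sigma> / 289) ^ n)) =
        49 * D * 3 powr (\<alpha> + 2 * \<sigma>) * decay_rate \<sigma> ^ n / 17 ^ n"
      by (simp add: power_divide square_17[symmetric])
    finally show ?thesis .
  qed
  then show ?thesis using that[of "49 * D * 3 powr (\<alpha> + 2 * \<sigma>)"] D(1) by simp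
qed

lemma avg_child_sum:
  assumes u: "u \<in> besov_space \<alpha> K \<sigma>"
  obtains C where "0 \<le> C" "\<forall>n. \<forall>i\<in>S. (\<Sum>w\<in>words n. (avg u (w @ [i]) - avg u w)\<^sup>2) \<le> C * decay_rate \<sigma> ^ n"
proof -
  obtain C where C: "0 \<le> C" "\<forall>n\<ge>1. (\<Sum>w\<in>words n. variation u w)
    \<le> ennreal (C * decay_rate \<sigma> ^ n / 17 ^ n)" by (rule variance_sum_decay[OF u])
  have L2: "u \<in> L2_space mu" using u by (simp add: besov_space_def)
  define M where "M = (\<Sum>i\<in>S. (avg u [i] - avg u [])\<^sup>2)"
  have "(\<Sum>w\<in>words n. (avg u (w @ [i]) - avg u w)\<^sup>2) \<le> (17 * C + M) * decay_rate \<sigma> ^ n" if i: "i \<in> S" for n i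
  proof (cases "n = 0")
    case True
    have "(avg u [i] - avg u [])\<^sup>2 \<le> M" unfolding M_def using i finite_S by (intro member_le_sum) auto
    then show ?thesis using True C(1) by simp
  next
    case False
    have "ennreal (\<Sum>w\<in>words n. (avg u (w @ [i]) - avg u w)\<^sup>2 / 17 ^ Suc n) =
        (\<Sum>w\<in>words n. ennreal ((avg u (w @ [i]) - avg u w)\<^sup>2 / 17 ^ Suc n))"
      by (simp add: sum_ennreal)
    also have "\<dots> \<le> (\<Sum>w\<in>words n. variation u w)"
    proof (rule sum_mono)
      fix w assume w: "w \<in> words n"
      have "ennreal ((avg u (w @ [i]) - avg u w)\<^sup>2 / 17 ^ Suc n) \<le>
          (\<integral>\<^sup>+x\<in>piece (w @ [i]). ennreal ((u x - avg u w)\<^sup>2) \<partial>mu)"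
        by (rule avg_deviation[OF L2 words_snoc[OF w i]])
      also have "\<dots> \<le> variation u w"
      proof (rule nn_integral_mono)
        fix x
        have "piece (w @ [i]) \<subseteq> piece w" using cell_map_in_K[OF i] by auto
        then show "ennreal ((u x - avg u w)\<^sup>2) * indicator (piece (w @ [i])) x \<le>
            ennreal ((u x - avg u w)\<^sup>2) * indicator (piece w) x"
          by (auto split: split_indicator)
      qed
      finally show "ennreal ((avg u (w @ [i]) - avg u w)\<^sup>2 / 17 ^ Suc n) \<le>
          variation u w" .
    qed
    also have "\<dots> \<le> ennreal (C * decay_rate \<sigma> ^ n / 17 ^ n)" using C(2) False by simp
    finally have "(\<Sum>w\<in>words n. (avg u (w @ [i]) - avg u w)\<^sup>2 / 17 ^ Suc n) \<le> C * decay_rate \<sigma> ^ n / 17 ^ n"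
      using C(1) decay_rate_pos[of \<sigma>] by (subst (asm) ennreal_le_iff) auto
    then have "(\<Sum>w\<in>words n. (avg u (w @ [i]) - avg u w)\<^sup>2) \<le> 17 * C * decay_rate \<sigma> ^ n"
      unfolding sum_divide_distrib[symmetric] by (simp add: field_simps)
    also have "\<dots> \<le> (17 * C + M) * decay_rate \<sigma> ^ n"
      using decay_rate_pos[of \<sigma>] by (intro mult_right_mono) (auto simp: M_def sum_nonneg)
    finally show ?thesis .
  qed
  moreover have "0 \<le> 17 * C + M" using C(1) by (simp add: M_def sum_nonneg)
  ultimately show ?thesis using that by blast
qed

section \<open>Vertex values of Besov functions\<close>

text \<open>The elements of the Besov space are functions up to null sets. Their values at the vertices are
  recovered as limits of averages over the cells shrinking to a vertex.\<close>

definition vertex_avg :: "(plane \<Rightarrow> real) \<Rightarrow> nat \<times> nat \<Rightarrow> (nat \<times> nat) list \<Rightarrow> nat \<Rightarrow> real" where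
  "vertex_avg u a w m = avg u (w @ replicate m (corner_cell a))"

definition vertex_value :: "(plane \<Rightarrow> real) \<Rightarrow> nat \<times> nat \<Rightarrow> (nat \<times> nat) list \<Rightarrow> real" where
  "vertex_value u a w = lim (vertex_avg u a w)"

text \<open>Along the cells shrinking to a vertex the differences of consecutive averages are bounded by a geometric
  sequence, even in the Euclidean norm over all words of fixed length.\<close>

lemma vertex_value_decay:
  assumes u: "u \<in> besov_space \<alpha> K \<sigma>" and rate: "decay_rate \<sigma> < 1"
  obtains C where "0 \<le> C"
    "\<forall>n. \<forall>a\<in>corners. (\<Sum>w\<in>words n. (vertex_value u a w - avg u w)\<^sup>2) \<le> C * decay_rate \<sigma> ^ n"
    "\<forall>n. \<forall>a\<in>corners. \<forall>w\<in>words n. vertex_avg u a w \<longlonglongrightarrow> vertex_value u a w"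
proof -
  obtain C where C: "0 \<le> C" "\<forall>n. \<forall>i\<in>S. (\<Sum>w\<in>words n. (avg u (w @ [i]) - avg u w)\<^sup>2) \<le> C * decay_rate \<sigma> ^ n"
    by (rule avg_child_sum[OF u])
  define t where "t = sqrt (decay_rate \<sigma>)"
  have t: "0 < t" "t < 1" using decay_rate_pos rate by (simp_all add: t_def)
  have t_power: "sqrt (C * decay_rate \<sigma> ^ n) = sqrt C * t ^ n" for n
    by (simp add: t_def real_sqrt_mult real_sqrt_power)
  have step: "L2_set (\<lambda>w. vertex_avg u a w (Suc m) - vertex_avg u a w m) (words n) \<le> sqrt C * t ^ (n + m)"
    if a: "a \<in> corners" for a m n
  proof -
    let ?i = "corner_cell a"
    have inj: "inj_on (\<lambda>w. w @ replicate m ?i) (words n)" by (auto simp: inj_on_def)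
    have "(\<Sum>w\<in>words n. (vertex_avg u a w (Suc m) - vertex_avg u a w m)\<^sup>2) =
        (\<Sum>v\<in>(\<lambda>w. w @ replicate m ?i) ` words n. (avg u (v @ [?i]) - avg u v)\<^sup>2)"
      unfolding sum.reindex[OF inj] vertex_avg_def by (simp add: replicate_append_same)
    also have "\<dots> \<le> (\<Sum>v\<in>words (n + m). (avg u (v @ [?i]) - avg u v)\<^sup>2)"
      using words_append words_replicate[OF corner_cell_in_S[OF a]] by (intro sum_mono2) auto
    also have "\<dots> \<le> C * decay_rate \<sigma> ^ (n + m)" using C(2) corner_cell_in_S[OF a] by blast
    finally show ?thesis unfolding t_power[symmetric] L2_set_def by (rule real_sqrt_le_mono)
  qed
  have geo: "(\<Sum>k<m. t ^ k) \<le> 1 / (1 - t)" for m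
    using t sum_gp_strict[of t m] by (simp add: divide_right_mono)
  have total: "L2_set (\<lambda>w. vertex_avg u a w m - avg u w) (words n) \<le> sqrt C / (1 - t) * t ^ n"
    if a: "a \<in> corners" for a m n
  proof -
    have "L2_set (\<lambda>w. vertex_avg u a w m - avg u w) (words n) \<le> sqrt C * t ^ n * (\<Sum>k<m. t ^ k)"
    proof (induction m)
      case 0
      show ?case by (simp add: vertex_avg_def L2_set_def)
    next
      case (Suc m)
      have "L2_set (\<lambda>w. vertex_avg u a w (Suc m) - avg u w) (words n) =
          L2_set (\<lambda>w. (vertex_avg u a w (Suc m) - vertex_avg u a w m) + (vertex_avg u a w m - avg u w)) (words n)"
        by simp
      also have "\<dots> \<le> sqrt C * t ^ (n + m) + sqrt C * t ^ n * (\<Sum>k<m. t ^ k)"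
        by (intro order_trans[OF L2_set_triangle_ineq] add_mono step[OF a] Suc)
      finally show ?case by (simp add: algebra_simps power_add)
    qed
    also have "\<dots> \<le> sqrt C * t ^ n * (1 / (1 - t))"
      using geo C(1) t by (intro mult_left_mono) auto
    finally show ?thesis by simp
  qed
  have conv: "vertex_avg u a w \<longlonglongrightarrow> vertex_value u a w" if a: "a \<in> corners" and w: "w \<in> words n" for a w n
  proof -
    have "\<bar>vertex_avg u a w (Suc m) - vertex_avg u a w m\<bar> \<le> sqrt C * t ^ n * t ^ m" for m
    proof -
      have "\<bar>vertex_avg u a w (Suc m) - vertex_avg u a w m\<bar> \<le>
          L2_set (\<lambda>w. vertex_avg u a w (Suc m) - vertex_avg u a w m) (words n)"
        unfolding L2_set_def using w
        by (intro real_le_rsqrt) (auto intro!: member_le_sum[of w "words n" "\<lambda>w. (vertex_avg u a w (Suc m) - vertex_avg u a w m)\<^sup>2"])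
      then show ?thesis using step[OF a, of m n] by (simp add: power_add)
    qed
    note le = this
    have geometric: "summable (\<lambda>m. sqrt C * t ^ n * t ^ m)"
      using t by (intro summable_mult summable_geometric) auto
    have "summable (\<lambda>m. vertex_avg u a w (Suc m) - vertex_avg u a w m)"
      by (rule summable_comparison_test'[OF geometric]) (simp add: le)
    then have "convergent (\<lambda>m. vertex_avg u a w m - vertex_avg u a w 0)"
      unfolding summable_iff_convergent sum_lessThan_telescope .
    then have "convergent (vertex_avg u a w)"
      using convergent_add[OF _ convergent_const, of "\<lambda>m. vertex_avg u a w m - vertex_avg u a w 0" "vertex_avg u a w 0"]
      by simp
    then show ?thesis unfolding vertex_value_def by (simp add: convergent_LIMSEQ_iff)
  qed
  have "(\<Sum>w\<in>words n. (vertex_value u a w - avg u w)\<^sup>2) \<le> C / (1 - t)\<^sup>2 * decay_rate \<sigma> ^ n" if a: "a \<in> corners" for a n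
  proof (rule LIMSEQ_le_const2)
    show "(\<lambda>m. \<Sum>w\<in>words n. (vertex_avg u a w m - avg u w)\<^sup>2) \<longlonglongrightarrow> (\<Sum>w\<in>words n. (vertex_value u a w - avg u w)\<^sup>2)"
      by (intro tendsto_sum tendsto_power tendsto_diff conv[OF a] tendsto_const)
    have "(\<Sum>w\<in>words n. (vertex_avg u a w m - avg u w)\<^sup>2) \<le> C / (1 - t)\<^sup>2 * decay_rate \<sigma> ^ n" for m
    proof -
      have "(L2_set (\<lambda>w. vertex_avg u a w m - avg u w) (words n))\<^sup>2 \<le> (sqrt C / (1 - t) * t ^ n)\<^sup>2"
        by (intro power_mono total[OF a] L2_set_nonneg)
      also have "\<dots> = C / (1 - t)\<^sup>2 * (t\<^sup>2) ^ n"
        using C(1) by (simp add: power_mult_distrib power_divide flip: power_mult) (simp add: mult.commute)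
      also have "t\<^sup>2 = decay_rate \<sigma>" using decay_rate_pos[of \<sigma>] by (simp add: t_def)
      finally show ?thesis by (simp add: L2_set_def sum_nonneg)
    qed
    then show "\<exists>N. \<forall>m\<ge>N. (\<Sum>w\<in>words n. (vertex_avg u a w m - avg u w)\<^sup>2) \<le> C / (1 - t)\<^sup>2 * decay_rate \<sigma> ^ n" by blast
  qed
  then show ?thesis using that[of "C / (1 - t)\<^sup>2"] C(1) conv by simp
qed

end

context ifs17
begin

text \<open>If a vertex belongs to two cells, then the small cells shrinking to it inside both are neighbours on
  each level, and the difference of their averages tends to zero.\<close>

lemma vertex_value_common:
  assumes u: "u \<in> besov_space \<alpha> K \<sigma>" and rate: "decay_rate \<sigma> < 1"
    and w: "w \<in> words n" and ij: "i \<in> S" "j \<in> S" and ab: "a \<in> corners" "b \<in> corners" and eq: "a + i = b + j"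
  shows "vertex_value u a (w @ [i]) = vertex_value u b (w @ [j])"
proof -
  obtain C where C: "0 \<le> C" "\<forall>n\<ge>1. \<forall>v\<in>words n. \<forall>w\<in>words n. piece v \<inter> piece w \<noteq> {} \<longrightarrow>
    (avg u v - avg u w)\<^sup>2 \<le> C * decay_rate \<sigma> ^ n" by (rule avg_neighbours[OF u])
  obtain C' where lim: "\<forall>n. \<forall>a\<in>corners. \<forall>w\<in>words n. vertex_avg u a w \<longlonglongrightarrow> vertex_value u a w"
    by (rule vertex_value_decay[OF u rate])
  let ?d = "\<lambda>m. vertex_avg u a (w @ [i]) m - vertex_avg u b (w @ [j]) m"
  have le: "(?d m)\<^sup>2 \<le> C * decay_rate \<sigma> ^ (Suc n + m)" for m
  proof -
    let ?v = "(w @ [i]) @ replicate m (corner_cell a)" and ?w = "(w @ [j]) @ replicate m (corner_cell b)"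
    have vw: "?v \<in> words (Suc n + m)" "?w \<in> words (Suc n + m)"
      by (rule words_append[OF words_snoc[OF w ij(1)] words_replicate[OF corner_cell_in_S[OF ab(1)]]],
          rule words_append[OF words_snoc[OF w ij(2)] words_replicate[OF corner_cell_in_S[OF ab(2)]]])
    have "word_map ?v (lattice_pt a) = word_map w (cell_map i (lattice_pt a))"
      by (simp add: word_map_corner)
    also have "cell_map i (lattice_pt a) = cell_map j (lattice_pt b)"
      using eq by (simp add: cell_map_lattice_eq_iff)
    also have "word_map w (cell_map j (lattice_pt b)) = word_map ?w (lattice_pt b)"
      by (simp add: word_map_corner)
    finally have "piece ?v \<inter> piece ?w \<noteq> {}"
      using imageI[OF corner_in_K[OF ab(1)], of "word_map ?v"] imageI[OF corner_in_K[OF ab(2)], of "word_map ?w"] by auto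
    then show ?thesis unfolding vertex_avg_def using C(2) vw by (metis le_add1 plus_1_eq_Suc trans_le_add1)
  qed
  have "(\<lambda>m. (?d m)\<^sup>2) \<longlonglongrightarrow> (vertex_value u a (w @ [i]) - vertex_value u b (w @ [j]))\<^sup>2"
    using lim ab words_snoc[OF w ij(1)] words_snoc[OF w ij(2)]
    by (intro tendsto_power tendsto_diff) blast+
  moreover have "(\<lambda>m. (?d m)\<^sup>2) \<longlonglongrightarrow> 0"
  proof (rule tendsto_sandwich[of "\<lambda>_. 0"])
    show "(\<lambda>m. C * decay_rate \<sigma> ^ Suc n * decay_rate \<sigma> ^ m) \<longlonglongrightarrow> 0"
      using LIMSEQ_realpow_zero[of "decay_rate \<sigma>"] decay_rate_pos[of \<sigma>] rate
      by (intro tendsto_mult_right_zero) simp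
    show "\<forall>\<^sub>F m in sequentially. (?d m)\<^sup>2 \<le> C * decay_rate \<sigma> ^ Suc n * decay_rate \<sigma> ^ m"
      using le by (intro always_eventually) (simp add: power_add mult.assoc)
  qed auto
  ultimately have "(vertex_value u a (w @ [i]) - vertex_value u b (w @ [j]))\<^sup>2 = 0"
    by (rule LIMSEQ_unique)
  then show ?thesis by simp
qed

lemma vertex_value_corner:
  assumes u: "u \<in> besov_space \<alpha> K \<sigma>" and rate: "decay_rate \<sigma> < 1"
    and w: "w \<in> words n" and a: "a \<in> corners"
  shows "vertex_value u a (w @ [corner_cell a]) = vertex_value u a w"
proof -
  obtain C' where lim: "\<forall>n. \<forall>a\<in>corners. \<forall>w\<in>words n. vertex_avg u a w \<longlonglongrightarrow> vertex_value u a w"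
    by (rule vertex_value_decay[OF u rate])
  have "vertex_avg u a (w @ [corner_cell a]) = (\<lambda>m. vertex_avg u a w (Suc m))"
    by (simp add: vertex_avg_def fun_eq_iff)
  moreover have "(\<lambda>m. vertex_avg u a w (Suc m)) \<longlonglongrightarrow> vertex_value u a w"
    using lim a w by (intro LIMSEQ_Suc) blast
  moreover have "vertex_avg u a (w @ [corner_cell a]) \<longlonglongrightarrow> vertex_value u a (w @ [corner_cell a])"
    using lim a words_snoc[OF w corner_cell_in_S[OF a]] by blast
  ultimately show ?thesis using LIMSEQ_unique by metis
qed

text \<open>Both vertex values are close to the average over the whole cell.\<close>

lemma vertex_difference_decay:
  assumes u: "u \<in> besov_space \<alpha> K \<sigma>" and rate: "decay_rate \<sigma> < 1" and ab: "a \<in> corners" "b \<in> corners"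
  obtains C where "\<forall>n. (\<Sum>w\<in>words n. (vertex_value u a w - vertex_value u b w)\<^sup>2) \<le> C * decay_rate \<sigma> ^ n"
proof -
  obtain C where C: "0 \<le> C"
    "\<forall>n. \<forall>a\<in>corners. (\<Sum>w\<in>words n. (vertex_value u a w - avg u w)\<^sup>2) \<le> C * decay_rate \<sigma> ^ n"
    by (rule vertex_value_decay[OF u rate])
  have "(\<Sum>w\<in>words n. (vertex_value u a w - vertex_value u b w)\<^sup>2) \<le> 4 * C * decay_rate \<sigma> ^ n" for n
  proof -
    have "(x - y)\<^sup>2 \<le> 2 * (x - z)\<^sup>2 + 2 * (y - z)\<^sup>2" for x y z :: real
      using zero_le_power2[of "(x - z) + (y - z)"] by (simp add: power2_eq_square algebra_simps)
    then have "(\<Sum>w\<in>words n. (vertex_value u a w - vertex_value u b w)\<^sup>2) \<le>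
        (\<Sum>w\<in>words n. 2 * (vertex_value u a w - avg u w)\<^sup>2 + 2 * (vertex_value u b w - avg u w)\<^sup>2)"
      by (rule sum_mono)
    also have "\<dots> = 2 * (\<Sum>w\<in>words n. (vertex_value u a w - avg u w)\<^sup>2) + 2 * (\<Sum>w\<in>words n. (vertex_value u b w - avg u w)\<^sup>2)"
      by (simp add: sum.distrib sum_distrib_left)
    also have "\<dots> \<le> 2 * (C * decay_rate \<sigma> ^ n) + 2 * (C * decay_rate \<sigma> ^ n)"
      using C(2) ab by (intro add_mono mult_left_mono) auto
    finally show ?thesis by simp
  qed
  then show ?thesis using that by blast
qed

text \<open>An energy that is at most \<open>\<kappa>\<close> times its refinement cannot decay faster than the powers of \<open>1 / \<kappa>\<close> unless
  it vanishes.\<close>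

lemma energy_vanishes:
  assumes step: "\<And>n w. w \<in> words n \<Longrightarrow> (D w)\<^sup>2 \<le> \<kappa> * (\<Sum>i\<in>S. (D (w @ [i]))\<^sup>2)"
    and decay: "\<forall>n. (\<Sum>w\<in>words n. (D w)\<^sup>2) \<le> C * \<theta> ^ n"
    and k: "0 < \<kappa>" "0 < \<theta>" "\<kappa> * \<theta> < 1" and w: "w \<in> words n"
  shows "D w = (0::real)"
proof -
  define E where "E n = (\<Sum>w\<in>words n. (D w)\<^sup>2)" for n
  have "E n \<le> \<kappa> * E (Suc n)" for n
    unfolding E_def sum_words_snoc sum_distrib_left[of \<kappa> _ "words n"] by (rule sum_mono) (rule step)
  then have "E n \<le> \<kappa> ^ m * E (n + m)" for m
  proof (induction m)
    case (Suc m)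
    have "\<kappa> ^ m * E (n + m) \<le> \<kappa> ^ m * (\<kappa> * E (Suc (n + m)))"
      using Suc.prems k(1) by (intro mult_left_mono) auto
    then show ?case using Suc.IH[OF Suc.prems] by (simp add: mult_ac)
  qed simp
  moreover have "\<kappa> ^ m * E (n + m) \<le> C * \<theta> ^ n * (\<kappa> * \<theta>) ^ m" for m
  proof -
    have "\<kappa> ^ m * E (n + m) \<le> \<kappa> ^ m * (C * \<theta> ^ (n + m))"
      unfolding E_def using decay k(1) by (intro mult_left_mono) auto
    then show ?thesis by (simp add: power_add power_mult_distrib mult_ac)
  qed
  ultimately have le: "E n \<le> C * \<theta> ^ n * (\<kappa> * \<theta>) ^ m" for m by (rule order_trans)
  have "(\<lambda>m. C * \<theta> ^ n * (\<kappa> * \<theta>) ^ m) \<longlonglongrightarrow> 0"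
    using k by (intro tendsto_mult_right_zero LIMSEQ_realpow_zero) auto
  then have "E n \<le> 0" using le by (intro LIMSEQ_le_const) auto
  moreover have "(D w)\<^sup>2 \<le> E n" unfolding E_def using w by (intro member_le_sum) auto
  ultimately have "(D w)\<^sup>2 \<le> 0" by linarith
  then show ?thesis by simp
qed

end

context sickle
begin

section \<open>Upper bounds for the critical exponents\<close>

lemma column_in_S: "j \<le> 6 \<Longrightarrow> (0, j) \<in> S"
proof -
  assume "j \<le> 6"
  then have "(0, j) \<in> {(0,0), (0,1), (0,2), (0,3), (0,4), (0,5), (0,6)}" by auto
  then have "(0, j) \<in> {i \<in> S. fst i = 0}" unfolding column .
  then show "(0, j) \<in> S" by simp
qed

text \<open>The segment from \<open>p1\<close> to \<open>p3\<close> is a series of seven copies of itself, so a difference between its end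
  points has at least a seventh of its square as energy on the next level.\<close>

lemma segment_constant:
  assumes u: "u \<in> besov_space \<alpha> K \<sigma>" and rate: "7 * decay_rate \<sigma> < 1" and w: "w \<in> words n"
  shows "vertex_value u (0,1) w = vertex_value u (0,0) w"
proof -
  have rate1: "decay_rate \<sigma> < 1" using rate decay_rate_pos[of \<sigma>] by linarith
  define D where "D w = vertex_value u (0,1) w - vertex_value u (0,0) w" for w
  obtain C where C: "\<forall>n. (\<Sum>w\<in>words n. (D w)\<^sup>2) \<le> C * decay_rate \<sigma> ^ n"
    unfolding D_def by (rule vertex_difference_decay[OF u rate1, of "(0,1)" "(0,0)"]) (auto simp: corners_def)
  have "(D w)\<^sup>2 \<le> 7 * (\<Sum>i\<in>S. (D (w @ [i]))\<^sup>2)" if w: "w \<in> words n" for w n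
  proof -
    let ?V = "\<lambda>j. vertex_value u (0,0) (w @ [(0, j)])"
    have top: "vertex_value u (0,1) (w @ [(0, j)]) = ?V (Suc j)" if "j < 6" for j
      using that by (intro vertex_value_common[OF u rate1 w]) (auto simp: corners_def column_in_S)
    have last: "vertex_value u (0,1) (w @ [(0, 6)]) = vertex_value u (0,1) w"
      using vertex_value_corner[OF u rate1 w, of "(0,1)"] by (simp add: corners_def corner_cell_def)
    have first: "?V 0 = vertex_value u (0,0) w"
      using vertex_value_corner[OF u rate1 w, of "(0,0)"] by (simp add: corners_def corner_cell_def)
    have "D w = (\<Sum>j<7. D (w @ [(0, j)]))"
      using top[of 0] top[of 1] top[of 2] top[of 3] top[of 4] top[of 5] last first
      by (simp add: D_def eval_nat_numeral)
    then have "(D w)\<^sup>2 \<le> 7 * (\<Sum>j<7. (D (w @ [(0, j)]))\<^sup>2)"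
      using sum_squared_le_sum_of_squares[of "\<lambda>j. D (w @ [(0, j)])" "{..<7::nat}"] by simp
    also have "(\<Sum>j<7. (D (w @ [(0, j)]))\<^sup>2) = (\<Sum>i\<in>(\<lambda>j. (0, j)) ` {..<7::nat}. (D (w @ [i]))\<^sup>2)"
      by (subst sum.reindex) (auto simp: inj_on_def)
    also have "\<dots> \<le> (\<Sum>i\<in>S. (D (w @ [i]))\<^sup>2)"
      using finite_S column_in_S by (intro sum_mono2) auto
    finally show ?thesis by simp
  qed
  note step = this
  have "D w = 0"
    by (rule energy_vanishes[OF step C _ decay_rate_pos rate w]) simp_all
  then show ?thesis by (simp add: D_def)
qed

text \<open>Titu's inequality for three resistors \<open>1/2\<close>, \<open>1\<close> and \<open>7\<close> in series: the two parallel cells of the top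
  triangle, its third cell, and the seven active cells of the right arc.\<close>

lemma resistor_inequality:
  fixes x y s :: real
  shows "(x + y + s)\<^sup>2 \<le> 17/2 * (2 * x\<^sup>2 + y\<^sup>2 + s\<^sup>2 / 7)"
proof -
  have "17/2 * (2 * x\<^sup>2 + y\<^sup>2 + s\<^sup>2 / 7) - (x + y + s)\<^sup>2 =
      2 * (x - y / 2)\<^sup>2 + 2/7 * (7 * x - s / 2)\<^sup>2 + 1/7 * (7 * y - s)\<^sup>2"
    by (simp add: power2_eq_square field_simps)
  moreover have "0 \<le> 2 * (x - y / 2)\<^sup>2 + 2/7 * (7 * x - s / 2)\<^sup>2 + 1/7 * (7 * y - s)\<^sup>2" by simp
  ultimately show ?thesis by linarith
qed

text \<open>When the two ends of every copy of the segment from \<open>p1\<close> to \<open>p3\<close> carry the same value, the cells of the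
  left side are short circuits. There remains a series circuit from \<open>p1\<close> to \<open>p2\<close>: the two parallel cells
  \<open>(0,5)\<close>, \<open>(0,6)\<close>, the cell \<open>(1,5)\<close>, and the right arc, where \<open>H k\<close> is the value at \<open>z k\<close>.\<close>

lemma vertex_values_in_cell:
  assumes u: "u \<in> besov_space \<alpha> K \<sigma>" and rate: "7 * decay_rate \<sigma> < 1" and w: "w \<in> words n"
  defines "A \<equiv> vertex_value u (0,0)" and "D \<equiv> \<lambda>w. vertex_value u (1,0) w - vertex_value u (0,0) w"
  obtains H where
    "\<forall>j\<le>6. A (w @ [(0, j)]) = A w"
    "A (w @ [(1,5)]) = A w + D (w @ [(0,5)])" "D (w @ [(0,6)]) = D (w @ [(0,5)])"
    "H 0 = A w + D (w @ [(0,5)]) + D (w @ [(1,5)])" "H 9 = A w + D w"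
    "\<forall>k\<in>{1..9}. \<bar>H k - H (k - 1)\<bar> = (if active k then \<bar>D (w @ [c k])\<bar> else 0)"
    "\<forall>k\<in>{1..9}. A (w @ [c k]) = H k \<or> A (w @ [c k]) = H (k - 1)"
proof -
  let ?L = "vertex_value u"
  have rate1: "decay_rate \<sigma> < 1" using rate decay_rate_pos[of \<sigma>] by linarith
  note common = vertex_value_common[OF u rate1 w]
  note corner = vertex_value_corner[OF u rate1 w]
  have seg: "?L (0,1) (w @ [i]) = A (w @ [i])" if "i \<in> S" for i
    unfolding A_def by (rule segment_constant[OF u rate words_snoc[OF w that]])
  have E: "(0,0) \<in> corners" "(1,0) \<in> corners" "(0,1) \<in> corners" by (auto simp: corners_def)
  have S15: "(1,5) \<in> S" by (rule left_top_in_S) (simp add: top_cells_def)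
  have col: "A (w @ [(0, j)]) = A w" if "j \<le> 6" for j
    using that
  proof (induction j)
    case 0
    then show ?case using corner[OF E(1)] by (simp add: A_def corner_cell_def)
  next
    case (Suc j)
    have "A (w @ [(0, Suc j)]) = ?L (0,1) (w @ [(0, j)])"
      unfolding A_def using Suc.prems E by (intro common) (auto simp: column_in_S)
    then show ?case using Suc seg column_in_S[of j] by simp
  qed
  have v15: "?L (1,0) (w @ [(0,5)]) = A (w @ [(1,5)])"
    unfolding A_def using E S15 by (intro common) (auto simp: column_in_S)
  have "?L (1,0) (w @ [(0,6)]) = ?L (0,1) (w @ [(1,5)])"
    using E S15 by (intro common) (auto simp: column_in_S)
  then have v16: "?L (1,0) (w @ [(0,6)]) = A (w @ [(1,5)])" using seg[OF S15] by simp
  have "\<forall>k\<in>{1..9}. \<exists>p. fst p \<in> corners \<and> snd p \<in> corners \<and> z (k - 1) = cell_map (c k) (lattice_pt (fst p)) \<and>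
      z k = cell_map (c k) (lattice_pt (snd p))"
  proof
    fix k :: nat assume k: "k \<in> {1..9}"
    obtain a b where "a \<in> corners" "b \<in> corners" "z (k - 1) = cell_map (c k) (lattice_pt a)"
      "z k = cell_map (c k) (lattice_pt b)" using z_corner[OF k] .
    then show "\<exists>p. fst p \<in> corners \<and> snd p \<in> corners \<and> z (k - 1) = cell_map (c k) (lattice_pt (fst p)) \<and>
      z k = cell_map (c k) (lattice_pt (snd p))" by (intro exI[of _ "(a, b)"]) simp
  qed
  from bchoice[OF this] obtain p where "\<forall>k\<in>{1..9}. fst (p k) \<in> corners \<and> snd (p k) \<in> corners \<and>
      z (k - 1) = cell_map (c k) (lattice_pt (fst (p k))) \<and> z k = cell_map (c k) (lattice_pt (snd (p k)))" ..
  then have p: "fst (p k) \<in> corners" "snd (p k) \<in> corners"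
      "z (k - 1) = cell_map (c k) (lattice_pt (fst (p k)))" "z k = cell_map (c k) (lattice_pt (snd (p k)))"
    if "k \<in> {1..9}" for k using that by blast+
  define H where "H k = (if k = 0 then ?L (fst (p 1)) (w @ [c 1]) else ?L (snd (p k)) (w @ [c k]))" for k
  have prev: "H (k - 1) = ?L (fst (p k)) (w @ [c k])" if k: "k \<in> {1..9}" for k
  proof (cases "k = 1")
    case False
    then have k1: "k - 1 \<in> {1..9}" "k - 1 \<noteq> 0" using k by auto
    have "snd (p (k - 1)) + c (k - 1) = fst (p k) + c k"
      unfolding cell_map_lattice_eq_iff[symmetric] using p(4)[OF k1(1)] p(3)[OF k] by simp
    then show ?thesis unfolding H_def using k1 k p c_in_S by (auto intro!: common)
  qed (simp add: H_def)
  have nxt: "H k = ?L (snd (p k)) (w @ [c k])" if "k \<in> {1..9}" for k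
    using that by (simp add: H_def)
  have one: "(1::nat) \<in> {1..9}" and nine: "(9::nat) \<in> {1..9}" by simp_all
  have "fst (p 1) + c 1 = (1,0) + (1,5)"
  proof -
    have "grid_pt (fst (p 1) + c 1) = grid_pt (2,5)"
      using p(3)[OF one] z_ends(1) by (simp add: grid_pt_cell_map)
    then show ?thesis unfolding grid_pt_inj by simp
  qed
  then have "?L (fst (p 1)) (w @ [c 1]) = ?L (1,0) (w @ [(1,5)])"
    using E S15 p(1)[OF one] c_in_S[OF one] by (intro common) auto
  then have H0: "H 0 = A w + D (w @ [(0,5)]) + D (w @ [(1,5)])"
    using v15 col[of 5] by (simp add: H_def D_def A_def)
  have "snd (p 9) = (1,0)"
  proof -
    have "cell_map (c 9) (lattice_pt (snd (p 9))) = cell_map (c 9) (lattice_pt (1,0))"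
      using p(4)[OF nine] c_last(2) by simp
    then show ?thesis unfolding cell_map_lattice_eq_iff by simp
  qed
  then have H9: "H 9 = A w + D w"
    using corner[OF E(2)] c_last(1) by (simp add: H_def D_def A_def corner_cell_def)
  have step: "\<bar>H k - H (k - 1)\<bar> = (if active k then \<bar>D (w @ [c k])\<bar> else 0) \<and>
      (A (w @ [c k]) = H k \<or> A (w @ [c k]) = H (k - 1))" if k: "k \<in> {1..9}" for k
  proof -
    have act: "active k \<longleftrightarrow> fst (p k) = (1,0) \<or> snd (p k) = (1,0)"
      unfolding active_def tip_def p(3)[OF k] p(4)[OF k] insert_iff cell_map_lattice_eq_iff by auto
    have neq: "fst (p k) \<noteq> snd (p k)" using z_neq[OF k] p(3,4)[OF k] by auto
    have fp: "fst (p k) = (0,0) \<or> fst (p k) = (1,0) \<or> fst (p k) = (0,1)"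
      "snd (p k) = (0,0) \<or> snd (p k) = (1,0) \<or> snd (p k) = (0,1)"
      using p(1,2)[OF k] by (simp_all add: corners_def)
    show ?thesis
      unfolding prev[OF k] nxt[OF k] act
      using fp neq seg[OF c_in_S[OF k]] by (elim disjE) (simp_all add: D_def A_def)
  qed
  show ?thesis
  proof (rule that[of H])
    show "\<forall>j\<le>6. A (w @ [(0, j)]) = A w" using col by blast
    show "A (w @ [(1,5)]) = A w + D (w @ [(0,5)])" using v15 col[of 5] by (simp add: D_def A_def)
    show "D (w @ [(0,6)]) = D (w @ [(0,5)])" using v15 v16 col[of 5] col[of 6] by (simp add: D_def A_def)
  qed (use H0 H9 step in blast)+
qed

text \<open>Refining multiplies the energy of the differences \<open>D\<close> between \<open>p2\<close> and \<open>p1\<close> by at least the conductance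
  \<open>2/17\<close> of the series circuit, so all differences vanish. Hence all vertex values agree, and since the
  averages over cells are close to the vertex values in square mean, \<open>u\<close> is constant.\<close>

lemma besov_constant:
  assumes u: "u \<in> besov_space \<alpha> K \<sigma>" and rate: "17/2 * decay_rate \<sigma> < 1"
  shows "\<exists>b. AE x in mu. u x = b"
proof -
  let ?A = "vertex_value u (0,0)"
  have rate7: "7 * decay_rate \<sigma> < 1" and rate1: "decay_rate \<sigma> < 1"
    using rate decay_rate_pos[of \<sigma>] by linarith+
  define D where "D w = vertex_value u (1,0) w - ?A w" for w
  have E: "(0,0) \<in> corners" "(1,0) \<in> corners" "(0,1) \<in> corners" by (auto simp: corners_def)
  obtain C where C: "\<forall>n. (\<Sum>w\<in>words n. (D w)\<^sup>2) \<le> C * decay_rate \<sigma> ^ n"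
    unfolding D_def by (rule vertex_difference_decay[OF u rate1 E(2,1)])
  have "(D w)\<^sup>2 \<le> 17/2 * (\<Sum>i\<in>S. (D (w @ [i]))\<^sup>2)" if w: "w \<in> words n" for w n
  proof -
    obtain H where H: "D (w @ [(0,6)]) = D (w @ [(0,5)])"
      "H 0 = ?A w + D (w @ [(0,5)]) + D (w @ [(1,5)])" "H 9 = ?A w + D w"
      "\<forall>k\<in>{1..9}. \<bar>H k - H (k - 1)\<bar> = (if active k then \<bar>D (w @ [c k])\<bar> else 0)"
      unfolding D_def by (rule vertex_values_in_cell[OF u rate7 w])
    let ?T = "{k \<in> {1..9}. active k}"
    define s where "s = (\<Sum>k\<in>{1..9}. H k - H (k - 1))"
    have "s = H 9 - H 0" by (simp add: s_def eval_nat_numeral)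
    then have Dw: "D w = D (w @ [(0,5)]) + D (w @ [(1,5)]) + s" using H(2,3) by simp
    have "s = (\<Sum>k\<in>?T. H k - H (k - 1))"
      unfolding s_def
    proof (rule sum.mono_neutral_right)
      show "\<forall>k\<in>{1..9} - ?T. H k - H (k - 1) = 0"
      proof
        fix k assume "k \<in> {1..9} - ?T"
        then have "\<bar>H k - H (k - 1)\<bar> = 0" using H(4)[rule_format, of k] by simp
        then show "H k - H (k - 1) = 0" by simp
      qed
    qed auto
    then have "s\<^sup>2 \<le> 7 * (\<Sum>k\<in>?T. (H k - H (k - 1))\<^sup>2)"
      using sum_squared_le_sum_of_squares[of "\<lambda>k. H k - H (k - 1)" ?T] card_active by simp
    also have "(\<Sum>k\<in>?T. (H k - H (k - 1))\<^sup>2) = (\<Sum>k\<in>?T. (D (w @ [c k]))\<^sup>2)"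
    proof (rule sum.cong[OF refl])
      fix k assume "k \<in> ?T"
      then have "\<bar>H k - H (k - 1)\<bar> = \<bar>D (w @ [c k])\<bar>" using H(4) by simp
      then show "(H k - H (k - 1))\<^sup>2 = (D (w @ [c k]))\<^sup>2" by (metis power2_abs)
    qed
    also have "\<dots> \<le> (\<Sum>k\<in>{1..9}. (D (w @ [c k]))\<^sup>2)" by (intro sum_mono2) auto
    finally have s: "s\<^sup>2 / 7 \<le> (\<Sum>k\<in>{1..9}. (D (w @ [c k]))\<^sup>2)" by simp
    have "2 * (D (w @ [(0,5)]))\<^sup>2 + (D (w @ [(1,5)]))\<^sup>2 \<le> (\<Sum>i\<in>left_cells \<union> top_cells. (D (w @ [i]))\<^sup>2)"
      unfolding sum_left_top H(1) by simp
    with s have le: "2 * (D (w @ [(0,5)]))\<^sup>2 + (D (w @ [(1,5)]))\<^sup>2 + s\<^sup>2 / 7 \<le> (\<Sum>i\<in>S. (D (w @ [i]))\<^sup>2)"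
      unfolding sum_cells by linarith
    show ?thesis
      unfolding Dw by (rule order_trans[OF resistor_inequality mult_left_mono[OF le]]) simp
  qed
  note step = this
  have D_zero: "D w = 0" if "w \<in> words n" for w n
    by (rule energy_vanishes[OF step C _ decay_rate_pos rate that]) simp_all
  have all_A: "vertex_value u a w = ?A w" if "w \<in> words n" "a \<in> corners" for a w n
    using D_zero[OF that(1)] segment_constant[OF u rate7 that(1)] that(2) by (auto simp: corners_def D_def)
  define b where "b = ?A []"
  have A_const: "w \<in> words n \<Longrightarrow> ?A w = b" for w n
  proof (induction n arbitrary: w)
    case 0
    then show ?case by (simp add: b_def)
  next
    case (Suc n)
    obtain v i where vi: "v \<in> words n" "i \<in> S" "w = v @ [i]" using Suc.prems by (auto simp: words_Suc_snoc)
    have D0: "D (v @ [j]) = 0" if "j \<in> S" for j by (rule D_zero[OF words_snoc[OF vi(1) that]])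
    obtain H where H: "\<forall>j\<le>6. ?A (v @ [(0, j)]) = ?A v"
      "?A (v @ [(1,5)]) = ?A v + D (v @ [(0,5)])"
      "H 0 = ?A v + D (v @ [(0,5)]) + D (v @ [(1,5)])"
      "\<forall>k\<in>{1..9}. \<bar>H k - H (k - 1)\<bar> = (if active k then \<bar>D (v @ [c k])\<bar> else 0)"
      "\<forall>k\<in>{1..9}. ?A (v @ [c k]) = H k \<or> ?A (v @ [c k]) = H (k - 1)"
      unfolding D_def by (rule vertex_values_in_cell[OF u rate7 vi(1)])
    have S15: "(1,5) \<in> S" by (rule left_top_in_S) (simp add: top_cells_def)
    have Hk: "k \<le> 9 \<Longrightarrow> H k = ?A v" for k
    proof (induction k)
      case 0
      then show ?case using H(3) D0 S15 column_in_S[of 5] by simp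
    next
      case (Suc k)
      then have k: "Suc k \<in> {1..9}" by simp
      have "\<bar>H (Suc k) - H k\<bar> = 0" using H(4) k D0[OF c_in_S[OF k]] by (metis abs_zero diff_Suc_1)
      then show ?case using Suc by simp
    qed
    have "?A (v @ [i]) = ?A v"
      using vi(2)
    proof (cases rule: S_cases)
      case 1
      then have "i = (1,5) \<or> (\<exists>j\<le>6. i = (0, j))" by (auto simp: left_cells_def top_cells_def)
      then show ?thesis using H(1,2) D0[OF column_in_S[of 5]] by auto
    next
      case (2 k)
      then have "?A (v @ [c k]) = H k \<or> ?A (v @ [c k]) = H (k - 1)" using H(5) by blast
      then show ?thesis using Hk[of k] Hk[of "k - 1"] 2 by auto
    qed
    then show ?case using Suc.IH[OF vi(1)] vi(3) by simp
  qed
  obtain C1 where C1: "0 \<le> C1"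
    "\<forall>n. \<forall>a\<in>corners. (\<Sum>w\<in>words n. (vertex_value u a w - avg u w)\<^sup>2) \<le> C1 * decay_rate \<sigma> ^ n"
    by (rule vertex_value_decay[OF u rate1])
  obtain C2 where C2: "0 \<le> C2" "\<forall>n\<ge>1. (\<Sum>w\<in>words n. variation u w)
    \<le> ennreal (C2 * decay_rate \<sigma> ^ n / 17 ^ n)" by (rule variance_sum_decay[OF u])
  have L2: "u \<in> L2_space mu" using u by (simp add: besov_space_def)
  note [measurable] = L2_integrable(1)[OF L2]
  have le: "(\<integral>\<^sup>+x. ennreal ((u x - b)\<^sup>2) \<partial>mu) \<le> ennreal ((2 * C2 + 2 * C1) * decay_rate \<sigma> ^ n)" if n: "n \<ge> 1" for n
  proof -
    have [measurable]: "piece w \<in> sets mu" if "w \<in> words n" for w using that by (rule word_cell_sets)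
    have "(\<integral>\<^sup>+x. ennreal ((u x - b)\<^sup>2) \<partial>mu) \<le>
        (\<integral>\<^sup>+x. (\<Sum>w\<in>words n. 2 * (ennreal ((u x - avg u w)\<^sup>2) * indicator (piece w) x) +
          ennreal (2 * (avg u w - b)\<^sup>2) * indicator (piece w) x) \<partial>mu)"
    proof (rule nn_integral_mono)
      fix x assume "x \<in> space mu"
      then have "x \<in> K" by simp
      then obtain w y where w: "w \<in> words n" "y \<in> K" "x = word_map w y" by (rule in_word_cell)
      have "(u x - b)\<^sup>2 \<le> 2 * (u x - avg u w)\<^sup>2 + 2 * (avg u w - b)\<^sup>2"
        using zero_le_power2[of "(u x - avg u w) - (avg u w - b)"] by (simp add: power2_eq_square algebra_simps)
      then have "ennreal ((u x - b)\<^sup>2) \<le> ennreal (2 * (u x - avg u w)\<^sup>2 + 2 * (avg u w - b)\<^sup>2)" by (rule ennreal_leI)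
      also have "\<dots> = 2 * (ennreal ((u x - avg u w)\<^sup>2) * indicator (piece w) x) +
          ennreal (2 * (avg u w - b)\<^sup>2) * indicator (piece w) x"
        using w by (simp add: ennreal_plus ennreal_mult)
      also have "\<dots> \<le> (\<Sum>w\<in>words n. 2 * (ennreal ((u x - avg u w)\<^sup>2) * indicator (piece w) x) +
          ennreal (2 * (avg u w - b)\<^sup>2) * indicator (piece w) x)"
        using w(1) by (intro member_le_sum[of w "words n" "\<lambda>w. 2 * (ennreal ((u x - avg u w)\<^sup>2) * indicator (piece w) x) +
          ennreal (2 * (avg u w - b)\<^sup>2) * indicator (piece w) x"]) auto
      finally show "ennreal ((u x - b)\<^sup>2) \<le> (\<Sum>w\<in>words n. 2 * (ennreal ((u x - avg u w)\<^sup>2) * indicator (piece w) x) +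
          ennreal (2 * (avg u w - b)\<^sup>2) * indicator (piece w) x)" .
    qed
    also have "\<dots> = (\<Sum>w\<in>words n. (\<integral>\<^sup>+x. 2 * (ennreal ((u x - avg u w)\<^sup>2) * indicator (piece w) x) +
          ennreal (2 * (avg u w - b)\<^sup>2) * indicator (piece w) x \<partial>mu))"
      by (rule nn_integral_sum) measurable
    also have "\<dots> = (\<Sum>w\<in>words n. 2 * variation u w +
          ennreal (2 * (avg u w - b)\<^sup>2) * ennreal (1 / 17 ^ n))"
    proof (rule sum.cong[OF refl])
      fix w assume w: "w \<in> words n"
      then show "(\<integral>\<^sup>+x. 2 * (ennreal ((u x - avg u w)\<^sup>2) * indicator (piece w) x) +
          ennreal (2 * (avg u w - b)\<^sup>2) * indicator (piece w) x \<partial>mu) =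
        2 * variation u w +
          ennreal (2 * (avg u w - b)\<^sup>2) * ennreal (1 / 17 ^ n)"
        by (simp add: nn_integral_add nn_integral_cmult emeasure_word_cell)
    qed
    also have "\<dots> = 2 * (\<Sum>w\<in>words n. variation u w) +
        ennreal (\<Sum>w\<in>words n. 2 * (avg u w - b)\<^sup>2 / 17 ^ n)"
    proof -
      have "(\<Sum>w\<in>words n. ennreal (2 * (avg u w - b)\<^sup>2) * ennreal (1 / 17 ^ n)) =
          (\<Sum>w\<in>words n. ennreal (2 * (avg u w - b)\<^sup>2 / 17 ^ n))"
        by (intro sum.cong refl) (simp add: ennreal_mult[symmetric])
      also have "\<dots> = ennreal (\<Sum>w\<in>words n. 2 * (avg u w - b)\<^sup>2 / 17 ^ n)"
        by (rule sum_ennreal) simp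
      finally show ?thesis by (simp only: sum.distrib sum_distrib_left)
    qed
    also have "\<dots> \<le> 2 * ennreal (C2 * decay_rate \<sigma> ^ n / 17 ^ n) + ennreal (2 * (C1 * decay_rate \<sigma> ^ n))"
    proof (intro add_mono mult_left_mono ennreal_leI)
      show "(\<Sum>w\<in>words n. variation u w) \<le> ennreal (C2 * decay_rate \<sigma> ^ n / 17 ^ n)"
        using C2(2) n by blast
      have "(\<Sum>w\<in>words n. (avg u w - b)\<^sup>2) = (\<Sum>w\<in>words n. (?A w - avg u w)\<^sup>2)"
        using A_const by (intro sum.cong refl) (simp add: power2_commute)
      also have "\<dots> \<le> C1 * decay_rate \<sigma> ^ n" using C1(2) E(1) by blast
      finally have *: "2 * (\<Sum>w\<in>words n. (avg u w - b)\<^sup>2) \<le> 2 * (C1 * decay_rate \<sigma> ^ n)" by simp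
      have "(\<Sum>w\<in>words n. 2 * (avg u w - b)\<^sup>2 / 17 ^ n) \<le> (\<Sum>w\<in>words n. 2 * (avg u w - b)\<^sup>2)"
        by (intro sum_mono) (simp add: divide_le_eq mult_le_cancel_left1)
      then show "(\<Sum>w\<in>words n. 2 * (avg u w - b)\<^sup>2 / 17 ^ n) \<le> 2 * (C1 * decay_rate \<sigma> ^ n)"
        using * by (simp add: sum_distrib_left)
    qed simp
    also have "\<dots> \<le> ennreal (2 * (C2 * decay_rate \<sigma> ^ n)) + ennreal (2 * (C1 * decay_rate \<sigma> ^ n))"
    proof (rule add_right_mono)
      have "C2 * decay_rate \<sigma> ^ n / 17 ^ n \<le> C2 * decay_rate \<sigma> ^ n"
        using divide_left_mono[of 1 "17 ^ n" "C2 * decay_rate \<sigma> ^ n"] C2(1) decay_rate_pos[of \<sigma>] by simp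
      then show "2 * ennreal (C2 * decay_rate \<sigma> ^ n / 17 ^ n) \<le> ennreal (2 * (C2 * decay_rate \<sigma> ^ n))"
        by (simp add: ennreal_mult' mult_left_mono ennreal_leI)
    qed
    also have "\<dots> = ennreal ((2 * C2 + 2 * C1) * decay_rate \<sigma> ^ n)"
      using C1(1) C2(1) decay_rate_pos[of \<sigma>] by (simp add: ennreal_plus[symmetric] algebra_simps del: ennreal_plus)
    finally show ?thesis .
  qed
  have "(\<lambda>n. ennreal ((2 * C2 + 2 * C1) * decay_rate \<sigma> ^ n)) \<longlonglongrightarrow> ennreal 0"
    using LIMSEQ_realpow_zero[of "decay_rate \<sigma>"] decay_rate_pos[of \<sigma>] rate1
    by (intro tendsto_ennrealI tendsto_mult_right_zero) auto
  then have "(\<integral>\<^sup>+x. ennreal ((u x - b)\<^sup>2) \<partial>mu) \<le> ennreal 0"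
    using le by (intro LIMSEQ_le_const) auto
  then have "AE x in mu. ennreal ((u x - b)\<^sup>2) = 0"
    by (subst (asm) ennreal_0) (simp add: nn_integral_0_iff_AE)
  then have "AE x in mu. u x = b" by eventually_elim simp
  then show ?thesis by blast
qed

end

section \<open>Density in the space of continuous functions\<close>

lemma (in triangular_ifs) osc_class_mono:
  assumes u: "u \<in> osc_class \<rho>'" and rho: "0 \<le> \<rho>'" "\<rho>' \<le> \<rho>"
  shows "u \<in> osc_class \<rho>"
proof -
  obtain C b where "\<forall>n. osc_le u n (b n)" "\<forall>n. (\<Sum>w\<in>words n. (b n w)\<^sup>2) \<le> C * \<rho>' ^ n"
    by (rule osc_classE[OF u])
  note b = this[rule_format]
  have C: "0 \<le> C" using b(2)[of 0] by (simp add: order_trans[OF zero_le_power2])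
  show ?thesis
  proof (rule osc_classI[OF b(1)])
    fix n
    have "C * \<rho>' ^ n \<le> C * \<rho> ^ n" using C rho by (intro mult_left_mono power_mono) auto
    then show "(\<Sum>w\<in>words n. (b n w)\<^sup>2) \<le> C * \<rho> ^ n" using b(2)[of n] by linarith
  qed
qed

abbreviation (in triangular_ifs) uniform_osc_le :: "(plane \<Rightarrow> real) \<Rightarrow> nat \<Rightarrow> real \<Rightarrow> bool" where
  "uniform_osc_le v n e \<equiv> \<forall>w\<in>words n. \<forall>x\<in>K. \<forall>y\<in>K. \<bar>v (word_map w x) - v (word_map w y)\<bar> \<le> e"

lemma (in triangular_ifs) uniform_osc:
  assumes v: "continuous_on K v" and e: "0 < (e::real)"
  obtains n where "uniform_osc_le v n e"
proof -
  have "uniformly_continuous_on K v" by (rule compact_uniformly_continuous[OF v compact_K])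
  then obtain d where d: "0 < d" "\<forall>x\<in>K. \<forall>y\<in>K. dist y x < d \<longrightarrow> dist (v y) (v x) < e"
    using e unfolding uniformly_continuous_on_def by blast
  obtain n where n: "(1/7) ^ n < d" using real_arch_pow_inv[OF d(1), of "1/7"] by auto
  have "\<bar>v (word_map w x) - v (word_map w y)\<bar> \<le> e" if w: "w \<in> words n" and xy: "x \<in> K" "y \<in> K" for w x y
  proof -
    have "dist (word_map w x) (word_map w y) \<le> 1 / 7 ^ n"
      using dist_word_le[OF xy, of w] length_words[OF w] by simp
    then have "dist (word_map w x) (word_map w y) < d" using n by (simp add: power_one_over)
    then show ?thesis
      using d(2) word_map_in_K[OF w xy(1)] word_map_in_K[OF w xy(2)] by (auto simp: dist_real_def intro: less_imp_le)
  qed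
  then show ?thesis using that by blast
qed

context sickle
begin

text \<open>The functions 1, \<open>f\<close> and \<open>g\<close> span the values at the three corners.\<close>

lemma interpolation:
  obtains B where "0 \<le> B" "\<forall>p q r e. \<bar>q - p\<bar> \<le> e \<longrightarrow> \<bar>r - p\<bar> \<le> e \<longrightarrow> (\<exists>u\<in>osc_class (1/7).
    u (lattice_pt (0,0)) = p \<and> u (lattice_pt (1,0)) = q \<and> u (lattice_pt (0,1)) = r \<and> (\<forall>x\<in>K. \<bar>u x - p\<bar> \<le> B * e))"
proof -
  obtain g where g: "g \<in> osc_class (2/17)" "g (lattice_pt (0,0)) = 0" "g (lattice_pt (1,0)) = 1" "g (lattice_pt (0,1)) = 0"
    using g_exists .
  obtain f where f: "f \<in> osc_class (1/7)" "f (lattice_pt (0,0)) = 0" "f (lattice_pt (1,0)) = 5/6" "f (lattice_pt (0,1)) = 1"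
    using f_exists .
  obtain Bg where Bg: "\<forall>x\<in>K. \<bar>g x\<bar> \<le> Bg" using osc_class_bounded[OF g(1)] .
  obtain Bf where Bf: "\<forall>x\<in>K. \<bar>f x\<bar> \<le> Bf" using osc_class_bounded[OF f(1)] .
  have g': "g \<in> osc_class (1/7)" by (rule osc_class_mono[OF g(1)]) simp_all
  obtain x0 where "x0 \<in> K" using K_nonempty by blast
  then have B0: "0 \<le> Bf" "0 \<le> Bg" using Bf[rule_format, of x0] Bg[rule_format, of x0] by linarith+
  have "\<exists>u\<in>osc_class (1/7). u (lattice_pt (0,0)) = p \<and> u (lattice_pt (1,0)) = q \<and> u (lattice_pt (0,1)) = r \<and>
      (\<forall>x\<in>K. \<bar>u x - p\<bar> \<le> (Bf + 2 * Bg) * e)" if e: "\<bar>q - p\<bar> \<le> e" "\<bar>r - p\<bar> \<le> e" for p q r e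
  proof (intro bexI[of _ "\<lambda>x. p + ((r - p) * f x + (q - p - 5/6 * (r - p)) * g x)"] conjI ballI)
    show "(\<lambda>x. p + ((r - p) * f x + (q - p - 5/6 * (r - p)) * g x)) \<in> osc_class (1/7)"
      by (intro osc_class_add osc_class_scale osc_class_const f(1) g') simp
    fix x assume x: "x \<in> K"
    have "\<bar>(r - p) * f x + (q - p - 5/6 * (r - p)) * g x\<bar> \<le> \<bar>r - p\<bar> * \<bar>f x\<bar> + \<bar>q - p - 5/6 * (r - p)\<bar> * \<bar>g x\<bar>"
      by (intro order_trans[OF abs_triangle_ineq]) (simp add: abs_mult)
    also have "\<dots> \<le> e * Bf + (2 * e) * Bg"
    proof (intro add_mono mult_mono)
      have "q - p \<le> e" "p - q \<le> e" "r - p \<le> e" "p - r \<le> e" using e by linarith+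
      then show "\<bar>q - p - 5/6 * (r - p)\<bar> \<le> 2 * e" by (intro abs_leI) argo+
    qed (use e x Bf Bg in auto)
    finally show "\<bar>p + ((r - p) * f x + (q - p - 5/6 * (r - p)) * g x) - p\<bar> \<le> (Bf + 2 * Bg) * e"
      by (simp add: algebra_simps)
  qed (unfold f(2-4) g(2-4), simp_all add: algebra_simps)
  then show ?thesis using that[of "Bf + 2 * Bg"] B0 by simp
qed

text \<open>Interpolating at the vertices of level \<open>n\<close> gives compatible pieces whatever the given function is.\<close>

lemma uniform_approximation:
  obtains B where "0 \<le> B" "\<forall>n v e. uniform_osc_le v n e \<longrightarrow>
    (\<exists>u\<in>osc_class (1/7). (\<forall>a\<in>corners. u (lattice_pt a) = v (lattice_pt a)) \<and> (\<forall>x\<in>K. \<bar>u x - v x\<bar> \<le> B * e))"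
proof -
  obtain B where B: "0 \<le> B" "\<forall>p q r e. \<bar>q - p\<bar> \<le> e \<longrightarrow> \<bar>r - p\<bar> \<le> e \<longrightarrow> (\<exists>u\<in>osc_class (1/7).
    u (lattice_pt (0,0)) = p \<and> u (lattice_pt (1,0)) = q \<and> u (lattice_pt (0,1)) = r \<and> (\<forall>x\<in>K. \<bar>u x - p\<bar> \<le> B * e))"
    by (rule interpolation)
  have "\<exists>u\<in>osc_class (1/7). (\<forall>a\<in>corners. u (lattice_pt a) = v (lattice_pt a)) \<and> (\<forall>x\<in>K. \<bar>u x - v x\<bar> \<le> (B + 1) * e)"
    if "uniform_osc_le v n e" for n v e
    using that
  proof (induction n arbitrary: v)
    case 0
    then have osc: "\<bar>v x - v y\<bar> \<le> e" if "x \<in> K" "y \<in> K" for x y using that by simp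
    have E: "lattice_pt (0,0) \<in> K" "lattice_pt (1,0) \<in> K" "lattice_pt (0,1) \<in> K"
      by (rule corner_in_K, simp add: corners_def)+
    have "\<bar>v (lattice_pt (1,0)) - v (lattice_pt (0,0))\<bar> \<le> e" "\<bar>v (lattice_pt (0,1)) - v (lattice_pt (0,0))\<bar> \<le> e"
      using osc[OF E(2,1)] osc[OF E(3,1)] .
    from B(2)[rule_format, OF this] obtain u where u: "u \<in> osc_class (1/7)"
      "u (lattice_pt (0,0)) = v (lattice_pt (0,0))" "u (lattice_pt (1,0)) = v (lattice_pt (1,0))"
      "u (lattice_pt (0,1)) = v (lattice_pt (0,1))" "\<forall>x\<in>K. \<bar>u x - v (lattice_pt (0,0))\<bar> \<le> B * e" by blast
    have "\<bar>u x - v x\<bar> \<le> (B + 1) * e" if x: "x \<in> K" for x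
    proof -
      have "\<bar>v (lattice_pt (0,0)) - v x\<bar> \<le> e" by (rule osc[OF E(1) x])
      moreover have "(B + 1) * e = B * e + e" by (simp add: algebra_simps)
      ultimately show ?thesis using u(5)[rule_format, OF x] by linarith
    qed
    then show ?case using u by (intro bexI[of _ u]) (auto simp: corners_def)
  next
    case (Suc n)
    have "\<forall>i\<in>S. \<exists>u. u \<in> osc_class (1/7) \<and> (\<forall>a\<in>corners. u (lattice_pt a) = v (cell_map i (lattice_pt a))) \<and>
        (\<forall>x\<in>K. \<bar>u x - v (cell_map i x)\<bar> \<le> (B + 1) * e)"
    proof
      fix i assume i: "i \<in> S"
      have "\<forall>w\<in>words n. \<forall>x\<in>K. \<forall>y\<in>K. \<bar>v (cell_map i (word_map w x)) - v (cell_map i (word_map w y))\<bar> \<le> e"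
      proof (intro ballI)
        fix w x y assume "w \<in> words n" "x \<in> K" "y \<in> K"
        then show "\<bar>v (cell_map i (word_map w x)) - v (cell_map i (word_map w y))\<bar> \<le> e"
          using Suc.prems[rule_format, of "i # w" x y] i by (simp add: words_Cons_iff)
      qed
      from Suc.IH[OF this] show "\<exists>u. u \<in> osc_class (1/7) \<and> (\<forall>a\<in>corners. u (lattice_pt a) = v (cell_map i (lattice_pt a))) \<and>
        (\<forall>x\<in>K. \<bar>u x - v (cell_map i x)\<bar> \<le> (B + 1) * e)" by blast
    qed
    from bchoice[OF this] obtain U where "\<forall>i\<in>S. U i \<in> osc_class (1/7) \<and>
        (\<forall>a\<in>corners. U i (lattice_pt a) = v (cell_map i (lattice_pt a))) \<and>
        (\<forall>x\<in>K. \<bar>U i x - v (cell_map i x)\<bar> \<le> (B + 1) * e)" ..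
    then have U: "U i \<in> osc_class (1/7)" "\<And>a. a \<in> corners \<Longrightarrow> U i (lattice_pt a) = v (cell_map i (lattice_pt a))"
      "\<And>x. x \<in> K \<Longrightarrow> \<bar>U i x - v (cell_map i x)\<bar> \<le> (B + 1) * e" if "i \<in> S" for i
      using that by simp_all
    have "compatible (\<lambda>i a. U i (lattice_pt a))"
      unfolding compatible_def
    proof (intro ballI impI)
      fix i j a b assume *: "i \<in> S" "j \<in> S" "a \<in> corners" "b \<in> corners" "a + i = b + j"
      then have "cell_map i (lattice_pt a) = cell_map j (lattice_pt b)" by (simp only: cell_map_lattice_eq_iff)
      then show "U i (lattice_pt a) = U j (lattice_pt b)" using U(2)[OF *(1,3)] U(2)[OF *(2,4)] by simp
    qed
    then obtain u where u: "\<forall>i\<in>S. \<forall>x\<in>K. u (cell_map i x) = U i x" by (rule glue)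
    have "u \<in> osc_class (1/7)"
    proof (rule osc_class_pieces)
      fix i assume i: "i \<in> S"
      show "(\<lambda>x. u (cell_map i x)) \<in> osc_class (1/7)"
        by (rule osc_class_cong[OF U(1)[OF i]]) (use u i in simp)
    qed simp
    moreover have "u (lattice_pt a) = v (lattice_pt a)" if a: "a \<in> corners" for a
      using corners_fixed[OF u a] U(2)[OF corner_cell_in_S[OF a] a] by (simp add: cell_map_corner)
    moreover have "\<bar>u x - v x\<bar> \<le> (B + 1) * e" if x: "x \<in> K" for x
    proof -
      obtain i y where i: "i \<in> S" "y \<in> K" "x = cell_map i y" using in_cell[OF x] .
      then show ?thesis using u U(3)[OF i(1,2)] by simp
    qed
    ultimately show ?case by blast
  qed
  then show ?thesis using that[of "B + 1"] B(1) by simp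
qed

lemma osc_class_dense_in_C:
  assumes "osc_class (1/7) \<subseteq> B"
  shows "dense_in_C K B"
  unfolding dense_in_C_def
proof (intro allI impI)
  fix f :: "plane \<Rightarrow> real" and e :: real
  assume f: "continuous_on K f" and e: "0 < e"
  obtain D where D: "0 \<le> D" "\<forall>n v e. uniform_osc_le v n e \<longrightarrow>
    (\<exists>u\<in>osc_class (1/7). (\<forall>a\<in>corners. u (lattice_pt a) = v (lattice_pt a)) \<and> (\<forall>x\<in>K. \<bar>u x - v x\<bar> \<le> D * e))"
    by (rule uniform_approximation)
  have "0 < e / (D + 1)" using D(1) e by simp
  from uniform_osc[OF f this] obtain n where
    n: "uniform_osc_le f n (e / (D + 1))" .
  from D(2)[rule_format, of n f "e / (D + 1)"] n obtain u where
    u: "u \<in> osc_class (1/7)" "\<forall>x\<in>K. \<bar>u x - f x\<bar> \<le> D * (e / (D + 1))" by blast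
  have "D * (e / (D + 1)) < e" using D(1) e by (simp add: field_simps)
  then have "\<forall>x\<in>K. \<bar>f x - u x\<bar> < e" using u(2) by (metis abs_minus_commute order_le_less_trans)
  moreover have "continuous_on K u" by (rule osc_class_continuous[OF u(1)]) simp_all
  ultimately show "\<exists>u\<in>B. continuous_on K u \<and> (\<forall>x\<in>K. \<bar>f x - u x\<bar> < e)" using u(1) assms by blast
qed

section \<open>Density in the space of square integrable functions\<close>

text \<open>On each cell of level \<open>n\<close> a function is replaced by a multiple of a plateau function. All vertex values
  are zero, so the pieces fit together.\<close>

lemma plateau_approximation:
  obtains B where "0 \<le> B" "\<forall>m n v e M. uniform_osc_le v n e \<longrightarrow>
    (\<forall>x\<in>K. \<bar>v x\<bar> \<le> M) \<longrightarrow>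
    (\<exists>u\<in>osc_class (2/17). \<exists>Bad. finite Bad \<and> card Bad \<le> 17 ^ n * (7 ^ m + 1) \<and>
      (\<forall>a\<in>corners. u (lattice_pt a) = 0) \<and> (\<forall>x\<in>K. \<bar>u x\<bar> \<le> B * M) \<and>
      (\<forall>w\<in>words (n + m) - Bad. \<forall>x\<in>K. \<bar>u (word_map w x) - v (word_map w x)\<bar> \<le> e))"
proof -
  obtain B where B: "\<forall>m. \<exists>u\<in>osc_class (2/17). \<exists>Bad. finite Bad \<and> card Bad \<le> 7 ^ m + 1 \<and>
    (\<forall>a\<in>corners. u (lattice_pt a) = 0) \<and> (\<forall>x\<in>K. \<bar>u x\<bar> \<le> B) \<and>
    (\<forall>w\<in>words m - Bad. \<forall>x\<in>K. u (word_map w x) = 1)" by (rule plateau_exists)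
  obtain x0 where x0: "x0 \<in> K" using K_nonempty by blast
  have B0: "0 \<le> B" using B x0 by (meson abs_ge_zero order_trans)
  have "\<exists>u\<in>osc_class (2/17). \<exists>Bad. finite Bad \<and> card Bad \<le> 17 ^ n * (7 ^ m + 1) \<and>
      (\<forall>a\<in>corners. u (lattice_pt a) = 0) \<and> (\<forall>x\<in>K. \<bar>u x\<bar> \<le> B * M) \<and>
      (\<forall>w\<in>words (n + m) - Bad. \<forall>x\<in>K. \<bar>u (word_map w x) - v (word_map w x)\<bar> \<le> e)"
    if "uniform_osc_le v n e" "\<forall>x\<in>K. \<bar>v x\<bar> \<le> M" for m n v e M
    using that
  proof (induction n arbitrary: v)
    case 0
    obtain u Bad where u: "u \<in> osc_class (2/17)" "finite Bad" "card Bad \<le> 7 ^ m + 1"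
      "\<forall>a\<in>corners. u (lattice_pt a) = 0" "\<forall>x\<in>K. \<bar>u x\<bar> \<le> B" "\<forall>w\<in>words m - Bad. \<forall>x\<in>K. u (word_map w x) = 1"
      using B by blast
    have "\<bar>v x0 * u x\<bar> \<le> B * M" if "x \<in> K" for x
      using 0(2)[rule_format, OF x0] u(5)[rule_format, OF that] B0
      unfolding abs_mult mult.commute[of B] by (intro mult_mono) auto
    moreover have "\<bar>v x0 * u (word_map w x) - v (word_map w x)\<bar> \<le> e" if "w \<in> words m - Bad" "x \<in> K" for w x
      using 0(1)[rule_format, of "[]" x0 "word_map w x"] u(6)[rule_format, OF that] x0 that(1)
        word_map_in_K[of w m x] that(2) by simp
    ultimately show ?case
      using u(2-4) osc_class_scale[OF u(1), of "v x0"]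
      by (intro bexI[of _ "\<lambda>x. v x0 * u x"] exI[of _ Bad]) auto
  next
    case (Suc n)
    have "\<forall>i\<in>S. \<exists>p. fst p \<in> osc_class (2/17) \<and> finite (snd p) \<and> card (snd p) \<le> 17 ^ n * (7 ^ m + 1) \<and>
      (\<forall>a\<in>corners. fst p (lattice_pt a) = 0) \<and> (\<forall>x\<in>K. \<bar>fst p x\<bar> \<le> B * M) \<and>
      (\<forall>w\<in>words (n + m) - snd p. \<forall>x\<in>K. \<bar>fst p (word_map w x) - v (cell_map i (word_map w x))\<bar> \<le> e)"
    proof
      fix i assume i: "i \<in> S"
      have 1: "\<forall>w\<in>words n. \<forall>x\<in>K. \<forall>y\<in>K. \<bar>v (cell_map i (word_map w x)) - v (cell_map i (word_map w y))\<bar> \<le> e"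
      proof (intro ballI)
        fix w x y assume "w \<in> words n" "x \<in> K" "y \<in> K"
        then show "\<bar>v (cell_map i (word_map w x)) - v (cell_map i (word_map w y))\<bar> \<le> e"
          using Suc.prems(1)[rule_format, of "i # w" x y] i by (simp add: words_Cons_iff)
      qed
      have 2: "\<forall>x\<in>K. \<bar>v (cell_map i x)\<bar> \<le> M" using Suc.prems(2) cell_map_in_K[OF i] by blast
      from Suc.IH[OF 1 2] obtain u Bad where "u \<in> osc_class (2/17)" "finite Bad" "card Bad \<le> 17 ^ n * (7 ^ m + 1)"
        "\<forall>a\<in>corners. u (lattice_pt a) = 0" "\<forall>x\<in>K. \<bar>u x\<bar> \<le> B * M"
        "\<forall>w\<in>words (n + m) - Bad. \<forall>x\<in>K. \<bar>u (word_map w x) - v (cell_map i (word_map w x))\<bar> \<le> e" by blast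
      then show "\<exists>p. fst p \<in> osc_class (2/17) \<and> finite (snd p) \<and> card (snd p) \<le> 17 ^ n * (7 ^ m + 1) \<and>
        (\<forall>a\<in>corners. fst p (lattice_pt a) = 0) \<and> (\<forall>x\<in>K. \<bar>fst p x\<bar> \<le> B * M) \<and>
        (\<forall>w\<in>words (n + m) - snd p. \<forall>x\<in>K. \<bar>fst p (word_map w x) - v (cell_map i (word_map w x))\<bar> \<le> e)"
        by (intro exI[of _ "(u, Bad)"]) simp
    qed
    from bchoice[OF this] obtain p where "\<forall>i\<in>S. fst (p i) \<in> osc_class (2/17) \<and> finite (snd (p i)) \<and>
      card (snd (p i)) \<le> 17 ^ n * (7 ^ m + 1) \<and>
      (\<forall>a\<in>corners. fst (p i) (lattice_pt a) = 0) \<and> (\<forall>x\<in>K. \<bar>fst (p i) x\<bar> \<le> B * M) \<and>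
      (\<forall>w\<in>words (n + m) - snd (p i). \<forall>x\<in>K. \<bar>fst (p i) (word_map w x) - v (cell_map i (word_map w x))\<bar> \<le> e)" ..
    then have p: "fst (p i) \<in> osc_class (2/17)" "finite (snd (p i))" "card (snd (p i)) \<le> 17 ^ n * (7 ^ m + 1)"
      "\<And>a. a \<in> corners \<Longrightarrow> fst (p i) (lattice_pt a) = 0" "\<And>x. x \<in> K \<Longrightarrow> \<bar>fst (p i) x\<bar> \<le> B * M"
      "\<And>w x. w \<in> words (n + m) - snd (p i) \<Longrightarrow> x \<in> K \<Longrightarrow> \<bar>fst (p i) (word_map w x) - v (cell_map i (word_map w x))\<bar> \<le> e"
      if "i \<in> S" for i using that by simp_all
    have "compatible (\<lambda>i a. fst (p i) (lattice_pt a))" unfolding compatible_def by (simp add: p(4))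
    then obtain u where u: "\<forall>i\<in>S. \<forall>x\<in>K. u (cell_map i x) = fst (p i) x" by (rule glue)
    define Bad where "Bad = (\<Union>i\<in>S. (\<lambda>w. i # w) ` snd (p i))"
    have "u \<in> osc_class (2/17)"
    proof (rule osc_class_pieces)
      fix i assume i: "i \<in> S"
      show "(\<lambda>x. u (cell_map i x)) \<in> osc_class (2/17)"
        by (rule osc_class_cong[OF p(1)[OF i]]) (use u i in simp)
    qed simp
    moreover have "finite Bad" unfolding Bad_def using finite_S p(2) by blast
    moreover have "card Bad \<le> 17 ^ Suc n * (7 ^ m + 1)"
    proof -
      have "card Bad \<le> (\<Sum>i\<in>S. card ((\<lambda>w. i # w) ` snd (p i)))"
        unfolding Bad_def by (rule card_UN_le[OF finite_S])
      also have "\<dots> \<le> (\<Sum>i\<in>S. 17 ^ n * (7 ^ m + 1))"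
        by (intro sum_mono order_trans[OF card_image_le[OF p(2)] p(3)])
      finally show ?thesis by (simp add: card_S)
    qed
    moreover have "u (lattice_pt a) = 0" if a: "a \<in> corners" for a
      using corners_fixed[OF u a] p(4)[OF corner_cell_in_S[OF a] a] by simp
    moreover have "\<bar>u x\<bar> \<le> B * M" if x: "x \<in> K" for x
    proof -
      obtain i y where i: "i \<in> S" "y \<in> K" "x = cell_map i y" using in_cell[OF x] .
      then show ?thesis using u p(5)[OF i(1,2)] by simp
    qed
    moreover have "\<bar>u (word_map w x) - v (word_map w x)\<bar> \<le> e" if w: "w \<in> words (Suc n + m) - Bad" and x: "x \<in> K" for w x
    proof -
      obtain i w' where iw: "i \<in> S" "w' \<in> words (n + m)" "w = i # w'" using w by (auto simp: words_Suc_Cons)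
      then have "w' \<in> words (n + m) - snd (p i)" using w by (auto simp: Bad_def)
      from p(6)[OF iw(1) this x] show ?thesis using u iw word_map_in_K[OF iw(2) x] by simp
    qed
    ultimately show ?case by (intro bexI[of _ u] exI[of _ Bad]) auto
  qed
  then show ?thesis using that[of B] B0 by simp
qed

lemma continuous_L2:
  assumes v: "continuous_on K v"
  shows "v \<in> L2_space mu"
proof -
  have [measurable]: "v \<in> borel_measurable mu"
    using borel_measurable_continuous_on_restrict[OF v] by (simp add: measurable_cong_sets[OF sets_mu])
  have "compact (v ` K)" by (rule compact_continuous_image[OF v compact_K])
  then obtain M where M: "\<forall>x\<in>K. \<bar>v x\<bar> \<le> M"
    using compact_imp_bounded bounded_iff[of "v ` K"] by auto
  have "integrable mu (\<lambda>x. (v x)\<^sup>2)"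
  proof (rule mu.integrable_const_bound[of _ "M\<^sup>2"])
    have "(v x)\<^sup>2 \<le> M\<^sup>2" if "x \<in> K" for x using power_mono[OF M[rule_format, OF that], of 2] by simp
    then show "AE x in mu. norm ((v x)\<^sup>2) \<le> M\<^sup>2" by (intro AE_I2) simp
  qed measurable
  then show ?thesis by (simp add: L2_space_def)
qed

lemma L2_add: "f \<in> L2_space mu \<Longrightarrow> h \<in> L2_space mu \<Longrightarrow> (\<lambda>x. f x + h x) \<in> L2_space mu"
proof -
  assume f: "f \<in> L2_space mu" and h: "h \<in> L2_space mu"
  note [measurable] = L2_integrable(1)[OF f] L2_integrable(1)[OF h]
  have "integrable mu (\<lambda>x. (f x + h x)\<^sup>2)"
  proof (rule Bochner_Integration.integrable_bound)
    show "integrable mu (\<lambda>x. 2 * (f x)\<^sup>2 + 2 * (h x)\<^sup>2)"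
      using L2_integrable(3)[OF f] L2_integrable(3)[OF h] by simp
    have "(s + t)\<^sup>2 \<le> 2 * s\<^sup>2 + 2 * t\<^sup>2" for s t :: real
      using sum_squares_bound[of s t] by (simp add: power2_sum)
    then show "AE x in mu. norm ((f x + h x)\<^sup>2) \<le> norm (2 * (f x)\<^sup>2 + 2 * (h x)\<^sup>2)" by (intro AE_I2) simp
  qed measurable
  then show "(\<lambda>x. f x + h x) \<in> L2_space mu" by (simp add: L2_space_def)
qed

lemma L2_scale: "f \<in> L2_space mu \<Longrightarrow> (\<lambda>x. t * f x) \<in> L2_space mu"
  by (auto simp: L2_space_def power_mult_distrib)

lemma L2_diff: "f \<in> L2_space mu \<Longrightarrow> h \<in> L2_space mu \<Longrightarrow> (\<lambda>x. f x - h x) \<in> L2_space mu"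
  using L2_add[OF _ L2_scale[of h "-1"], of f] by simp

lemma L2_dist_triangle:
  assumes f: "f \<in> L2_space mu" and h: "h \<in> L2_space mu" and k: "k \<in> L2_space mu"
  shows "(\<integral>x. (f x - k x)\<^sup>2 \<partial>mu) \<le> 2 * (\<integral>x. (f x - h x)\<^sup>2 \<partial>mu) + 2 * (\<integral>x. (h x - k x)\<^sup>2 \<partial>mu)"
proof -
  note i = L2_integrable(3)[OF L2_diff[OF f h]] L2_integrable(3)[OF L2_diff[OF h k]]
  have "(\<integral>x. (f x - k x)\<^sup>2 \<partial>mu) \<le> (\<integral>x. 2 * (f x - h x)\<^sup>2 + 2 * (h x - k x)\<^sup>2 \<partial>mu)"
  proof (rule integral_mono)
    show "integrable mu (\<lambda>x. (f x - k x)\<^sup>2)" by (rule L2_integrable(3)[OF L2_diff[OF f k]])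
    show "integrable mu (\<lambda>x. 2 * (f x - h x)\<^sup>2 + 2 * (h x - k x)\<^sup>2)" using i by simp
    show "(f x - k x)\<^sup>2 \<le> 2 * (f x - h x)\<^sup>2 + 2 * (h x - k x)\<^sup>2" for x
      using zero_le_power2[of "(f x - h x) - (h x - k x)"] by (simp add: power2_eq_square algebra_simps)
  qed
  then show ?thesis using i by simp
qed

text \<open>Away from the cells where the plateau functions are not constant the error is at most \<open>e\<close>, and these
  cells have total measure at most \<open>2 * (7/17) ^ m\<close>.\<close>

lemma plateau_dense:
  assumes v: "continuous_on K v" and d: "0 < (d::real)"
  obtains u where "u \<in> osc_class (2/17)" "(\<integral>x. (v x - u x)\<^sup>2 \<partial>mu) < d"
proof -
  obtain B where B: "0 \<le> B" "\<forall>m n v e M. uniform_osc_le v n e \<longrightarrow>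
    (\<forall>x\<in>K. \<bar>v x\<bar> \<le> M) \<longrightarrow>
    (\<exists>u\<in>osc_class (2/17). \<exists>Bad. finite Bad \<and> card Bad \<le> 17 ^ n * (7 ^ m + 1) \<and>
      (\<forall>a\<in>corners. u (lattice_pt a) = 0) \<and> (\<forall>x\<in>K. \<bar>u x\<bar> \<le> B * M) \<and>
      (\<forall>w\<in>words (n + m) - Bad. \<forall>x\<in>K. \<bar>u (word_map w x) - v (word_map w x)\<bar> \<le> e))"
    by (rule plateau_approximation)
  have "compact (v ` K)" by (rule compact_continuous_image[OF v compact_K])
  then obtain M where M: "\<forall>x\<in>K. \<bar>v x\<bar> \<le> M"
    using compact_imp_bounded bounded_iff[of "v ` K"] by auto
  define e where "e = sqrt (d / 2)"
  have e: "0 < e" "e\<^sup>2 = d / 2" using d by (simp_all add: e_def)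
  obtain n where n: "uniform_osc_le v n e"
    using uniform_osc[OF v e(1)] .
  define c0 where "c0 = (M + B * M)\<^sup>2"
  have "(\<lambda>m. c0 * (2 * (7/17) ^ m)) \<longlonglongrightarrow> c0 * (2 * 0)"
    by (intro tendsto_mult tendsto_const LIMSEQ_realpow_zero) simp_all
  then have "\<forall>\<^sub>F m in sequentially. c0 * (2 * (7/17) ^ m) < d / 2"
    using d by (intro order_tendstoD) auto
  then obtain m where m: "c0 * (2 * (7/17) ^ m) < d / 2" by (auto simp: eventually_sequentially)
  from B(2)[rule_format, of n v e M m] n M obtain u Bad where
    u: "u \<in> osc_class (2/17)" "finite Bad" "card Bad \<le> 17 ^ n * (7 ^ m + 1)" "\<forall>x\<in>K. \<bar>u x\<bar> \<le> B * M"
      "\<forall>w\<in>words (n + m) - Bad. \<forall>x\<in>K. \<bar>u (word_map w x) - v (word_map w x)\<bar> \<le> e" by blast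
  let ?b = "Bad \<inter> words (n + m)"
  have [measurable]: "piece w \<in> sets mu" if "w \<in> words (n + m)" for w using that by (rule word_cell_sets)
  have uL2: "u \<in> L2_space mu" by (rule osc_class_L2[OF u(1)]) simp_all
  have int_b: "integrable mu (\<lambda>x. c0 * indicator (piece w) x)" if "w \<in> ?b" for w
  proof (rule integrable_mult_right)
    show "integrable mu (indicator (piece w) :: _ \<Rightarrow> real)"
      by (rule integrable_real_indicator) (use that emeasure_word_cell[of w "n + m"] in \<open>auto intro: word_cell_sets\<close>)
  qed
  have "(\<integral>x. (v x - u x)\<^sup>2 \<partial>mu) \<le> (\<integral>x. e\<^sup>2 + (\<Sum>w\<in>?b. c0 * indicator (piece w) x) \<partial>mu)"
  proof (rule integral_mono)
    show "integrable mu (\<lambda>x. (v x - u x)\<^sup>2)"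
      by (rule L2_integrable(3)[OF L2_diff[OF continuous_L2[OF v] uL2]])
    show "integrable mu (\<lambda>x. e\<^sup>2 + (\<Sum>w\<in>?b. c0 * indicator (piece w) x))"
      by (intro Bochner_Integration.integrable_add Bochner_Integration.integrable_sum int_b) simp_all
    fix x assume "x \<in> space mu"
    then have x: "x \<in> K" by simp
    obtain w y where w: "w \<in> words (n + m)" "y \<in> K" "x = word_map w y" using in_word_cell[OF x] .
    have nn: "0 \<le> (\<Sum>w\<in>?b. c0 * indicator (piece w) x)"
      by (intro sum_nonneg) (simp add: c0_def)
    show "(v x - u x)\<^sup>2 \<le> e\<^sup>2 + (\<Sum>w\<in>?b. c0 * indicator (piece w) x)"
    proof (cases "w \<in> Bad")
      case True
      have "\<bar>v x - u x\<bar> \<le> M + B * M" using M[rule_format, OF x] u(4)[rule_format, OF x] by linarith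
      then have "(v x - u x)\<^sup>2 \<le> c0" unfolding c0_def by (metis abs_ge_zero power2_abs power_mono)
      also have "c0 = c0 * indicator (piece w) x" using w by simp
      also have "\<dots> \<le> (\<Sum>w\<in>?b. c0 * indicator (piece w) x)"
        using True w u(2) by (intro member_le_sum) (auto simp: c0_def)
      finally show ?thesis using zero_le_power2[of e] by linarith
    next
      case False
      then have "\<bar>v x - u x\<bar> \<le> e" using u(5) w by (auto simp: abs_minus_commute)
      then have "(v x - u x)\<^sup>2 \<le> e\<^sup>2" by (metis abs_ge_zero power2_abs power_mono)
      then show ?thesis using nn by linarith
    qed
  qed
  also have "\<dots> = e\<^sup>2 + (\<Sum>w\<in>?b. c0 * measure mu (piece w))"
  proof -
    have "(\<integral>x. e\<^sup>2 + (\<Sum>w\<in>?b. c0 * indicator (piece w) x) \<partial>mu) =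
        (\<integral>x. e\<^sup>2 \<partial>mu) + (\<integral>x. (\<Sum>w\<in>?b. c0 * indicator (piece w) x) \<partial>mu)"
      by (intro Bochner_Integration.integral_add Bochner_Integration.integrable_sum int_b) simp_all
    also have "(\<integral>x. (\<Sum>w\<in>?b. c0 * indicator (piece w) x) \<partial>mu) =
        (\<Sum>w\<in>?b. (\<integral>x. c0 * indicator (piece w) x \<partial>mu))"
      by (rule Bochner_Integration.integral_sum[OF int_b])
    also have "\<dots> = (\<Sum>w\<in>?b. c0 * measure mu (piece w))"
    proof (rule sum.cong[OF refl])
      fix w assume "w \<in> ?b"
      then have "piece w \<in> sets mu" "piece w \<subseteq> K"
        using word_cell_sets[of w "n + m"] by (simp_all add: sets_mu_iff)
      then show "(\<integral>x. c0 * indicator (piece w) x \<partial>mu) = c0 * measure mu (piece w)"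
        by (simp add: Int_absorb2)
    qed
    finally show ?thesis by (simp add: measure_mu_K)
  qed
  also have "(\<Sum>w\<in>?b. c0 * measure mu (piece w)) = c0 * (real (card ?b) / 17 ^ (n + m))"
  proof -
    have "(\<Sum>w\<in>?b. c0 * measure mu (piece w)) = (\<Sum>w\<in>?b. c0 * (1 / 17 ^ (n + m)))"
      by (intro sum.cong refl) (auto simp: measure_word_cell)
    then show ?thesis by simp
  qed
  also have "\<dots> \<le> c0 * (2 * (7/17) ^ m)"
  proof (rule mult_left_mono)
    have "card ?b \<le> card Bad" using u(2) by (intro card_mono) auto
    then have "real (card ?b) \<le> real (17 ^ n * (7 ^ m + 1))" using u(3) by (intro of_nat_mono) linarith
    also have "\<dots> \<le> 17 ^ n * (2 * 7 ^ m)" by simp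
    finally have "real (card ?b) / 17 ^ (n + m) \<le> 17 ^ n * (2 * 7 ^ m) / 17 ^ (n + m)"
      by (rule divide_right_mono) simp
    also have "\<dots> = 2 * (7/17) ^ m" by (simp add: power_add power_divide)
    finally show "real (card ?b) / 17 ^ (n + m) \<le> 2 * (7/17) ^ m" .
  qed (simp add: c0_def)
  finally have "(\<integral>x. (v x - u x)\<^sup>2 \<partial>mu) < d" using m e by linarith
  then show ?thesis using that u(1) by blast
qed

definition continuous_closure :: "(plane \<Rightarrow> real) set" where
  "continuous_closure = {f \<in> L2_space mu. \<forall>d>0. \<exists>v. continuous_on K v \<and> (\<integral>x. (f x - v x)\<^sup>2 \<partial>mu) < d}"

lemma closure_add:
  assumes f: "f \<in> continuous_closure" and h: "h \<in> continuous_closure"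
  shows "(\<lambda>x. f x + h x) \<in> continuous_closure"
  unfolding continuous_closure_def
proof (intro CollectI conjI allI impI)
  have L: "f \<in> L2_space mu" "h \<in> L2_space mu" using f h by (auto simp: continuous_closure_def)
  then show "(\<lambda>x. f x + h x) \<in> L2_space mu" by (rule L2_add)
  fix d :: real assume "0 < d"
  then have "0 < d / 4" by simp
  then obtain v w where v: "continuous_on K v" "(\<integral>x. (f x - v x)\<^sup>2 \<partial>mu) < d / 4"
    and w: "continuous_on K w" "(\<integral>x. (h x - w x)\<^sup>2 \<partial>mu) < d / 4"
    using f h unfolding continuous_closure_def by blast
  have vw: "v \<in> L2_space mu" "w \<in> L2_space mu" using v w by (auto intro: continuous_L2)
  have "(\<integral>x. ((f x + h x) - (v x + w x))\<^sup>2 \<partial>mu) \<le> 2 * (\<integral>x. ((f x + h x) - (v x + h x))\<^sup>2 \<partial>mu) + 2 * (\<integral>x. ((v x + h x) - (v x + w x))\<^sup>2 \<partial>mu)"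
    by (intro L2_dist_triangle L2_add L vw)
  also have "\<dots> < d" using v(2) w(2) by simp
  finally show "\<exists>v. continuous_on K v \<and> (\<integral>x. (f x + h x - v x)\<^sup>2 \<partial>mu) < d"
    using v(1) w(1) by (intro exI[of _ "\<lambda>x. v x + w x"]) (auto intro: continuous_on_add)
qed

lemma closure_scale:
  assumes f: "f \<in> continuous_closure"
  shows "(\<lambda>x. t * f x) \<in> continuous_closure"
  unfolding continuous_closure_def
proof (intro CollectI conjI allI impI)
  have L: "f \<in> L2_space mu" using f by (auto simp: continuous_closure_def)
  then show "(\<lambda>x. t * f x) \<in> L2_space mu" by (rule L2_scale)
  fix d :: real assume d: "0 < d"
  then have "0 < d / (t\<^sup>2 + 1)" by (simp add: add_nonneg_pos)
  then obtain v where v: "continuous_on K v" "(\<integral>x. (f x - v x)\<^sup>2 \<partial>mu) < d / (t\<^sup>2 + 1)"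
    using f unfolding continuous_closure_def by blast
  have "(\<integral>x. (t * f x - t * v x)\<^sup>2 \<partial>mu) = t\<^sup>2 * (\<integral>x. (f x - v x)\<^sup>2 \<partial>mu)"
    by (simp flip: right_diff_distrib add: power_mult_distrib)
  also have "\<dots> \<le> t\<^sup>2 * (d / (t\<^sup>2 + 1))" using v(2) by (intro mult_left_mono) auto
  also have "\<dots> < d"
  proof -
    have "0 < t\<^sup>2 + 1" by (simp add: add_nonneg_pos)
    then show ?thesis using d by (simp add: field_simps)
  qed
  finally show "\<exists>v. continuous_on K v \<and> (\<integral>x. (t * f x - v x)\<^sup>2 \<partial>mu) < d"
    using v(1) by (intro exI[of _ "\<lambda>x. t * v x"]) (auto intro: continuous_intros)
qed

lemma closure_cong:
  assumes f: "f \<in> continuous_closure" and eq: "\<And>x. x \<in> K \<Longrightarrow> h x = f x"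
  shows "h \<in> continuous_closure"
proof -
  have "h \<in> borel_measurable mu \<longleftrightarrow> f \<in> borel_measurable mu" using eq by (intro measurable_cong) simp
  moreover have "integrable mu (\<lambda>x. (h x)\<^sup>2) \<longleftrightarrow> integrable mu (\<lambda>x. (f x)\<^sup>2)"
    using eq by (intro Bochner_Integration.integrable_cong) simp_all
  moreover have "(\<integral>x. (h x - v x)\<^sup>2 \<partial>mu) = (\<integral>x. (f x - v x)\<^sup>2 \<partial>mu)" for v
    using eq by (intro Bochner_Integration.integral_cong) simp_all
  ultimately show ?thesis using f by (simp add: continuous_closure_def L2_space_def)
qed

text \<open>A compact set inside \<open>A\<close> and an open set around \<open>A\<close> of nearly the same measure are separated by a
  continuous function.\<close>

lemma closure_indicator:
  assumes A: "A \<in> sets mu"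
  shows "indicator A \<in> continuous_closure"
  unfolding continuous_closure_def
proof (intro CollectI conjI allI impI)
  show L: "indicator A \<in> L2_space mu"
  proof -
    have "(\<lambda>x. (indicator A x :: real)\<^sup>2) = indicator A"
      by (auto simp: indicator_def)
    then show ?thesis using A by (auto simp: L2_space_def mu.emeasure_finite less_top[symmetric])
  qed
  fix d :: real assume d: "0 < d"
  have AB: "A \<in> sets borel" "A \<subseteq> K" using A by (simp_all add: sets_mu_iff)
  define M where "M = distr mu borel (\<lambda>x. x)"
  have id: "(\<lambda>x. x) \<in> measurable mu borel"
    unfolding measurable_cong_sets[OF sets_mu refl] by (rule measurable_restrict_space1) simp
  have M: "emeasure M X = emeasure mu (X \<inter> K)" if "X \<in> sets borel" for X
    using that by (simp add: M_def emeasure_distr[OF id])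
  have sM: "sets M = sets borel" and fM: "emeasure M (space M) \<noteq> \<infinity>"
    using M[of UNIV] by (simp_all add: M_def emeasure_K)
  have eA: "emeasure M A < \<infinity>" using M[OF AB(1)] mu.emeasure_finite by (simp add: less_top[symmetric])
  obtain C where C: "C \<subseteq> A" "compact C" "emeasure M A < emeasure M C + ennreal (d / 2)"
  proof -
    have sup: "emeasure M A = (SUP K \<in> {K. K \<subseteq> A \<and> compact K}. emeasure M K)"
      by (rule inner_regular[OF sM fM AB(1)])
    have "{} \<in> {K. K \<subseteq> A \<and> compact K}" by simp
    then have "{K. K \<subseteq> A \<and> compact K} \<noteq> {}" by blast
    from SUP_approx_ennreal[OF _ this sup, of "d / 2"]
    have "\<exists>C\<in>{K. K \<subseteq> A \<and> compact K}. emeasure M A < emeasure M C + ennreal (d / 2)"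
      using d eA by (metis half_gt_zero less_irrefl)
    then show ?thesis using that by blast
  qed
  obtain U where U: "A \<subseteq> U" "open U" "emeasure M U < emeasure M A + ennreal (d / 2)"
  proof -
    have inf: "emeasure M A = (INF U \<in> {U. A \<subseteq> U \<and> open U}. emeasure M U)"
      by (rule outer_regular[OF sM fM AB(1)])
    have "\<exists>U\<in>{U. A \<subseteq> U \<and> open U}. emeasure M U < emeasure M A + ennreal (d / 2)"
      by (rule INF_approx_ennreal[OF _ inf]) (simp add: d, metis eA less_irrefl)
    then show ?thesis using that by blast
  qed
  have cB: "C \<in> sets borel" and uB: "U \<in> sets borel"
    using C(2) U(2) by (auto intro: borel_closed compact_imp_closed)
  have small: "measure M (U - C) < d"
  proof -
    interpret M: finite_measure M by (rule finite_measureI) (use fM in simp)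
    have "measure M A < measure M C + d / 2"
      using C(3) d unfolding M.emeasure_eq_measure by (simp add: ennreal_plus[symmetric] ennreal_less_iff del: ennreal_plus)
    moreover have "measure M U < measure M A + d / 2"
      using U(3) d unfolding M.emeasure_eq_measure by (simp add: ennreal_plus[symmetric] ennreal_less_iff del: ennreal_plus)
    moreover have "measure M (U - C) = measure M U - measure M C"
      using cB uB C(1) U(1) sM by (intro M.finite_measure_Diff) auto
    ultimately show ?thesis by linarith
  qed
  obtain v :: "plane \<Rightarrow> real" where v: "continuous_on UNIV v" "\<And>x. v x \<in> closed_segment 1 0"
    "\<And>x. x \<in> C \<Longrightarrow> v x = 1" "\<And>x. x \<in> - U \<Longrightarrow> v x = 0"
    using Urysohn[of C "- U" "1::real" 0] C U by (auto simp: compact_imp_closed)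
  have v01: "0 \<le> v x" "v x \<le> 1" for x using v(2)[of x] by (auto simp: closed_segment_eq_real_ivl)
  have cv: "continuous_on K v" using v(1) by (rule continuous_on_subset) simp
  have UC: "(U - C) \<inter> K \<in> sets mu" using cB uB K_borel by (simp add: sets_mu_iff)
  have "(\<integral>x. (indicator A x - v x)\<^sup>2 \<partial>mu) \<le> (\<integral>x. indicator ((U - C) \<inter> K) x \<partial>mu)"
  proof (rule integral_mono)
    show "integrable mu (\<lambda>x. (indicator A x - v x)\<^sup>2)"
      by (rule L2_integrable(3)[OF L2_diff[OF L continuous_L2[OF cv]]])
    show "integrable mu (indicator ((U - C) \<inter> K) :: _ \<Rightarrow> real)"
      using UC mu.emeasure_finite by (intro integrable_real_indicator) (auto simp: less_top[symmetric])
    fix x assume x: "x \<in> space mu"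
    have "(1 - t)\<^sup>2 \<le> 1" "t\<^sup>2 \<le> 1" if "0 \<le> t" "t \<le> 1" for t :: real
      using that by (auto intro: power_le_one)
    then show "(indicator A x - v x)\<^sup>2 \<le> indicator ((U - C) \<inter> K) x"
      using v01[of x] v(3)[of x] v(4)[of x] C(1) U(1) x by (auto split: split_indicator)
  qed
  also have "\<dots> = measure mu ((U - C) \<inter> K)" using UC by simp
  also have "\<dots> = measure M (U - C)" using M[of "U - C"] cB uB by (simp add: measure_def)
  finally show "\<exists>v. continuous_on K v \<and> (\<integral>x. (indicator A x - v x)\<^sup>2 \<partial>mu) < d" using small cv by force
qed

lemma closure_sum:
  assumes "finite I" "\<And>i. i \<in> I \<Longrightarrow> f i \<in> continuous_closure"
  shows "(\<lambda>x. \<Sum>i\<in>I. f i x) \<in> continuous_closure"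
  using assms
proof (induction I rule: finite_induct)
  case empty
  have "(\<lambda>x. 0 * indicator {} x) \<in> continuous_closure"
    by (rule closure_scale[OF closure_indicator]) simp
  then show ?case by simp
next
  case (insert i I)
  then show ?case by (simp add: closure_add)
qed

lemma continuous_dense_L2:
  assumes f: "f \<in> L2_space mu" and d: "0 < (d::real)"
  obtains v where "continuous_on K v" "(\<integral>x. (f x - v x)\<^sup>2 \<partial>mu) < d"
proof -
  note [measurable] = L2_integrable(1)[OF f]
  obtain s where s: "\<forall>i. simple_function mu (s i)" "\<forall>x\<in>space mu. (\<lambda>i. s i x) \<longlonglongrightarrow> f x"
    "\<forall>i. \<forall>x\<in>space mu. dist (s i x) 0 \<le> 2 * dist (f x) 0"
    using borel_measurable_implies_sequence_metric[OF L2_integrable(1)[OF f], of 0] by blast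
  have [measurable]: "s i \<in> borel_measurable mu" for i
    using s(1) borel_measurable_simple_function by blast
  have s_closure: "s i \<in> continuous_closure" for i
  proof -
    let ?A = "\<lambda>y. s i -` {y} \<inter> space mu"
    have fin: "finite (s i ` space mu)" "\<And>y. y \<in> s i ` space mu \<Longrightarrow> ?A y \<in> sets mu"
      using s(1) by (auto simp: simple_function_def)
    have "(\<lambda>x. \<Sum>y\<in>s i ` space mu. y * indicator (?A y) x) \<in> continuous_closure"
      by (intro closure_sum fin closure_scale closure_indicator)
    then show ?thesis
    proof (rule closure_cong)
      fix x assume x: "x \<in> K"
      have "(\<Sum>y\<in>s i ` space mu. y * indicator (?A y) x) = (\<Sum>y\<in>{s i x}. y * indicator (?A y) x)"
        using x fin(1) by (intro sum.mono_neutral_right) (auto split: split_indicator)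
      then show "s i x = (\<Sum>y\<in>s i ` space mu. y * indicator (?A y) x)" using x by simp
    qed
  qed
  have "(\<lambda>i. \<integral>x. (f x - s i x)\<^sup>2 \<partial>mu) \<longlonglongrightarrow> (\<integral>x. 0 \<partial>mu)"
  proof (rule integral_dominated_convergence[where w = "\<lambda>x. 9 * (f x)\<^sup>2"])
    show "integrable mu (\<lambda>x. 9 * (f x)\<^sup>2)" using L2_integrable(3)[OF f] by simp
    show "AE x in mu. (\<lambda>i. (f x - s i x)\<^sup>2) \<longlonglongrightarrow> 0"
    proof (rule AE_I2)
      fix x assume "x \<in> space mu"
      then have "(\<lambda>i. (f x - s i x)\<^sup>2) \<longlonglongrightarrow> (f x - f x)\<^sup>2"
        using s(2) by (intro tendsto_intros) auto
      then show "(\<lambda>i. (f x - s i x)\<^sup>2) \<longlonglongrightarrow> 0" by simp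
    qed
    fix i
    show "AE x in mu. norm ((f x - s i x)\<^sup>2) \<le> 9 * (f x)\<^sup>2"
    proof (rule AE_I2)
      fix x assume "x \<in> space mu"
      then have "\<bar>s i x\<bar> \<le> 2 * \<bar>f x\<bar>" using s(3) by (simp add: dist_real_def)
      then have "\<bar>f x - s i x\<bar> \<le> 3 * \<bar>f x\<bar>" by linarith
      then have "\<bar>f x - s i x\<bar>\<^sup>2 \<le> (3 * \<bar>f x\<bar>)\<^sup>2" by (intro power_mono) auto
      then show "norm ((f x - s i x)\<^sup>2) \<le> 9 * (f x)\<^sup>2" by (simp add: power_mult_distrib)
    qed
  qed measurable
  then have "\<forall>\<^sub>F i in sequentially. (\<integral>x. (f x - s i x)\<^sup>2 \<partial>mu) < d / 4"
    using d by (intro order_tendstoD) auto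
  then obtain i where i: "(\<integral>x. (f x - s i x)\<^sup>2 \<partial>mu) < d / 4" by (auto simp: eventually_sequentially)
  have "0 < d / 4" using d by simp
  then obtain v where v: "continuous_on K v" "(\<integral>x. (s i x - v x)\<^sup>2 \<partial>mu) < d / 4"
    using s_closure[of i] unfolding continuous_closure_def by blast
  have "s i \<in> L2_space mu" using s_closure[of i] by (simp add: continuous_closure_def)
  from L2_dist_triangle[OF f this continuous_L2[OF v(1)]] have "(\<integral>x. (f x - v x)\<^sup>2 \<partial>mu) < d"
    using i v(2) by linarith
  then show ?thesis using that v(1) by blast
qed

lemma osc_class_dense_in_L2:
  assumes "osc_class (2/17) \<subseteq> B" "B \<subseteq> L2_space mu"
  shows "dense_in_L2 mu B"
  unfolding dense_in_L2_def
proof (intro conjI ballI allI impI)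
  fix f :: "plane \<Rightarrow> real" and e :: real
  assume f: "f \<in> L2_space mu" and e: "0 < e"
  then have d: "0 < e\<^sup>2 / 4" by simp
  obtain v where v: "continuous_on K v" "(\<integral>x. (f x - v x)\<^sup>2 \<partial>mu) < e\<^sup>2 / 4" using continuous_dense_L2[OF f d] .
  obtain u where u: "u \<in> osc_class (2/17)" "(\<integral>x. (v x - u x)\<^sup>2 \<partial>mu) < e\<^sup>2 / 4" using plateau_dense[OF v(1) d] .
  have "u \<in> L2_space mu" using u(1) assms by blast
  from L2_dist_triangle[OF f continuous_L2[OF v(1)] this] have "(\<integral>x. (f x - u x)\<^sup>2 \<partial>mu) < e\<^sup>2"
    using v(2) u(2) by linarith
  then have "L2_norm mu (\<lambda>x. f x - u x) < e"
    unfolding L2_norm_def using e real_sqrt_less_mono by fastforce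
  then show "\<exists>u\<in>B. L2_norm mu (\<lambda>x. f x - u x) < e" using u(1) assms(1) by blast
qed (use assms in blast)

section \<open>The critical exponents\<close>

text \<open>On the cells shrinking to a corner a continuous function is uniformly close to its value there.\<close>

lemma vertex_avg_continuous:
  assumes u: "continuous_on K u" and a: "a \<in> corners"
  shows "vertex_avg u a [] \<longlonglongrightarrow> u (lattice_pt a)"
proof (rule LIMSEQ_I)
  fix e :: real assume e: "0 < e"
  obtain n0 where n0: "uniform_osc_le u n0 (e / 2)"
    using uniform_osc[OF u, of "e / 2"] e by auto
  have "\<bar>vertex_avg u a [] n - u (lattice_pt a)\<bar> < e" if n: "n \<ge> n0" for n
  proof -
    let ?w = "replicate n (corner_cell a)" and ?t = "u (lattice_pt a)"
    have w: "?w \<in> words n" by (rule words_replicate[OF corner_cell_in_S[OF a]])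
    have near: "\<bar>u x - ?t\<bar> \<le> e / 2" if x: "x \<in> piece ?w" for x
    proof -
      obtain y where y: "y \<in> K" "x = word_map ?w y" using x by blast
      have split: "?w = replicate n0 (corner_cell a) @ replicate (n - n0) (corner_cell a)"
        using n by (simp flip: replicate_add)
      have "x = word_map (replicate n0 (corner_cell a)) (word_map (replicate (n - n0) (corner_cell a)) y)"
        unfolding y(2) word_map_append[symmetric] split[symmetric] ..
      then show ?thesis
        using n0[rule_format, OF words_replicate[OF corner_cell_in_S[OF a]]
            word_map_in_K[OF words_replicate[OF corner_cell_in_S[OF a]] y(1)] corner_in_K[OF a]]
        by (simp add: word_map_corner)
    qed
    have "ennreal ((avg u ?w - ?t)\<^sup>2 / 17 ^ n) \<le> (\<integral>\<^sup>+x\<in>piece ?w. ennreal ((u x - ?t)\<^sup>2) \<partial>mu)"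
      by (rule avg_deviation[OF continuous_L2[OF u] w])
    also have "\<dots> \<le> (\<integral>\<^sup>+x. ennreal ((e / 2)\<^sup>2) * indicator (piece ?w) x \<partial>mu)"
    proof (rule nn_integral_mono)
      fix x
      have "(u x - ?t)\<^sup>2 \<le> (e / 2)\<^sup>2" if "x \<in> piece ?w"
        using power_mono[OF near[OF that], of 2] by simp
      then show "ennreal ((u x - ?t)\<^sup>2) * indicator (piece ?w) x \<le> ennreal ((e / 2)\<^sup>2) * indicator (piece ?w) x"
        by (auto split: split_indicator intro: ennreal_leI)
    qed
    also have "\<dots> = ennreal ((e / 2)\<^sup>2 / 17 ^ n)"
      using word_cell_sets[OF w] by (simp add: nn_integral_cmult_indicator emeasure_word_cell[OF w] ennreal_mult[symmetric])
    finally have "(avg u ?w - ?t)\<^sup>2 / 17 ^ n \<le> (e / 2)\<^sup>2 / 17 ^ n" by (simp add: ennreal_le_iff)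
    then have "(avg u ?w - ?t)\<^sup>2 \<le> (e / 2)\<^sup>2" by (simp add: divide_le_cancel)
    then have "\<bar>avg u ?w - ?t\<bar> \<le> e / 2" using e by (simp add: abs_le_square_iff[symmetric])
    then show ?thesis using e by (simp add: vertex_avg_def)
  qed
  then show "\<exists>no. \<forall>n\<ge>no. norm (vertex_avg u a [] n - u (lattice_pt a)) < e" by auto
qed

lemma powr_star: "7 powr (\<alpha> + 2 * (1/2 * (1 + ln 17 / ln 7))) = 7 * 289"
proof -
  have "a + 2 * (1/2 * (1 + a)) = a + a + 1" for a :: real by simp
  then have "\<alpha> + 2 * (1/2 * (1 + ln 17 / ln 7)) = \<alpha> + \<alpha> + 1" unfolding alpha .
  then show ?thesis by (simp only: powr_add powr_7_alpha) simp
qed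

lemma powr_sharp: "7 powr (\<alpha> + 2 * (1/2 * ((2 * ln 17 - ln 2) / ln 7))) = 17 ^ 3 / 2"
proof -
  have "\<alpha> + 2 * (1/2 * ((2 * ln 17 - ln 2) / ln 7)) = \<alpha> + \<alpha> + \<alpha> - ln 2 / ln 7"
    by (simp add: alpha diff_divide_distrib)
  moreover have "7 powr (ln 2 / ln 7) = (2::real)" by (simp add: powr_def)
  ultimately show ?thesis by (simp only: powr_add powr_diff powr_7_alpha) simp
qed

text \<open>The continuous functions in the space take equal values at \<open>p1\<close> and \<open>p3\<close>, so they cannot approximate the
  third barycentric coordinate.\<close>

lemma not_dense_above:
  assumes s: "1/2 * (1 + ln 17 / ln 7) < \<sigma>"
  shows "\<not> dense_in_C K (besov_space \<alpha> K \<sigma>)"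
proof
  assume dense: "dense_in_C K (besov_space \<alpha> K \<sigma>)"
  have "7 * 289 < 7 powr (\<alpha> + 2 * \<sigma>)"
    unfolding powr_star[symmetric] by (intro powr_less_mono add_strict_left_mono mult_strict_left_mono s) auto
  then have rate: "7 * decay_rate \<sigma> < 1" by (simp add: decay_rate_def divide_less_eq)
  then have rate1: "decay_rate \<sigma> < 1" using decay_rate_pos[of \<sigma>] by linarith
  have cY: "continuous_on K coordY" unfolding coordY_def by (auto intro!: continuous_intros)
  obtain u where u: "u \<in> besov_space \<alpha> K \<sigma>" "continuous_on K u" "\<forall>x\<in>K. \<bar>coordY x - u x\<bar> < 1/3"
    using dense[unfolded dense_in_C_def, rule_format, OF cY, of "1/3"] by auto
  have E: "(0,0) \<in> corners" "(0,1) \<in> corners" by (auto simp: corners_def)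
  obtain C where lim: "\<forall>n. \<forall>a\<in>corners. \<forall>w\<in>words n. vertex_avg u a w \<longlonglongrightarrow> vertex_value u a w"
    by (rule vertex_value_decay[OF u(1) rate1])
  have "vertex_value u a [] = u (lattice_pt a)" if a: "a \<in> corners" for a
    using LIMSEQ_unique[OF lim[rule_format, OF a, of "[]" 0] vertex_avg_continuous[OF u(2) a]] by simp
  then have "u (lattice_pt (0,1)) = u (lattice_pt (0,0))"
    using segment_constant[OF u(1) rate, of "[]" 0] E by simp
  moreover have "\<bar>1 - u (lattice_pt (0,1))\<bar> < 1/3" "\<bar>0 - u (lattice_pt (0,0))\<bar> < 1/3"
    using u(3)[rule_format, OF corner_in_K[OF E(2)]] u(3)[rule_format, OF corner_in_K[OF E(1)]] by simp_all
  ultimately show False by linarith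
qed

lemma constant_above:
  assumes s: "1/2 * ((2 * ln 17 - ln 2) / ln 7) < \<sigma>" and u: "u \<in> besov_space \<alpha> K \<sigma>"
  shows "\<exists>b. AE x in mu. u x = b"
proof -
  have "17 ^ 3 / 2 < 7 powr (\<alpha> + 2 * \<sigma>)"
    unfolding powr_sharp[symmetric] by (intro powr_less_mono add_strict_left_mono mult_strict_left_mono s) auto
  then have "17/2 * decay_rate \<sigma> < 1" by (simp add: decay_rate_def divide_less_eq)
  then show ?thesis by (rule besov_constant[OF u])
qed

lemma star_osc_class: "osc_class (1/7) \<subseteq> besov_space \<alpha> K (1/2 * (1 + ln 17 / ln 7))"
proof
  fix u assume "u \<in> osc_class (1/7)"
  then show "u \<in> besov_space \<alpha> K (1/2 * (1 + ln 17 / ln 7))"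
    by (rule osc_class_besov) (simp_all only: powr_star, simp_all add: add_pos_pos)
qed

lemma sharp_osc_class:
  assumes "0 < \<sigma>" "\<sigma> \<le> 1/2 * ((2 * ln 17 - ln 2) / ln 7)"
  shows "osc_class (2/17) \<subseteq> besov_space \<alpha> K \<sigma>"
proof
  fix u assume u: "u \<in> osc_class (2/17)"
  have "7 powr (\<alpha> + 2 * \<sigma>) \<le> 17 ^ 3 / 2"
    unfolding powr_sharp[symmetric] by (intro powr_mono add_left_mono mult_left_mono assms(2)) auto
  then show "u \<in> besov_space \<alpha> K \<sigma>"
    using assms(1) by (intro osc_class_besov[OF u]) simp_all
qed

text \<open>If \<open>g\<close> were almost everywhere constant, then all its averages would equal this constant, but their limits
  at two corners differ.\<close>

lemma osc_class_nonconstant: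
  obtains u where "u \<in> osc_class (2/17)" "\<not> (\<exists>b. AE x in mu. u x = b)"
proof -
  obtain g where g: "g \<in> osc_class (2/17)" "g (lattice_pt (0,0)) = 0" "g (lattice_pt (1,0)) = 1"
    using g_exists .
  have cg: "continuous_on K g" by (rule osc_class_continuous[OF g(1)]) simp_all
  have "\<not> (AE x in mu. g x = b)" for b
  proof
    assume b: "AE x in mu. g x = b"
    have avg: "avg g w = b" if w: "w \<in> words n" for w n
    proof -
      have "(\<integral>x. indicator (piece w) x * g x \<partial>mu) = (\<integral>x. indicator (piece w) x * b \<partial>mu)"
        using b L2_integrable(1)[OF continuous_L2[OF cg]] word_cell_sets[OF w]
        by (intro integral_cong_AE) (auto elim: eventually_mono)
      also have "\<dots> = b / 17 ^ n"
        using word_cell_sets[OF w] by (simp add: sets_mu_iff Int_absorb2 measure_word_cell[OF w])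
      finally show ?thesis by (simp add: avg_def length_words[OF w])
    qed
    have "g (lattice_pt a) = b" if a: "a \<in> corners" for a
    proof -
      have "vertex_avg g a [] = (\<lambda>n. b)"
        using avg[OF words_replicate[OF corner_cell_in_S[OF a]]] by (simp add: vertex_avg_def fun_eq_iff)
      then show ?thesis using vertex_avg_continuous[OF cg a] by (simp add: LIMSEQ_const_iff)
    qed
    then show False using g(2,3) by (simp add: corners_def)
  qed
  then show ?thesis using that g(1) by blast
qed

lemma star_pos: "0 < 1/2 * (1 + ln 17 / ln (7::real))"
  by (simp add: add_pos_pos)

lemma sharp_pos: "0 < 1/2 * ((2 * ln 17 - ln 2) / ln (7::real))"
proof -
  have "ln 2 < ln (17::real)" "0 < ln (17::real)" by simp_all
  then show ?thesis by (intro mult_pos_pos divide_pos_pos) (linarith | simp)+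
qed

lemma star_dense: "dense_in_C K (besov_space \<alpha> K (1/2 * (1 + ln 17 / ln 7)))"
  by (rule osc_class_dense_in_C[OF star_osc_class])

lemma sigma_star_eq: "sigma_star \<alpha> K = ereal (1/2 * (1 + ln 17 / ln 7))"
  unfolding sigma_star_def
proof (rule antisym)
  show "(SUP \<sigma> \<in> {\<sigma>. 0 < \<sigma> \<and> dense_in_C K (besov_space \<alpha> K \<sigma>)}. ereal \<sigma>) \<le> ereal (1/2 * (1 + ln 17 / ln 7))"
  proof (rule SUP_least)
    fix \<sigma> assume "\<sigma> \<in> {\<sigma>. 0 < \<sigma> \<and> dense_in_C K (besov_space \<alpha> K \<sigma>)}"
    then have "\<not> 1/2 * (1 + ln 17 / ln 7) < \<sigma>" using not_dense_above by blast
    then show "ereal \<sigma> \<le> ereal (1/2 * (1 + ln 17 / ln 7))" by (simp only: ereal_less_eq(3) not_less)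
  qed
  show "ereal (1/2 * (1 + ln 17 / ln 7)) \<le> (SUP \<sigma> \<in> {\<sigma>. 0 < \<sigma> \<and> dense_in_C K (besov_space \<alpha> K \<sigma>)}. ereal \<sigma>)"
    by (rule SUP_upper) (use star_pos star_dense in blast)
qed

lemma sigma_sharp_eq: "sigma_sharp \<alpha> K = ereal (1/2 * ((2 * ln 17 - ln 2) / ln 7))"
  unfolding sigma_sharp_def
proof (rule antisym)
  let ?s = "1/2 * ((2 * ln 17 - ln 2) / ln (7::real))"
  show "(SUP \<sigma> \<in> {\<sigma>. 0 < \<sigma> \<and> (\<exists>u\<in>besov_space \<alpha> K \<sigma>. \<not> (\<exists>b. AE x in mu. u x = b))}. ereal \<sigma>) \<le> ereal ?s"
  proof (rule SUP_least)
    fix \<sigma> assume "\<sigma> \<in> {\<sigma>. 0 < \<sigma> \<and> (\<exists>u\<in>besov_space \<alpha> K \<sigma>. \<not> (\<exists>b. AE x in mu. u x = b))}"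
    then have "\<not> ?s < \<sigma>" using constant_above by blast
    then show "ereal \<sigma> \<le> ereal ?s" by (simp only: ereal_less_eq(3) not_less)
  qed
  obtain u where u: "u \<in> osc_class (2/17)" "\<not> (\<exists>b. AE x in mu. u x = b)" using osc_class_nonconstant .
  have "u \<in> besov_space \<alpha> K ?s" using sharp_osc_class[OF sharp_pos order_refl] u(1) by blast
  then show "ereal ?s \<le> (SUP \<sigma> \<in> {\<sigma>. 0 < \<sigma> \<and> (\<exists>u\<in>besov_space \<alpha> K \<sigma>. \<not> (\<exists>b. AE x in mu. u x = b))}. ereal \<sigma>)"
    using sharp_pos u(2) by (intro SUP_upper) blast
qed

end

theorem theorem5p8:
  fixes c :: "nat \<Rightarrow> nat \<times> nat" and z :: "nat \<Rightarrow> plane" and K :: "plane set" and \<alpha> :: real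
  assumes "right_chain c z"
    and "is_sickle c K"
    and "\<alpha> = ln 17 / ln 7"
  shows "sigma_star \<alpha> K = ereal (1/2 * (1 + ln 17 / ln 7))
    \<and> sigma_sharp \<alpha> K = ereal (1/2 * ((2 * ln 17 - ln 2) / ln 7))
    \<and> dense_in_C K (besov_space \<alpha> K (real_of_ereal (sigma_star \<alpha> K)))
    \<and> (\<forall>\<sigma>::real. sigma_star \<alpha> K < ereal \<sigma> \<and> ereal \<sigma> \<le> sigma_sharp \<alpha> K \<longrightarrow>
         dense_in_L2 (normalized_hausdorff \<alpha> K) (besov_space \<alpha> K \<sigma>))"
proof -
  interpret sickle c z K \<alpha> by (rule sickle.intro[OF assms])
  have "dense_in_L2 mu (besov_space \<alpha> K \<sigma>)"
    if "sigma_star \<alpha> K < ereal \<sigma>" "ereal \<sigma> \<le> sigma_sharp \<alpha> K" for \<sigma>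
  proof (rule osc_class_dense_in_L2)
    show "osc_class (2/17) \<subseteq> besov_space \<alpha> K \<sigma>"
      using that star_pos unfolding sigma_star_eq sigma_sharp_eq ereal_less_eq(3) less_ereal.simps(1)
      by (intro sharp_osc_class) linarith+
    show "besov_space \<alpha> K \<sigma> \<subseteq> L2_space mu" by (auto simp: besov_space_def)
  qed
  moreover have "dense_in_C K (besov_space \<alpha> K (real_of_ereal (sigma_star \<alpha> K)))"
    unfolding sigma_star_eq real_of_ereal.simps by (rule star_dense)
  ultimately show ?thesis using sigma_star_eq sigma_sharp_eq by blast
qed

end
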